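(* Let $F\in\mathcal S(]-\infty,0],\mathbb C)$, extended to $\mathbb R$ as an even function. For every real $y>0$, $$\sum_{n=0}^{+\infty}r_nF(ny)=\frac{\pi}{y}\int_0^{+\infty}F(u)\,du+\frac1y\sum_{n=1}^{+\infty}r_n\int_0^{+\infty}\sin\Bigl(\frac{\pi^2n}{yu}\Bigr)\widehat F(u)\,\frac{du}{u}.$$
   Context: $r_n=\#\{(a,b)\in\mathbb Z^2: a^2+b^2=n\}$ (so $r_0=1$). $\mathcal S(]-\infty,0],\mathbb C)$ is the space of functions $F\in C^\infty(]-\infty,0],\mathbb C)$ (one-sided derivatives at $0$) such that $\lim_{t\to-\infty}|t|^mF^{(n)}(t)=0$ for all integers $n,m\ge 0$. The Fourier transform of the even function $F$ is $\widehat F(x)=\int_{\mathbb R}F(u)e^{-ixu}du=2\int_0^{+\infty}F(u)\cos(xu)\,du$. The integrals $\int_0^{+\infty}\sin(\pi^2n/(yu))\widehat F(u)\frac{du}{u}$ are improper (conditionally convergent) at $u=0^+$. *)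

theory Defs
  imports "HOL-Analysis.Analysis"
begin

definition r2 :: "nat \<Rightarrow> nat" where
  "r2 n = card {(a :: int, b :: int). a\<^sup>2 + b\<^sup>2 = int n}"

(* Iterated derivatives relative to ]-oo,0]: one-sided at 0, and depending only on the
   values of F on ]-oo,0]. *)
primrec deriv_nonpos :: "nat \<Rightarrow> (real \<Rightarrow> complex) \<Rightarrow> real \<Rightarrow> complex" where
  "deriv_nonpos 0 F = F"
| "deriv_nonpos (Suc n) F = (\<lambda>t. vector_derivative (deriv_nonpos n F) (at t within {..0}))"

definition smooth_nonpos :: "(real \<Rightarrow> complex) \<Rightarrow> bool" where
  "smooth_nonpos F \<longleftrightarrow>
     (\<forall>n. \<forall>t\<le>0. deriv_nonpos n F differentiable (at t within {..0}))"

(* Functions on ]-oo,0] are represented by total functions whose values on ]0,+oo[ are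
   arbitrary. *)
definition schwartz_nonpos :: "(real \<Rightarrow> complex) set" where
  "schwartz_nonpos =
     {F. smooth_nonpos F \<and>
         (\<forall>n m. ((\<lambda>t. of_real (\<bar>t\<bar> ^ m) * deriv_nonpos n F t) \<longlongrightarrow> 0) at_bot)}"

definition even_ext :: "(real \<Rightarrow> complex) \<Rightarrow> real \<Rightarrow> complex" where
  "even_ext F t = F (- \<bar>t\<bar>)"

definition fourier :: "(real \<Rightarrow> complex) \<Rightarrow> real \<Rightarrow> complex" where
  "fourier f x = (LBINT u. f u * exp (- (\<i> * of_real x * of_real u)))"

(* Integrals over ]0,+oo[ that are absolutely convergent at infinity and improper at 0. *)
definition improper_convergent :: "(real \<Rightarrow> complex) \<Rightarrow> bool" where
  "improper_convergent g \<longleftrightarrow>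
     (\<forall>\<epsilon>>0. set_integrable lborel {\<epsilon><..} g) \<and>
     (\<exists>l. ((\<lambda>\<epsilon>. LBINT u:{\<epsilon><..}. g u) \<longlongrightarrow> l) (at_right 0))"

definition improper_integral :: "(real \<Rightarrow> complex) \<Rightarrow> complex" where
  "improper_integral g = Lim (at_right 0) (\<lambda>\<epsilon>. LBINT u:{\<epsilon><..}. g u)"

definition sine_kernel_integrand ::
  "(real \<Rightarrow> complex) \<Rightarrow> real \<Rightarrow> nat \<Rightarrow> real \<Rightarrow> complex" where
  "sine_kernel_integrand f y n u =
     of_real (sin (pi\<^sup>2 * real n / (y * u))) * fourier f u / of_real u"

end

(* Put f t = F (- t) for t >= 0. The n-th integral on the right equals pi times the integral over t >= 0
   of f t * J_0 (2 sqrt (A t)) with A = pi^2 n / y, the Bessel kernel of the plane Fourier transform.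
   Integration by parts against the Bessel kernel bounds it by a multiple of n^(-3/2), and
   r_n (1 + n)^(-3/2) is summable. Hence both sides of the formula are linear in f and continuous for
   the norm sup (1 + t)^6 |f''' t|, and it suffices to treat exponentials exp (- s t), s > 0, whose span
   is dense for this norm. For them the formula is the functional equation of the square of Jacobi's
   theta function, and the identification of the n-th integral is the Laplace integral
   of v sin (A v) / (v^2 + s^(-2)) over v >= 0, evaluated with Cauchy's formula. *)
theory Submission
  imports Defs "HOL-Probability.Probability" "HOL-Complex_Analysis.Complex_Analysis" "HOL-Real_Asymp.Real_Asymp"
begin

section \<open>The theta function and sums over the square lattice\<close>

text \<open>The sine integrals converge only conditionally at 0, so absolute convergence does not
  permit exchanging them with the integral that defines the Fourier transform. Comparing bounded
  linear functionals on exponentials avoids any such exchange. The exponent 3/2 matters: r_n equals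
  pi on average, so a bound of order 1/n would not make the dual series converge absolutely. One
  full round of integration by parts yields only 1/n, which is why a third derivative enters. The
  norm looks at the third derivative alone because the lower ones are recovered by integration from
  infinity; density then reduces to Weierstrass approximation of a single function. The
  approximation consumes one power of t, hence the decay of order 7 asked of that derivative,
  against order 6 in the norm.\<close>

lemma infsum_bounded_terms_integral:
  fixes f :: "'i \<Rightarrow> real \<Rightarrow> real"
  assumes cont: "\<And>i. continuous_on {a..b} (f i)"
    and bound: "\<And>i x. x \<in> {a..b} \<Longrightarrow> \<bar>f i x\<bar> \<le> M i" and M: "M summable_on UNIV"
  shows "continuous_on {a..b} (\<lambda>x. \<Sum>\<^sub>\<infinity>i. f i x)"
    and "((\<lambda>i. integral {a..b} (f i)) has_sum integral {a..b} (\<lambda>x. \<Sum>\<^sub>\<infinity>i. f i x)) UNIV"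
proof -
  \<comment> \<open>The M-test works along the net of finite subsets, so continuity and termwise
    integration hold for sums over the integers without choosing an order of summation.\<close>
  have u: "uniform_limit {a..b} (\<lambda>X x. \<Sum>i\<in>X. f i x) (\<lambda>x. \<Sum>\<^sub>\<infinity>i. f i x) (finite_subsets_at_top UNIV)"
    by (rule Weierstrass_m_test_general[OF _ M]) (use bound in auto)
  have c: "continuous_on {a..b} (\<lambda>x. \<Sum>i\<in>X. f i x)" for X
    by (intro continuous_intros cont)
  show "continuous_on {a..b} (\<lambda>x. \<Sum>\<^sub>\<infinity>i. f i x)"
    by (rule uniform_limit_theorem[OF _ u]) (auto intro: c)
  obtain I J where I: "\<And>X. ((\<lambda>x. \<Sum>i\<in>X. f i x) has_integral I X) {a..b}"
    and J: "((\<lambda>x. \<Sum>\<^sub>\<infinity>i. f i x) has_integral J) {a..b}"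
    and lim: "(I \<longlongrightarrow> J) (finite_subsets_at_top UNIV)"
    by (rule uniform_limit_integral[OF u c]) auto
  have "I X = (\<Sum>i\<in>X. integral {a..b} (f i))" if "finite X" for X
    using has_integral_unique[OF I[of X] has_integral_sum[OF that, of f "\<lambda>i. integral {a..b} (f i)"]] cont
    by (simp add: integrable_continuous_real integrable_integral)
  moreover have "eventually (\<lambda>X. finite X) (finite_subsets_at_top (UNIV::'i set))"
    by (simp add: eventually_finite_subsets_at_top_weakI)
  ultimately have "((\<lambda>X. \<Sum>i\<in>X. integral {a..b} (f i)) \<longlongrightarrow> J) (finite_subsets_at_top UNIV)"
    using lim by (elim Lim_transform_eventually) (auto elim: eventually_mono)
  then show "((\<lambda>i. integral {a..b} (f i)) has_sum integral {a..b} (\<lambda>x. \<Sum>\<^sub>\<infinity>i. f i x)) UNIV"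
    using J by (simp add: has_sum_def integral_unique)
qed

lemma summable_on_int_abs:
  fixes f :: "nat \<Rightarrow> real"
  assumes "summable f" "\<And>n. f n \<ge> 0"
  shows "(\<lambda>k::int. f (nat \<bar>k\<bar>)) summable_on UNIV"
proof -
  have f: "f summable_on UNIV"
    using assms by (subst summable_on_UNIV_nonneg_real_iff) auto
  have 1: "(\<lambda>k::int. f (nat \<bar>k\<bar>)) summable_on range int"
    by (subst summable_on_reindex) (auto simp: o_def f)
  have 2: "(\<lambda>k::int. f (nat \<bar>k\<bar>)) summable_on range (\<lambda>n. - int n)"
    by (subst summable_on_reindex) (auto simp: o_def f inj_def)
  have "range int \<union> range (\<lambda>n. - int n) = UNIV"
    by (auto intro: int_cases2)
  then show ?thesis
    using summable_on_union[OF 1 2] by simp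
qed

lemma summable_on_gaussian:
  fixes c :: real
  assumes "c > 0"
  shows "(\<lambda>k::int. exp (- c * (of_int k)\<^sup>2)) summable_on (UNIV :: int set)"
proof -
  have "summable (\<lambda>n::nat. exp (- c * (real n)\<^sup>2))"
  proof (rule summable_comparison_test_ev)
    show "summable (\<lambda>n. exp (- c) ^ n)" by (rule summable_geometric) (use assms in auto)
    have "- c * (real n)\<^sup>2 \<le> real n * - c" for n
      using assms by (cases n) (auto simp: power2_eq_square field_simps)
    then show "\<forall>\<^sub>F n in sequentially. norm (exp (- c * (real n)\<^sup>2)) \<le> exp (- c) ^ n"
      by (intro always_eventually) (simp add: exp_of_nat_mult[symmetric])
  qed
  from summable_on_int_abs[OF this] show ?thesis by simp
qed

text \<open>This is the characteristic function of the standard normal law after the substitution of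
  \<open>s * x\<close> for the variable, with s = sqrt (2 pi t). The frequency \<open>v\<close> is
  chosen so that v s = 2 pi u. The real part suffices because only cosine coefficients are needed
  later.\<close>

lemma gaussian_cosine_transform:
  fixes t u :: real
  assumes t: "t > 0"
  shows "integrable lborel (\<lambda>x. exp (- pi * t * x\<^sup>2) * cos (2 * pi * u * x))"
    and "(LBINT x. exp (- pi * t * x\<^sup>2) * cos (2 * pi * u * x)) = exp (- pi * u\<^sup>2 / t) / sqrt t"
proof -
  define v where "v = sqrt (2 * pi) * u / sqrt t"
  have int: "integrable lborel (\<lambda>x. std_normal_density x * cos (v * x))"
  proof (rule Bochner_Integration.integrable_bound)
    show "integrable lborel std_normal_density" by simp
  qed (auto simp: abs_mult mult_left_le intro!: AE_I2)
  have "Re (char std_normal_distribution v) = (LBINT x. std_normal_density x * cos (v * x))"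
  proof -
    interpret real_distribution std_normal_distribution by (rule real_dist_normal_dist)
    have "Re (char std_normal_distribution v) = (LINT x|std_normal_distribution. cos (v * x))"
      unfolding char_def
      by (subst integral_Re[symmetric]) (auto intro!: integrable_iexp simp: Re_exp)
    then show ?thesis
      by (simp add: integral_density)
  qed
  then have val: "(LBINT x. std_normal_density x * cos (v * x)) = exp (- v\<^sup>2 / 2)"
    unfolding char_std_normal_distribution by (metis Re_complex_of_real)
  define s where "s = sqrt (2 * pi * t)"
  have s: "s > 0" using t by (simp add: s_def)
  have eq: "std_normal_density (0 + s * x) * cos (v * (0 + s * x)) =
      (1 / sqrt (2 * pi)) * (exp (- pi * t * x\<^sup>2) * cos (2 * pi * u * x))" for x
  proof -
    have "v * s = 2 * pi * u"
      using t by (simp add: v_def s_def real_sqrt_mult field_simps)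
    moreover have "(s * x)\<^sup>2 = 2 * pi * t * x\<^sup>2"
      using t by (simp add: s_def power_mult_distrib)
    ultimately show ?thesis
      by (simp add: std_normal_density_def mult.assoc[symmetric])
  qed
  from lborel_integrable_real_affine[OF int, of s 0] s
  have "integrable lborel (\<lambda>x. (1 / sqrt (2 * pi)) * (exp (- pi * t * x\<^sup>2) * cos (2 * pi * u * x)))"
    unfolding eq by simp
  then have "integrable lborel (\<lambda>x. sqrt (2 * pi) *
      ((1 / sqrt (2 * pi)) * (exp (- pi * t * x\<^sup>2) * cos (2 * pi * u * x))))"
    by (rule integrable_mult_right)
  then show "integrable lborel (\<lambda>x. exp (- pi * t * x\<^sup>2) * cos (2 * pi * u * x))"
    by simp
  have "exp (- v\<^sup>2 / 2) = s *\<^sub>R (LBINT x. (1 / sqrt (2 * pi)) * (exp (- pi * t * x\<^sup>2) * cos (2 * pi * u * x)))"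
    using lborel_integral_real_affine[of s "\<lambda>x. std_normal_density x * cos (v * x)" 0] s
    unfolding eq val by simp
  also have "\<dots> = sqrt t * (LBINT x. exp (- pi * t * x\<^sup>2) * cos (2 * pi * u * x))"
    using t by (simp add: s_def real_sqrt_mult)
  finally show "(LBINT x. exp (- pi * t * x\<^sup>2) * cos (2 * pi * u * x)) = exp (- pi * u\<^sup>2 / t) / sqrt t"
    using t by (simp add: v_def power_mult_distrib power_divide field_simps)
qed

text \<open>The symmetry makes \<open>W\<close> a continuous function \<open>V\<close> of cos (2 pi
  x): arccos recovers x on the first half of the interval, and reflection covers the second half.
  Weierstrass approximates \<open>V\<close> by polynomials, and a polynomial in cos (2 pi x) is a
  combination of the cosines to which \<open>W\<close> is orthogonal. Hence the integral of W^2
  vanishes, and no convergence theorem for Fourier series is involved.\<close>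

lemma even_periodic_eq_zero:
  fixes W :: "real \<Rightarrow> real"
  assumes cont: "continuous_on {0..1} W" and refl: "\<And>x. W (1 - x) = W x"
    and coeff: "\<And>k::nat. integral {0..1} (\<lambda>x. W x * cos (2 * pi * real k * x)) = 0"
    and x: "x \<in> {0..1}"
  shows "W x = 0"
proof -
  have powcoeff: "integral {0..1} (\<lambda>x. W x * cos (2 * pi * x) ^ j * cos (2 * pi * real k * x)) = 0" for j k
  proof (induction j arbitrary: k)
    case 0
    then show ?case using coeff by simp
  next
    case (Suc j)
    \<comment> \<open>The product formula trades one factor cos (2 pi x) for the two neighbouring
      frequencies. At k = 0 the lower neighbour is -1, which has the same cosine as 1.\<close>
    have eq: "W x * cos (2 * pi * x) ^ Suc j * cos (2 * pi * real k * x) =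
       (W x * cos (2 * pi * x) ^ j * cos (2 * pi * real (Suc k) * x)) / 2 +
       (W x * cos (2 * pi * x) ^ j * cos (2 * pi * real (if k = 0 then 1 else k - 1) * x)) / 2" for x
    proof -
      have "cos (2 * pi * x) * cos (2 * pi * real k * x) =
        (cos (2 * pi * real (Suc k) * x) + cos (2 * pi * real (if k = 0 then 1 else k - 1) * x)) / 2"
        by (cases k) (auto simp: cos_times_cos algebra_simps)
      then have "W x * cos (2 * pi * x) ^ j * (cos (2 * pi * x) * cos (2 * pi * real k * x)) =
        W x * cos (2 * pi * x) ^ j * ((cos (2 * pi * real (Suc k) * x) + cos (2 * pi * real (if k = 0 then 1 else k - 1) * x)) / 2)"
        by (rule arg_cong)
      then show ?thesis by (simp only: power_Suc distrib_left add_divide_distrib times_divide_eq_right mult_ac)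
    qed
    have i: "(\<lambda>x. W x * cos (2 * pi * x) ^ j * cos (2 * pi * real k * x)) integrable_on {0..1}" for k
      by (intro integrable_continuous_real continuous_intros cont)
    show ?case
      unfolding eq
      by (subst integral_add) (use i Suc in \<open>auto intro!: integrable_divide simp del: of_nat_Suc\<close>)
  qed
  have poly: "integral {0..1} (\<lambda>x. W x * (\<Sum>i\<le>n. a i * cos (2 * pi * x) ^ i)) = 0" for a and n :: nat
  proof -
    have i: "(\<lambda>x. a j * (W x * cos (2 * pi * x) ^ j)) integrable_on {0..1}" for j
      by (intro integrable_continuous_real continuous_intros cont)
    have "integral {0..1} (\<lambda>x. W x * (\<Sum>i\<le>n. a i * cos (2 * pi * x) ^ i)) =
        integral {0..1} (\<lambda>x. \<Sum>i\<le>n. a i * (W x * cos (2 * pi * x) ^ i))"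
      by (simp add: sum_distrib_left mult_ac)
    also have "\<dots> = (\<Sum>i\<le>n. integral {0..1} (\<lambda>x. a i * (W x * cos (2 * pi * x) ^ i)))"
      by (rule integral_sum) (auto intro: i)
    also have "\<dots> = 0"
      using powcoeff[of _ 0] by simp
    finally show ?thesis .
  qed
  define V where "V c = W (arccos c / (2 * pi))" for c
  have rng: "arccos c / (2 * pi) \<in> {0..1}" if "c \<in> {-1..1}" for c
    using that arccos_bounded[of c] by (auto simp: field_simps)
  have Vcont: "continuous_on {-1..1} V"
    unfolding V_def
    by (rule continuous_on_compose2[OF cont, of _ "\<lambda>c. arccos c / (2 * pi)"])
       (use rng in \<open>auto intro!: continuous_intros\<close>)
  have VW: "V (cos (2 * pi * x)) = W x" if "x \<in> {0..1}" for x
  proof (cases "x \<le> 1/2")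
    case True
    then have "arccos (cos (2 * pi * x)) = 2 * pi * x"
      using that by (intro arccos_cos) (auto simp: field_simps)
    then show ?thesis by (simp add: V_def)
  next
    case False
    have "cos (2 * pi * x) = cos (2 * pi * (1 - x))"
      by (simp add: algebra_simps cos_diff)
    moreover have "arccos (cos (2 * pi * (1 - x))) = 2 * pi * (1 - x)"
      using that False by (intro arccos_cos) (auto simp: field_simps)
    ultimately show ?thesis by (simp add: V_def refl)
  qed
  have Wsq: "integral {0..1} (\<lambda>x. W x * W x) \<le> e * integral {0..1} (\<lambda>x. \<bar>W x\<bar>)" if e: "e > 0" for e
  proof -
    obtain g where g: "real_polynomial_function g" "\<And>c. c \<in> {-1..1} \<Longrightarrow> \<bar>V c - g c\<bar> < e"
      using Stone_Weierstrass_real_polynomial_function[OF _ Vcont e] by auto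
    obtain a n where gn: "g = (\<lambda>x. \<Sum>i\<le>n. a i * x ^ i)"
      using g(1) unfolding real_polynomial_function_iff_sum by blast
    have gc: "continuous_on {0..1} (\<lambda>x. g (cos (2 * pi * x)))"
      unfolding gn by (intro continuous_intros)
    have "integral {0..1} (\<lambda>x. W x * W x) = integral {0..1} (\<lambda>x. W x * (W x - g (cos (2 * pi * x))) + W x * g (cos (2 * pi * x)))"
      by (simp add: algebra_simps)
    also have "\<dots> = integral {0..1} (\<lambda>x. W x * (W x - g (cos (2 * pi * x)))) + integral {0..1} (\<lambda>x. W x * g (cos (2 * pi * x)))"
      by (intro integral_add integrable_continuous_real continuous_intros cont gc)
    also have "integral {0..1} (\<lambda>x. W x * g (cos (2 * pi * x))) = 0"
      using poly[of a n] by (simp add: gn)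
    also have "integral {0..1} (\<lambda>x. W x * (W x - g (cos (2 * pi * x)))) \<le> integral {0..1} (\<lambda>x. e * \<bar>W x\<bar>)"
    proof (rule integral_le)
      fix x :: real assume x: "x \<in> {0..1}"
      have "\<bar>W x - g (cos (2 * pi * x))\<bar> \<le> e"
        using g(2)[of "cos (2 * pi * x)"] VW[OF x] by auto
      then have "\<bar>W x * (W x - g (cos (2 * pi * x)))\<bar> \<le> \<bar>W x\<bar> * e"
        unfolding abs_mult by (intro mult_left_mono) auto
      then show "W x * (W x - g (cos (2 * pi * x))) \<le> e * \<bar>W x\<bar>"
        by (simp add: mult.commute)
    qed (intro integrable_continuous_real continuous_intros cont gc)+
    finally show ?thesis by simp
  qed
  have "integral {0..1} (\<lambda>x. W x * W x) \<le> 0"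
  proof (rule tendsto_lowerbound)
    show "((\<lambda>e. e * integral {0..1} (\<lambda>x. \<bar>W x\<bar>)) \<longlongrightarrow> 0) (at_right 0)"
      by (rule tendsto_eq_intros | simp)+
    show "\<forall>\<^sub>F e in at_right 0. integral {0..1} (\<lambda>x. W x * W x) \<le> e * integral {0..1} (\<lambda>x. \<bar>W x\<bar>)"
      using eventually_at_right_less[of "0::real"] by eventually_elim (rule Wsq)
  qed auto
  moreover have "integral {0..1} (\<lambda>x. W x * W x) \<ge> 0"
    by (intro integral_nonneg integrable_continuous_real continuous_intros cont) auto
  ultimately have "integral (cbox 0 1) (\<lambda>x. W x * W x) = 0" by simp
  then have "W x * W x = 0"
    using x by (subst (asm) integral_cbox_eq_0_iff) (auto intro!: continuous_intros cont)
  then show ?thesis by simp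
qed


lemma integral_cos_2pi_int:
  "integral {0..1} (\<lambda>x. cos (2 * pi * of_int j * x)) = (if j = 0 then 1 else 0 :: real)"
proof (cases "j = 0")
  case False
  have "((\<lambda>x. cos (2 * pi * of_int j * x)) has_integral
      sin (2 * pi * of_int j * 1) / (2 * pi * of_int j) - sin (2 * pi * of_int j * 0) / (2 * pi * of_int j)) {0..1}"
  proof (rule fundamental_theorem_of_calculus)
    fix x :: real
    show "((\<lambda>x. sin (2 * pi * of_int j * x) / (2 * pi * of_int j)) has_vector_derivative cos (2 * pi * of_int j * x)) (at x within {0..1})"
      unfolding has_real_derivative_iff_has_vector_derivative[symmetric]
      using False by (auto intro!: derivative_eq_intros)
  qed simp
  moreover have "sin (2 * pi * of_int j) = 0"
    using sin_integer_2pi[of "of_int j"] by (simp add: mult_ac)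
  ultimately show ?thesis using False by (auto dest: integral_unique)
qed simp

lemma integral_cos_cos_2pi_int:
  "integral {0..1} (\<lambda>x. cos (2 * pi * of_int m * x) * cos (2 * pi * of_int k * x)) =
    ((if m = k then 1 else 0) + (if m = - k then 1 else 0)) / (2::real)"
proof -
  have "cos (2 * pi * of_int m * x) * cos (2 * pi * of_int k * x) =
     cos (2 * pi * of_int (m - k) * x) / 2 + cos (2 * pi * of_int (m + k) * x) / 2" for x
  proof -
    have "2 * pi * of_int (m - k) * x = 2 * pi * of_int m * x - 2 * pi * of_int k * x"
      "2 * pi * of_int (m + k) * x = 2 * pi * of_int m * x + 2 * pi * of_int k * x"
      by (simp_all add: algebra_simps)
    then show ?thesis by (simp only: cos_diff cos_add) (simp add: field_simps)
  qed
  then have "integral {0..1} (\<lambda>x. cos (2 * pi * of_int m * x) * cos (2 * pi * of_int k * x)) =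
     integral {0..1} (\<lambda>x. cos (2 * pi * of_int (m - k) * x) / 2) + integral {0..1} (\<lambda>x. cos (2 * pi * of_int (m + k) * x) / 2)"
    by (simp only:) (intro integral_add integrable_continuous_real continuous_intros; simp)
  also have "\<dots> = ((if m - k = 0 then 1 else 0) + (if m + k = 0 then 1 else 0)) / 2"
    by (simp only: integral_divide integral_cos_2pi_int add_divide_distrib)
  finally show ?thesis by (simp add: eq_neg_iff_add_eq_0)
qed

text \<open>Allows an unordered sum over the integers to be evaluated along symmetric blocks. They
  are half-open because the cells [n, n + 1] with n in \<open>{- int N..<int N}\<close> tile [-N, N]
  exactly.\<close>

lemma filterlim_symmetric_int_interval:
  "filterlim (\<lambda>N. {- int N..<int N}) (finite_subsets_at_top UNIV) sequentially"
  unfolding filterlim_iff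
proof (intro allI impI)
  fix P :: "int set \<Rightarrow> bool" assume "eventually P (finite_subsets_at_top UNIV)"
  then obtain X where X: "finite X" "\<And>Y. finite Y \<Longrightarrow> X \<subseteq> Y \<Longrightarrow> P Y"
    unfolding eventually_finite_subsets_at_top by auto
  obtain B where B: "\<And>x. x \<in> X \<Longrightarrow> \<bar>x\<bar> \<le> B"
    using X(1) by (meson finite_imageI finite_nat_set_iff_bounded_le Max_ge image_eqI)
  show "\<forall>\<^sub>F N in sequentially. P {- int N..<int N}"
    using eventually_ge_at_top[of "nat (B + 1)"]
  proof eventually_elim
    case (elim N)
    have "x \<in> {- int N..<int N}" if "x \<in> X" for x using B[OF that] elim by auto
    then show ?case by (intro X(2)) auto
  qed
qed

definition theta :: "real \<Rightarrow> real" where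
  "theta t = (\<Sum>\<^sub>\<infinity>k::int. exp (- pi * t * (of_int k)\<^sup>2))"

lemma summable_on_theta: "t > 0 \<Longrightarrow> (\<lambda>k::int. exp (- pi * t * (of_int k)\<^sup>2)) summable_on UNIV"
  using summable_on_gaussian[of "pi * t"] by simp

text \<open>Unfolding: the cosine has period 1, so the integrals of the shifted Gaussians over the
  unit interval are those of one function over consecutive cells and fill the whole line.
  \<open>S\<close> is arbitrary so that the value produced by termwise integration can be
  inserted.\<close>

lemma integral_periodic_sum_cos:
  fixes k :: nat
  assumes t: "t > 0"
  shows "((\<lambda>n::int. integral {0..1} (\<lambda>x. exp (- pi * t * (x + of_int n)\<^sup>2) * cos (2 * pi * real k * x))) has_sum S) UNIV
     \<Longrightarrow> S = exp (- pi * (real k)\<^sup>2 / t) / sqrt t"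
proof -
  define h where "h x = exp (- pi * t * x\<^sup>2) * cos (2 * pi * real k * x)" for x
  have hc: "continuous_on A h" for A
    unfolding h_def by (intro continuous_intros)
  have shift: "integral {0..1} (\<lambda>x. exp (- pi * t * (x + of_int n)\<^sup>2) * cos (2 * pi * real k * x)) =
      integral {real_of_int n..real_of_int n + 1} h" for n
  proof -
    have "cos (2 * pi * real k * (x + of_int n)) = cos (2 * pi * real k * x)" for x
    proof -
      have "2 * pi * real k * (x + of_int n) = 2 * pi * real k * x + 2 * pi * of_int (int k * n)"
        by (simp add: algebra_simps)
      then show ?thesis by (simp only: cos_add cos_int_2pin sin_int_2pin mult_1_right mult_zero_right diff_zero)
    qed
    then show ?thesis
      using integral_shift[of 0 "real_of_int n" 1 h] hc by (simp add: h_def o_def add.commute)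
  qed
  assume "((\<lambda>n::int. integral {0..1} (\<lambda>x. exp (- pi * t * (x + of_int n)\<^sup>2) * cos (2 * pi * real k * x))) has_sum S) UNIV"
  then have "((\<lambda>X. \<Sum>n\<in>X. integral {real_of_int n..real_of_int n + 1} h) \<longlongrightarrow> S) (finite_subsets_at_top UNIV)"
    by (simp only: has_sum_def shift)
  from filterlim_compose[OF this filterlim_symmetric_int_interval]
  have lim1: "(\<lambda>N. \<Sum>n\<in>{- int N..<int N}. integral {real_of_int n..real_of_int n + 1} h) \<longlonglongrightarrow> S" .
  have part: "(\<Sum>n\<in>{- int N..<int N}. integral {real_of_int n..real_of_int n + 1} h) = integral {- real N..real N} h" for N
  proof (induction N)
    case (Suc N)
    have "{- int (Suc N)..<int (Suc N)} = insert (- int (Suc N)) (insert (int N) {- int N..<int N})" by auto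
    then have "(\<Sum>n\<in>{- int (Suc N)..<int (Suc N)}. integral {real_of_int n..real_of_int n + 1} h) =
      integral {- real (Suc N)..- real N} h + (integral {real N..real (Suc N)} h + integral {- real N..real N} h)"
      using Suc by (simp add: algebra_simps)
    also have "\<dots> = integral {- real (Suc N)..- real N} h + integral {- real N..real (Suc N)} h"
      using Henstock_Kurzweil_Integration.integral_combine[of "- real N" "real N" "real (Suc N)" h] hc
      by (simp add: integrable_continuous_real)
    also have "\<dots> = integral {- real (Suc N)..real (Suc N)} h"
      using Henstock_Kurzweil_Integration.integral_combine[of "- real (Suc N)" "- real N" "real (Suc N)" h] hc
      by (simp add: integrable_continuous_real)
    finally show ?case .
  qed simp
  have hi: "integrable lborel h"
    unfolding h_def by (rule gaussian_cosine_transform(1)[OF t])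
  have "(\<lambda>N. LBINT x:{- real N..real N}. h x) \<longlonglongrightarrow> (LBINT x. h x)"
    unfolding set_lebesgue_integral_def
  proof (rule integral_dominated_convergence[where w = "\<lambda>x. \<bar>h x\<bar>"])
    show "AE x in lborel. (\<lambda>N. indicator {- real N..real N} x *\<^sub>R h x) \<longlonglongrightarrow> h x"
    proof (intro AE_I2 tendsto_eventually)
      fix x :: real
      show "\<forall>\<^sub>F N in sequentially. indicator {- real N..real N} x *\<^sub>R h x = h x"
        using eventually_ge_at_top[of "nat \<lceil>\<bar>x\<bar>\<rceil>"] by eventually_elim (auto simp: indicator_def)
    qed
  qed (use hi in \<open>auto simp: indicator_def\<close>)
  moreover have "(LBINT x:{- real N..real N}. h x) = integral {- real N..real N} h" for N
    by (rule set_borel_integral_eq_integral) (auto intro!: borel_integrable_atLeastAtMost' hc)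
  ultimately have "(\<lambda>N. integral {- real N..real N} h) \<longlonglongrightarrow> exp (- pi * (real k)\<^sup>2 / t) / sqrt t"
    using gaussian_cosine_transform(2)[OF t, of "real k"] by (simp add: h_def)
  with lim1 show ?thesis
    unfolding part by (rule LIMSEQ_unique)
qed

text \<open>Poisson summation for a Gaussian. The periodised Gaussian \<open>P\<close> and its
  expected Fourier series \<open>Q\<close> are continuous, symmetric under x to 1 - x, and have the
  same cosine coefficients, so they agree; the equation is their equality at 0.\<close>

theorem theta_functional_equation:
  assumes t: "t > 0"
  shows "theta t = theta (1 / t) / sqrt t"
proof -
  define e where "e k = exp (- pi * (of_int k)\<^sup>2 / t) / sqrt t" for k :: int
  define P where "P x = (\<Sum>\<^sub>\<infinity>n::int. exp (- pi * t * (x + of_int n)\<^sup>2))" for x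
  define Q where "Q x = (\<Sum>\<^sub>\<infinity>k::int. e k * cos (2 * pi * of_int k * x))" for x
  \<comment> \<open>A majorant of the shifted Gaussians that is uniform for x in [0, 1]: the
    inequality (2 x + n)^2 >= 0 gives (x + n)^2 >= n^2 / 2 - x^2 >= n^2 / 2 - 1.\<close>
  define MP where "MP n = exp (pi * t) * exp (- (pi * t / 2) * (of_int n)\<^sup>2)" for n :: int
  have MP: "MP summable_on UNIV"
    unfolding MP_def using t by (intro summable_on_cmult_right summable_on_gaussian) auto
  have e: "e summable_on UNIV"
    unfolding e_def using summable_on_cmult_left[OF summable_on_gaussian[of "pi / t"], of "1 / sqrt t"] t
    by simp
  have e0: "e k \<ge> 0" for k using t by (simp add: e_def)
  have Pb: "\<bar>exp (- pi * t * (x + of_int n)\<^sup>2)\<bar> \<le> MP n" if "x \<in> {0..1}" for x and n :: int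
  proof -
    have "0 \<le> (2 * x + of_int n)\<^sup>2" by simp
    moreover have "x\<^sup>2 \<le> 1" using that by (simp add: power_le_one)
    ultimately have "(of_int n)\<^sup>2 / 2 - 1 \<le> (x + of_int n)\<^sup>2"
      by (simp add: power2_eq_square algebra_simps)
    then have "pi * t * ((of_int n)\<^sup>2 / 2 - 1) \<le> pi * t * (x + of_int n)\<^sup>2"
      using t by (intro mult_left_mono) auto
    then show ?thesis
      by (simp add: MP_def exp_add[symmetric] algebra_simps)
  qed
  have Qb: "\<bar>e k * cos (2 * pi * of_int k * x)\<bar> \<le> e k" for x k
    using e0[of k] by (auto simp: abs_mult mult_left_le)
  have Pc: "continuous_on {0..1} P"
    unfolding P_def by (rule infsum_bounded_terms_integral(1)[OF _ Pb MP]) (auto intro!: continuous_intros)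
  have Qc: "continuous_on {0..1} Q"
    unfolding Q_def by (rule infsum_bounded_terms_integral(1)[OF _ Qb e]) (auto intro!: continuous_intros)
  have Prefl: "P (1 - x) = P x" for x
    unfolding P_def
    by (rule infsum_reindex_bij_witness[where i = "\<lambda>n. - 1 - n" and j = "\<lambda>n. - 1 - n"])
       (auto simp: power2_eq_square algebra_simps)
  have Qrefl: "Q (1 - x) = Q x" for x
  proof -
    have "cos (2 * pi * of_int k * (1 - x)) = cos (2 * pi * of_int k * x)" for k :: int
    proof -
      have "2 * pi * of_int k * (1 - x) = 2 * pi * of_int k - 2 * pi * of_int k * x"
        by (simp add: algebra_simps)
      then show ?thesis by (simp only: cos_diff cos_int_2pin sin_int_2pin mult_1_left mult_zero_left add_0_right)
    qed
    then show ?thesis by (simp add: Q_def)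
  qed
  have Pint: "integral {0..1} (\<lambda>x. P x * cos (2 * pi * real k * x)) = e (int k)" for k
  proof -
    have "((\<lambda>n::int. integral {0..1} (\<lambda>x. exp (- pi * t * (x + of_int n)\<^sup>2) * cos (2 * pi * real k * x))) has_sum
       integral {0..1} (\<lambda>x. \<Sum>\<^sub>\<infinity>n::int. exp (- pi * t * (x + of_int n)\<^sup>2) * cos (2 * pi * real k * x))) UNIV"
    proof (rule infsum_bounded_terms_integral(2)[OF _ _ MP])
      fix n :: int and x :: real assume "x \<in> {0..1}"
      then have "\<bar>exp (- pi * t * (x + of_int n)\<^sup>2)\<bar> * \<bar>cos (2 * pi * real k * x)\<bar> \<le> MP n * 1"
        by (intro mult_mono Pb) (auto simp: MP_def)
      then show "\<bar>exp (- pi * t * (x + of_int n)\<^sup>2) * cos (2 * pi * real k * x)\<bar> \<le> MP n"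
        by (simp add: abs_mult)
    qed (auto intro!: continuous_intros)
    from integral_periodic_sum_cos[OF t this] show ?thesis
      by (simp add: infsum_cmult_left' P_def e_def)
  qed
  have Qint: "integral {0..1} (\<lambda>x. Q x * cos (2 * pi * real k * x)) = e (int k)" for k
  proof -
    have "((\<lambda>m::int. integral {0..1} (\<lambda>x. e m * cos (2 * pi * of_int m * x) * cos (2 * pi * real k * x))) has_sum
       integral {0..1} (\<lambda>x. \<Sum>\<^sub>\<infinity>m::int. e m * cos (2 * pi * of_int m * x) * cos (2 * pi * real k * x))) UNIV"
    proof (rule infsum_bounded_terms_integral(2)[OF _ _ e])
      fix m :: int and x :: real
      have "\<bar>e m * cos (2 * pi * of_int m * x)\<bar> * \<bar>cos (2 * pi * real k * x)\<bar> \<le> e m * 1"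
        by (intro mult_mono Qb) (auto simp: e0)
      then show "\<bar>e m * cos (2 * pi * of_int m * x) * cos (2 * pi * real k * x)\<bar> \<le> e m"
        by (simp add: abs_mult)
    qed (auto intro!: continuous_intros)
    moreover have "integral {0..1} (\<lambda>x. e m * cos (2 * pi * of_int m * x) * cos (2 * pi * real k * x)) =
       e m * (((if m = int k then 1 else 0) + (if m = - int k then 1 else 0)) / 2)" for m
      using integral_cos_cos_2pi_int[of m "int k"] by (simp add: mult.assoc)
    ultimately have "((\<lambda>m::int. e m * (((if m = int k then 1 else 0) + (if m = - int k then 1 else 0)) / 2)) has_sum
       integral {0..1} (\<lambda>x. Q x * cos (2 * pi * real k * x))) UNIV"
      by (simp add: infsum_cmult_left' Q_def)
    \<comment> \<open>For k = 0 both conditions hold at the single index 0; otherwise the indices k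
      and -k contribute one half each, and \<open>e\<close> is even.\<close>
    moreover have "((\<lambda>m::int. e m * (((if m = int k then 1 else 0) + (if m = - int k then 1 else 0)) / 2)) has_sum
       e (int k)) UNIV"
      by (rule has_sum_finite_neutralI[of "{int k, - int k}"]) (auto simp: e_def sum.insert_if)
    ultimately show ?thesis by (rule has_sum_unique)
  qed
  have "P 0 - Q 0 = 0"
  proof (rule even_periodic_eq_zero[of "\<lambda>x. P x - Q x"])
    show "integral {0..1} (\<lambda>x. (P x - Q x) * cos (2 * pi * real k * x)) = 0" for k
    proof -
      have "integral {0..1} (\<lambda>x. (P x - Q x) * cos (2 * pi * real k * x)) =
        integral {0..1} (\<lambda>x. P x * cos (2 * pi * real k * x)) - integral {0..1} (\<lambda>x. Q x * cos (2 * pi * real k * x))"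
        unfolding left_diff_distrib
        by (intro integral_diff integrable_continuous_real continuous_intros Pc Qc)
      then show ?thesis by (simp add: Pint Qint)
    qed
  qed (auto intro!: continuous_intros Pc Qc simp: Prefl Qrefl)
  moreover have "Q 0 = theta (1 / t) / sqrt t"
    unfolding Q_def e_def theta_def using infsum_cmult_left'[of _ "1 / sqrt t"] by simp
  ultimately show ?thesis
    by (simp add: P_def theta_def)
qed


section \<open>Sums of two squares\<close>

lemma has_sum_product_nonneg:
  fixes f :: "'a \<Rightarrow> real" and g :: "'b \<Rightarrow> real"
  assumes f: "(f has_sum F) A" and g: "(g has_sum G) B"
    and "\<And>x. f x \<ge> 0" "\<And>x. g x \<ge> 0"
  shows "((\<lambda>(x, y). f x * g y) has_sum F * G) (A \<times> B)"
proof (rule has_sum_SigmaI)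
  have inner: "((\<lambda>y. f x * g y) has_sum f x * G) B" for x
    by (rule has_sum_cmult_right[OF g])
  then show "((\<lambda>y. case (x, y) of (x, y) \<Rightarrow> f x * g y) has_sum f x * G) B" for x by simp
  show outer: "((\<lambda>x. f x * G) has_sum F * G) A"
    by (rule has_sum_cmult_left[OF f])
  show "(\<lambda>(x, y). f x * g y) summable_on A \<times> B"
    by (rule summable_on_SigmaI) (use inner outer assms in \<open>auto simp: has_sum_imp_summable\<close>)
qed

text \<open>Guarantees that \<open>card\<close> really counts in \<open>r2\<close>, since an
  infinite set would get the value 0. An integer satisfies |a| <= a^2, which confines the points to
  a box.\<close>

lemma finite_sum_two_squares: "finite {(a :: int, b :: int). a\<^sup>2 + b\<^sup>2 = int n}"
proof (rule finite_subset)
  have "\<bar>a\<bar> \<le> int n" if "a\<^sup>2 + b\<^sup>2 = int n" for a b :: int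
  proof -
    have "\<bar>a\<bar> \<le> \<bar>a\<bar> * \<bar>a\<bar>" using mult_left_mono[of 1 "\<bar>a\<bar>" "\<bar>a\<bar>"] by (cases "a = 0") simp_all
    also have "\<dots> \<le> int n"
      using that zero_le_power2[of b] by (simp only: power2_eq_square abs_mult_self_eq)
    finally show ?thesis .
  qed
  then show "{(a :: int, b :: int). a\<^sup>2 + b\<^sup>2 = int n} \<subseteq> {- int n..int n} \<times> {- int n..int n}"
    by (fastforce simp: add.commute abs_le_iff)
qed simp

text \<open>Groups lattice points by squared length: each circle carries finitely many points, and
  the summand is constant on it.\<close>

lemma has_sum_r2:
  fixes \<phi> :: "nat \<Rightarrow> 'a :: real_normed_field"
  assumes "((\<lambda>(a :: int, b :: int). \<phi> (nat (a\<^sup>2 + b\<^sup>2))) has_sum S) UNIV"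
  shows "((\<lambda>n. of_nat (r2 n) * \<phi> n) has_sum S) UNIV"
proof (rule has_sum_SigmaD)
  let ?P = "\<lambda>n. {(a :: int, b :: int). a\<^sup>2 + b\<^sup>2 = int n}"
  show "((\<lambda>(n, p). \<phi> n) has_sum S) (Sigma UNIV ?P)"
    by (rule has_sum_reindex_bij_witness[where i = "\<lambda>(a, b). (nat (a\<^sup>2 + b\<^sup>2), (a, b))" and j = snd, THEN iffD2, OF _ _ _ _ _ refl assms])
       auto
  show "((\<lambda>p. case (n, p) of (n, p) \<Rightarrow> \<phi> n) has_sum of_nat (r2 n) * \<phi> n) (?P n)" for n
    by (rule has_sum_finiteI) (use finite_sum_two_squares in \<open>simp_all add: r2_def\<close>)
qed

lemma has_sum_r2_exp:
  assumes t: "t > 0"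
  shows "((\<lambda>n. of_nat (r2 n) * exp (- pi * t * real n)) has_sum (theta t)\<^sup>2) UNIV"
proof (rule has_sum_r2)
  have th: "((\<lambda>k::int. exp (- pi * t * (of_int k)\<^sup>2)) has_sum theta t) UNIV"
    unfolding theta_def by (intro has_sum_infsum summable_on_theta t)
  have "((\<lambda>(a :: int, b :: int). exp (- pi * t * (of_int a)\<^sup>2) * exp (- pi * t * (of_int b)\<^sup>2)) has_sum theta t * theta t) (UNIV \<times> UNIV)"
    by (rule has_sum_product_nonneg[OF th th]) auto
  then show "((\<lambda>(a :: int, b :: int). exp (- pi * t * real (nat (a\<^sup>2 + b\<^sup>2)))) has_sum (theta t)\<^sup>2) UNIV"
    by (simp add: power2_eq_square exp_add[symmetric] algebra_simps)
qed

text \<open>The inequality (1 + a^2) (1 + b^2) <= (1 + a^2 + b^2)^2 separates the two coordinates.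
  The exponent 3/2 becomes 3/4 on each factor 1 + a^2, that is, decay |a|^(-3/2), which is summable
  over the integers.\<close>

lemma summable_r2_powr: "summable (\<lambda>n. real (r2 n) * (1 + real n) powr (-3/2))"
proof -
  define g where "g a = (1 + (real_of_int a)\<^sup>2) powr (-3/4)" for a :: int
  have "summable (\<lambda>n::nat. (1 + (real n)\<^sup>2) powr (-3/4))"
  proof (rule summable_comparison_test_ev)
    show "summable (\<lambda>n. real n powr (-3/2))" by (simp add: summable_real_powr_iff)
    show "\<forall>\<^sub>F n in sequentially. norm ((1 + (real n)\<^sup>2) powr (-3/4)) \<le> real n powr (-3/2)"
      using eventually_gt_at_top[of 0]
    proof eventually_elim
      case (elim n)
      have "(1 + (real n)\<^sup>2) powr (-3/4) \<le> ((real n)\<^sup>2) powr (-3/4)"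
        using elim by (intro powr_mono2') auto
      also have "\<dots> = real n powr (-3/2)"
        using elim by (simp add: powr_powr flip: powr_numeral)
      finally show ?case by simp
    qed
  qed
  from summable_on_int_abs[OF this] have g: "g summable_on UNIV" by (simp add: g_def[abs_def])
  have "(\<lambda>(a, b). g a * g b) summable_on UNIV \<times> UNIV"
    by (rule has_sum_imp_summable[OF has_sum_product_nonneg[OF has_sum_infsum[OF g] has_sum_infsum[OF g]]])
       (auto simp: g_def)
  then have "(\<lambda>(a, b). g a * g b) summable_on UNIV" by simp
  then have "(\<lambda>(a :: int, b :: int). (1 + real (nat (a\<^sup>2 + b\<^sup>2))) powr (-3/2)) summable_on UNIV"
  proof (rule summable_on_comparison_test)
    fix p :: "int \<times> int"
    obtain a b where p: "p = (a, b)" by (cases p)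
    have "(1 + (real_of_int a)\<^sup>2) * (1 + (real_of_int b)\<^sup>2) \<le> (1 + (real_of_int a)\<^sup>2 + (real_of_int b)\<^sup>2)\<^sup>2"
      unfolding power2_eq_square[of "1 + _ + _"] by (intro mult_mono) auto
    then have "((1 + (real_of_int a)\<^sup>2 + (real_of_int b)\<^sup>2)\<^sup>2) powr (-3/4) \<le> ((1 + (real_of_int a)\<^sup>2) * (1 + (real_of_int b)\<^sup>2)) powr (-3/4)"
      by (intro powr_mono2') (auto intro!: mult_pos_pos add_pos_nonneg)
    also have "\<dots> = g a * g b"
      by (simp add: g_def powr_mult)
    also have "((1 + (real_of_int a)\<^sup>2 + (real_of_int b)\<^sup>2)\<^sup>2) powr (-3/4) = (1 + (real_of_int a)\<^sup>2 + (real_of_int b)\<^sup>2) powr (-3/2)"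
      by (simp add: powr_powr add_pos_nonneg flip: powr_numeral)
    finally show "(case p of (a, b) \<Rightarrow> (1 + real (nat (a\<^sup>2 + b\<^sup>2))) powr (-3/2)) \<le> (case p of (a, b) \<Rightarrow> g a * g b)"
      by (simp add: p add.assoc)
  qed auto
  then have "((\<lambda>(a :: int, b :: int). (1 + real (nat (a\<^sup>2 + b\<^sup>2))) powr (-3/2)) has_sum
      infsum (\<lambda>(a :: int, b :: int). (1 + real (nat (a\<^sup>2 + b\<^sup>2))) powr (-3/2)) UNIV) UNIV"
    by (rule has_sum_infsum)
  from has_sum_r2[OF this] show ?thesis
    by (auto dest: has_sum_imp_sums sums_summable)
qed

text \<open>The square of the functional equation at t = s y / pi, with \<Theta> the square of theta
  at 1 / t. The exponents are arranged to match exp (- s u) at the points n y on one side and its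
  Bessel transform on the other.\<close>

lemma r2_exp_sums:
  assumes "s > 0" "y > 0"
  obtains \<Theta> where "(\<lambda>n. real (r2 n) * exp (- s * (real n * y))) sums (pi / (s * y) * \<Theta>)"
    and "(\<lambda>n. real (r2 n) * exp (- (pi\<^sup>2 * real n / y) / s)) sums \<Theta>"
proof -
  define t where "t = s * y / pi"
  have t: "t > 0" using assms by (simp add: t_def)
  have e1: "- pi * t * real n = - s * (real n * y)" for n
    by (simp add: t_def)
  have e2: "- pi * (1 / t) * real n = - (pi\<^sup>2 * real n / y) / s" for n
    using assms by (simp add: t_def power2_eq_square field_simps)
  have "(theta t)\<^sup>2 = pi / (s * y) * (theta (1 / t))\<^sup>2"
    using theta_functional_equation[OF t] t by (simp add: power_divide) (simp add: t_def)
  then show ?thesis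
    using that has_sum_imp_sums[OF has_sum_r2_exp[of t]] has_sum_imp_sums[OF has_sum_r2_exp[of "1/t"]] t
    unfolding e1 e2 by simp
qed

section \<open>The Bessel kernel\<close>

text \<open>\<open>bes c\<close> is \<open>J\<^sub>0 (2 * sqrt c)\<close>, the radial kernel of the Fourier transform in the plane.\<close>

definition bes_coeff :: "nat \<Rightarrow> real" where
  "bes_coeff k = (-1) ^ k / (fact k)\<^sup>2"

definition bes :: "real \<Rightarrow> real" where
  "bes c = (\<Sum>k. bes_coeff k * c ^ k)"

definition bes' :: "real \<Rightarrow> real" where
  "bes' c = (\<Sum>k. diffs bes_coeff k * c ^ k)"

definition bes'' :: "real \<Rightarrow> real" where
  "bes'' c = (\<Sum>k. diffs (diffs bes_coeff) k * c ^ k)"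

lemma summable_norm_bes: "summable (\<lambda>k. norm (bes_coeff k * c ^ k))"
proof (rule summable_comparison_test)
  show "summable (\<lambda>k. inverse (fact k) * \<bar>c\<bar> ^ k)" by (rule summable_exp)
  have "inverse ((fact k)\<^sup>2) \<le> (inverse (fact k) :: real)" for k
    by (intro le_imp_inverse_le) (auto simp: power2_eq_square)
  then show "\<exists>N. \<forall>n\<ge>N. norm (norm (bes_coeff n * c ^ n)) \<le> inverse (fact n) * \<bar>c\<bar> ^ n"
    by (intro exI[of _ 0] allI impI)
      (auto simp: bes_coeff_def abs_mult power_abs divide_inverse intro!: mult_right_mono)
qed

lemma summable_bes: "summable (\<lambda>k. bes_coeff k * c ^ k)"
  by (rule summable_norm_cancel[OF summable_norm_bes])

lemma summable_diffs_bes: "summable (\<lambda>k. diffs bes_coeff k * c ^ k)"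
  by (rule termdiff_converges_all[OF summable_bes])

lemma DERIV_bes: "(bes has_real_derivative bes' c) (at c)"
  unfolding bes_def[abs_def] bes'_def by (rule termdiffs_strong_converges_everywhere[OF summable_bes])

lemma DERIV_bes': "(bes' has_real_derivative bes'' c) (at c)"
  unfolding bes'_def[abs_def] bes''_def by (rule termdiffs_strong_converges_everywhere[OF summable_diffs_bes])

lemma continuous_on_bes:
  assumes "continuous_on S f"
  shows "continuous_on S (\<lambda>x. bes (f x))"
  by (rule continuous_on_compose2[OF _ assms, of UNIV]) (auto intro: DERIV_continuous_on DERIV_bes)

text \<open>Coefficientwise this is the recurrence (n + 1)^2 a_(n+1) = - a_n. It is Bessel's
  equation of order 0 after the substitution x = 2 sqrt c.\<close>

lemma bes_ode: "c * bes'' c + bes' c + bes c = 0"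
proof -
  have "summable (\<lambda>k. diffs (diffs bes_coeff) k * c ^ k)"
    by (rule termdiff_converges_all[OF summable_diffs_bes])
  have "(\<lambda>n. of_nat n * diffs bes_coeff n * c ^ n) sums (c * bes'' c)"
  proof -
    have eq: "of_nat n * diffs bes_coeff n * c ^ (n - Suc 0) * c = of_nat n * diffs bes_coeff n * c ^ n" for n
      by (cases n) auto
    show ?thesis
      using sums_mult2[OF diffs_equiv[OF \<open>summable (\<lambda>k. diffs (diffs bes_coeff) k * c ^ k)\<close>], of c]
      unfolding eq by (simp add: bes''_def mult.commute)
  qed
  moreover have "(\<lambda>n. diffs bes_coeff n * c ^ n) sums bes' c"
    unfolding bes'_def by (rule summable_sums[OF summable_diffs_bes])
  moreover have "(\<lambda>n. bes_coeff n * c ^ n) sums bes c"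
    unfolding bes_def by (rule summable_sums[OF summable_bes])
  ultimately have "(\<lambda>n. of_nat n * diffs bes_coeff n * c ^ n + diffs bes_coeff n * c ^ n + bes_coeff n * c ^ n)
      sums (c * bes'' c + bes' c + bes c)"
    by (intro sums_add)
  moreover have "of_nat n * diffs bes_coeff n * c ^ n + diffs bes_coeff n * c ^ n + bes_coeff n * c ^ n = 0" for n
  proof -
    have "of_nat n * diffs bes_coeff n + diffs bes_coeff n + bes_coeff n = (real n + 1)\<^sup>2 * bes_coeff (Suc n) + bes_coeff n"
      by (simp add: diffs_def power2_eq_square algebra_simps)
    also have "(real n + 1)\<^sup>2 * bes_coeff (Suc n) = - bes_coeff n"
    proof -
      have "(fact (Suc n) :: real)\<^sup>2 = (real n + 1)\<^sup>2 * (fact n)\<^sup>2"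
        by (simp add: power_mult_distrib[symmetric] algebra_simps)
      then show ?thesis by (simp add: bes_coeff_def del: fact_Suc)
    qed
    finally show ?thesis by (simp flip: distrib_right)
  qed
  ultimately show ?thesis by (simp add: sums_iff)
qed

text \<open>An energy argument: by the differential equation the left side has derivative -
  (\<open>bes' c\<close>)^2, and it equals 1 at c = 0. Both bounds on the kernel used below follow
  from it, so no asymptotic expansion of Bessel functions is needed.\<close>

lemma bes_energy:
  assumes "c \<ge> 0"
  shows "(bes c)\<^sup>2 + c * (bes' c)\<^sup>2 \<le> 1"
proof -
  have "(bes c)\<^sup>2 + c * (bes' c)\<^sup>2 \<le> (bes 0)\<^sup>2 + 0 * (bes' 0)\<^sup>2"
  proof (rule DERIV_nonpos_imp_nonincreasing[OF assms])
    fix x :: real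
    have "((\<lambda>c. (bes c)\<^sup>2 + c * (bes' c)\<^sup>2) has_real_derivative
        2 * bes x * bes' x + ((bes' x)\<^sup>2 + x * (2 * bes' x * bes'' x))) (at x)"
      by (auto intro!: derivative_eq_intros DERIV_bes DERIV_bes' simp: power2_eq_square)
    also have "2 * bes x * bes' x + ((bes' x)\<^sup>2 + x * (2 * bes' x * bes'' x)) =
        2 * bes' x * (x * bes'' x + bes' x + bes x) - (bes' x)\<^sup>2"
      by (simp add: power2_eq_square algebra_simps)
    finally have "((\<lambda>c. (bes c)\<^sup>2 + c * (bes' c)\<^sup>2) has_real_derivative - (bes' x)\<^sup>2) (at x)"
      by (simp add: bes_ode)
    then show "\<exists>y. ((\<lambda>c. (bes c)\<^sup>2 + c * (bes' c)\<^sup>2) has_real_derivative y) (at x) \<and> y \<le> 0"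
      by (intro exI[of _ "- (bes' x)\<^sup>2"]) auto
  qed
  also have "bes 0 = 1" unfolding bes_def powser_zero by (simp add: bes_coeff_def)
  finally show ?thesis by simp
qed

lemma abs_bes_le_1: "c \<ge> 0 \<Longrightarrow> \<bar>bes c\<bar> \<le> 1"
  unfolding abs_square_le_1[symmetric]
  using bes_energy[of c] mult_nonneg_nonneg[of c "(bes' c)\<^sup>2"] zero_le_power2[of "bes' c"] by linarith

text \<open>This growth costs half a power of A in the decay estimate and leaves A^(-3/2) instead of
  A^(-2).\<close>

lemma abs_bes'_le: "c \<ge> 0 \<Longrightarrow> \<bar>c * bes' c\<bar> \<le> sqrt c"
proof -
  assume c: "c \<ge> 0"
  have "c * (bes' c)\<^sup>2 \<le> 1" using bes_energy[OF c] zero_le_power2[of "bes c"] by linarith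
  then have "c * (c * (bes' c)\<^sup>2) \<le> c * 1" using c by (intro mult_left_mono)
  then have "(c * bes' c)\<^sup>2 \<le> c" by (simp add: power2_eq_square mult_ac)
  then show ?thesis by (metis real_sqrt_abs real_sqrt_le_mono)
qed

section \<open>Laplace transform of the Bessel kernel\<close>

lemma has_bochner_integral_power_exp_scale:
  fixes s :: real
  assumes s: "s > 0"
  shows "has_bochner_integral lborel (\<lambda>t. indicator {0..} t *\<^sub>R (t ^ k * exp (- s * t))) (fact k / s ^ Suc k)"
proof -
  let ?f = "\<lambda>x. x ^ k * exp (- x) * indicator {0..} x :: real"
  have f: "has_bochner_integral lborel ?f (fact k)"
    by (rule has_bochner_integral_I0i_power_exp_m')
  have eq: "?f (0 + s * t) = s ^ k * (indicator {0..} t *\<^sub>R (t ^ k * exp (- s * t)))" for t :: real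
    using s by (auto simp: indicator_def zero_le_mult_iff power_mult_distrib)
  have "integrable lborel (\<lambda>t. s ^ k * (indicator {0..} t *\<^sub>R (t ^ k * exp (- s * t))))"
    using lborel_integrable_real_affine[of ?f s 0] f s unfolding eq by (auto dest: integrable.intros)
  then have "integrable lborel (\<lambda>t. indicator {0..} t *\<^sub>R (t ^ k * exp (- s * t)))"
    using integrable_mult_left_iff[of lborel "s ^ k"] s by simp
  moreover
  have "fact k = s *\<^sub>R (LBINT t. s ^ k * (indicator {0..} t *\<^sub>R (t ^ k * exp (- s * t))))"
    using lborel_integral_real_affine[of s ?f 0] s has_bochner_integral_integral_eq[OF f] unfolding eq by simp
  then have "fact k = s * (s ^ k * (LBINT t. indicator {0..} t *\<^sub>R (t ^ k * exp (- s * t))))"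
    by (simp only: integral_mult_right_zero real_scaleR_def)
  ultimately show ?thesis
    using s by (simp add: has_bochner_integral_iff field_simps)
qed

text \<open>Termwise integration: the integral of t^k exp (- s t) is k! / s^(k+1), and its factorial
  cancels one of the two in \<open>bes_coeff k\<close>, leaving an exponential series. With absolute
  values the same computation sums to exp (A / s) / s, which justifies the exchange.\<close>

lemma laplace_bes:
  assumes s: "s > 0" and A: "A \<ge> 0"
  shows "set_integrable lborel {0..} (\<lambda>t. exp (- s * t) * bes (A * t))"
    and "(LBINT t:{0..}. exp (- s * t) * bes (A * t)) = exp (- A / s) / s"
proof -
  define f where "f k t = bes_coeff k * A ^ k * (indicator {0..} t *\<^sub>R (t ^ k * exp (- s * t)))" for k and t :: real
  note hb = has_bochner_integral_power_exp_scale[OF s]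
  have int: "integrable lborel (f k)" for k
    unfolding f_def using hb[of k] by (intro integrable_mult_right) (auto simp: has_bochner_integral_iff)
  have fs: "f k t = (indicator {0..} t * exp (- s * t)) * (bes_coeff k * (A * t) ^ k)" for k t
    by (simp add: f_def power_mult_distrib)
  have val: "integral\<^sup>L lborel (f k) = bes_coeff k * A ^ k * (fact k / s ^ Suc k)" for k
    unfolding f_def using hb[of k] by (simp add: has_bochner_integral_iff)
  have "norm (f k t) = \<bar>bes_coeff k * A ^ k\<bar> * (indicator {0..} t *\<^sub>R (t ^ k * exp (- s * t)))" for k t
    by (auto simp: f_def abs_mult indicator_def)
  then have valn: "(LBINT t. norm (f k t)) = \<bar>bes_coeff k * A ^ k\<bar> * (fact k / s ^ Suc k)" for k
    using hb[of k] by (simp add: has_bochner_integral_iff)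
  have valn': "(LBINT t. norm (f k t)) = (inverse (fact k) * (A / s) ^ k) / s" for k
    unfolding valn using s A by (simp add: bes_coeff_def abs_mult power2_eq_square field_simps)
  have sn: "summable (\<lambda>k. LBINT t. norm (f k t))"
    unfolding valn' by (intro summable_divide summable_exp)
  have ae: "AE t in lborel. summable (\<lambda>k. norm (f k t))"
    unfolding fs norm_mult[of "_ * _"] by (intro AE_I2 summable_mult summable_norm_bes)
  have sum: "(\<Sum>k. f k t) = indicator {0..} t *\<^sub>R (exp (- s * t) * bes (A * t))" for t
    unfolding fs by (subst suminf_mult[OF summable_bes]) (simp add: bes_def)
  show "set_integrable lborel {0..} (\<lambda>t. exp (- s * t) * bes (A * t))"
    unfolding set_integrable_def sum[symmetric] by (rule integrable_suminf[OF int ae sn])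
  have "(\<lambda>k. inverse (fact k) * (- A / s) ^ k / s) sums (exp (- A / s) / s)"
    using sums_divide[OF exp_converges[of "- A / s"], of s] by simp
  moreover have "integral\<^sup>L lborel (f k) = inverse (fact k) * (- A / s) ^ k / s" for k
    unfolding val using s by (simp add: bes_coeff_def power2_eq_square power_minus[of "A / s"] power_divide field_simps)
  ultimately show "(LBINT t:{0..}. exp (- s * t) * bes (A * t)) = exp (- A / s) / s"
    using integral_suminf[OF int ae sn] unfolding set_lebesgue_integral_def sum by (simp add: sums_iff)
qed

section \<open>Integrals against the Bessel kernel\<close>

lemma has_bochner_integral_inverse_square_half_line:
  "has_bochner_integral lborel (\<lambda>t::real. indicator {0..} t *\<^sub>R (1 / (1 + t)\<^sup>2)) 1"
proof -
  have "((\<lambda>t::real. - 1 / (1 + t)) \<longlongrightarrow> 0) at_top" by real_asymp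
  then have "(\<integral>\<^sup>+t. ennreal (1 / (1 + t)\<^sup>2) * indicator {0..} t \<partial>lborel) = ennreal (0 - (- 1 / (1 + 0)))"
    by (intro nn_integral_FTC_atLeast)
       (auto intro!: derivative_eq_intros simp: power2_eq_square field_simps)
  also have "(\<integral>\<^sup>+t. ennreal (1 / (1 + t)\<^sup>2) * indicator {0..} t \<partial>lborel) =
      (\<integral>\<^sup>+t. ennreal (indicator {0..} t *\<^sub>R (1 / (1 + t)\<^sup>2)) \<partial>lborel)"
    by (intro nn_integral_cong) (auto split: split_indicator)
  finally show ?thesis
    by (intro has_bochner_integral_nn_integral) (auto split: split_indicator)
qed

text \<open>The comparison function 1 / (1 + t)^2 has integral exactly 1, so \<open>C\<close> also
  bounds the integral. The disjunction serves two kinds of integrand: those continuous on the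
  half-line, and the remainder in the sine kernel, which is cut at 1. Restricting the bound to t > 0
  leaves out the point where kernels are divided by 0.\<close>

lemma set_integrable_inverse_square_bound:
  fixes h :: "real \<Rightarrow> complex"
  assumes h: "h \<in> borel_measurable borel \<or> continuous_on {0..} h"
    and bound: "\<And>t. t > 0 \<Longrightarrow> norm (h t) \<le> C / (1 + t)\<^sup>2"
  shows "set_integrable lborel {0..} h" and "norm (LBINT t:{0..}. h t) \<le> C"
proof -
  note hb = has_bochner_integral_inverse_square_half_line
  have C: "integrable lborel (\<lambda>t. C * (indicator {0..} t *\<^sub>R (1 / (1 + t)\<^sup>2)))"
    using hb by (intro integrable_mult_right) (auto simp: has_bochner_integral_iff)
  have ae: "AE t in lborel. norm (indicator {0..} t *\<^sub>R h t) \<le> C * (indicator {0..} t *\<^sub>R (1 / (1 + t)\<^sup>2))"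
    using AE_lborel_singleton[of 0] by eventually_elim (use bound in \<open>auto simp: indicator_def\<close>)
  have "(\<lambda>t. indicator {0..} t *\<^sub>R h t) \<in> borel_measurable lborel"
    using h
  proof
    assume "h \<in> borel_measurable borel"
    then show ?thesis by simp
  next
    assume "continuous_on {0..} h"
    then show ?thesis by (simp add: borel_measurable_continuous_on_indicator)
  qed
  then show i: "set_integrable lborel {0..} h"
    unfolding set_integrable_def
  proof (rule Bochner_Integration.integrable_bound[OF C _ eventually_mono[OF ae]])
    fix t assume "norm (indicator {0..} t *\<^sub>R h t) \<le> C * (indicator {0..} t *\<^sub>R (1 / (1 + t)\<^sup>2))"
    then show "norm (indicator {0..} t *\<^sub>R h t) \<le> norm (C * (indicator {0..} t *\<^sub>R (1 / (1 + t)\<^sup>2)))"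
      by (rule order_trans) (simp only: real_norm_def abs_ge_self)
  qed
  have "norm (LBINT t:{0..}. h t) \<le> (LBINT t. norm (indicator {0..} t *\<^sub>R h t))"
    unfolding set_lebesgue_integral_def by (rule integral_norm_bound)
  also have "\<dots> \<le> (LBINT t. C * (indicator {0..} t *\<^sub>R (1 / (1 + t)\<^sup>2)))"
    by (rule integral_mono_AE[OF integrable_norm[OF i[unfolded set_integrable_def]] C ae])
  also have "\<dots> = C"
    using hb by (subst integral_mult_right_zero) (simp add: has_bochner_integral_iff)
  finally show "norm (LBINT t:{0..}. h t) \<le> C" .
qed

lemma set_integral_Ici_eq_Ioi:
  fixes g :: "real \<Rightarrow> complex"
  assumes "set_integrable lborel {a..} g"
  shows "(LBINT t:{a..}. g t) = (LBINT t:{a<..}. g t)"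
  unfolding set_lebesgue_integral_def
proof (rule integral_cong_AE)
  show "AE t in lborel. indicator {a..} t *\<^sub>R g t = indicator {a<..} t *\<^sub>R g t"
    using AE_lborel_singleton[of a] by eventually_elim (auto simp: indicator_def)
  have "set_integrable lborel {a<..} g"
    by (rule set_integrable_subset[OF assms]) auto
  then show "(\<lambda>t. indicator {a<..} t *\<^sub>R g t) \<in> borel_measurable lborel"
    by (auto simp: set_integrable_def)
qed (use assms in \<open>auto simp: set_integrable_def\<close>)

text \<open>One-sided differentiability at \<open>a\<close> suffices, which fits functions known
  only on a closed half-line; the open half-line of integration is the form in which the sine
  integrals are truncated.\<close>

lemma integral_half_line_FTC:
  fixes G g :: "real \<Rightarrow> complex"
  assumes G: "\<And>t. t \<ge> a \<Longrightarrow> (G has_vector_derivative g t) (at t within {a..})"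
    and g: "continuous_on {a..} g" and int: "set_integrable lborel {a<..} g"
    and lim: "(G \<longlongrightarrow> L) at_top"
  shows "(LBINT t:{a<..}. g t) = L - G a"
proof -
  have "(LBINT t=ereal a..\<infinity>. g t) = L - G a"
  proof (rule interval_integral_FTC_integrable)
    show "(G has_vector_derivative g x) (at x)" if "ereal a < ereal x" for x
      using G[of x] that by (simp add: at_within_interior[of x "{a..}"])
    show "isCont g x" if "ereal a < ereal x" for x
      using continuous_on_interior[OF g, of x] that by simp
    show "((G \<circ> real_of_ereal) \<longlongrightarrow> G a) (at_right (ereal a))"
      unfolding ereal_tendsto_simps
      using has_vector_derivative_continuous[OF G[of a]]
      by (auto simp: continuous_within intro: tendsto_within_subset)
    show "((G \<circ> real_of_ereal) \<longlongrightarrow> L) (at_left \<infinity>)"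
      unfolding ereal_tendsto_simps by (rule lim)
  qed (use int in auto)
  then show ?thesis by (simp add: interval_integral_to_infinity_eq)
qed

text \<open>The mean value inequality compares g on [t, T] with - D / (1 + x)^(n+1), and then T
  tends to infinity. The derivative of the comparison function carries a surplus factor n + 1, which
  is given away so that the same \<open>D\<close> can be kept through repeated integration.\<close>

lemma inverse_power_decay_antiderivative:
  fixes g g' :: "real \<Rightarrow> complex"
  assumes g: "\<And>t. t \<ge> 0 \<Longrightarrow> (g has_vector_derivative g' t) (at t within {0..})"
    and lim: "(g \<longlongrightarrow> 0) at_top"
    and bound: "\<And>t. t \<ge> 0 \<Longrightarrow> norm (g' t) \<le> D / (1 + t) ^ (n + 2)"
    and t: "t \<ge> 0"
  shows "norm (g t) \<le> D / (1 + t) ^ (n + 1)"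
proof -
  have "0 \<le> norm (g' 0)" by simp
  also have "\<dots> \<le> D" using bound[of 0] by simp
  finally have D: "D \<ge> 0" .
  have cont: "continuous_on {0..} g"
    using g by (auto simp: continuous_on_eq_continuous_within intro: has_vector_derivative_continuous)
  have incr: "norm (g T - g t) \<le> D / (1 + t) ^ (n + 1)" if T: "T > t" for T
  proof -
    have "norm (g T - g t) \<le> (- D / (1 + T) ^ (n + 1)) - (- D / (1 + t) ^ (n + 1))"
    proof (rule differentiable_bound_general[OF T])
      show "continuous_on {t..T} g" by (rule continuous_on_subset[OF cont]) (use t in auto)
      show "continuous_on {t..T} (\<lambda>x. - D / (1 + x) ^ (n + 1))"
        using t by (intro continuous_intros) auto
      fix x assume x: "t < x" "x < T"
      show "(g has_vector_derivative g' x) (at x)"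
        using g[of x] x t by (simp add: at_within_interior[of x "{0..}"])
      show "((\<lambda>x. - D / (1 + x) ^ (n + 1)) has_vector_derivative (real n + 1) * (D / (1 + x) ^ (n + 2))) (at x)"
      proof -
        have y: "1 + x > 0" using x t by simp
        have "((\<lambda>x. 1 + x) has_real_derivative 1) (at x)"
          by (auto intro!: derivative_eq_intros)
        from DERIV_divide[OF DERIV_const[of "- D"] DERIV_power_Suc[OF this, of n]] y
        have "((\<lambda>x. - D / (1 + x) ^ Suc n) has_real_derivative
            (0 * (1 + x) ^ Suc n - - D * ((1 + real n) * (1 * (1 + x) ^ n))) / ((1 + x) ^ Suc n * (1 + x) ^ Suc n)) (at x)"
          by (simp del: power_Suc add: power_eq_0_iff)
        moreover have "(0 * z ^ Suc n - - D * ((1 + real n) * (1 * z ^ n))) / (z ^ Suc n * z ^ Suc n) =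
            (real n + 1) * (D / z ^ (n + 2))" if "z > 0" for z
          using that by (simp add: field_simps)
        ultimately show ?thesis
          using y by (simp add: has_real_derivative_iff_has_vector_derivative ac_simps)
      qed
      have "norm (g' x) \<le> 1 * (D / (1 + x) ^ (n + 2))" using bound[of x] x t by simp
      also have "\<dots> \<le> (real n + 1) * (D / (1 + x) ^ (n + 2))"
        using x t D by (intro mult_right_mono) auto
      finally show "norm (g' x) \<le> (real n + 1) * (D / (1 + x) ^ (n + 2))" .
    qed
    also have "\<dots> \<le> D / (1 + t) ^ (n + 1)" using D T t by simp
    finally show ?thesis .
  qed
  have "((\<lambda>T. norm (g T - g t)) \<longlongrightarrow> norm (0 - g t)) at_top"
    by (intro tendsto_intros lim)
  then have "norm (0 - g t) \<le> D / (1 + t) ^ (n + 1)"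
    by (rule tendsto_upperbound) (rule eventually_mono[OF eventually_gt_at_top[of t] incr], simp_all)
  then show ?thesis by simp
qed

text \<open>The constant \<open>D\<close> serves as a norm of \<open>f\<close>: it also controls \<open>f2\<close>, \<open>f1\<close> and \<open>f\<close>, which
  vanish at infinity.\<close>

definition tame ::
  "real \<Rightarrow> (real \<Rightarrow> complex) \<Rightarrow> (real \<Rightarrow> complex) \<Rightarrow> (real \<Rightarrow> complex) \<Rightarrow> (real \<Rightarrow> complex) \<Rightarrow> bool" where
  "tame D f f1 f2 f3 \<longleftrightarrow>
     (\<forall>t\<ge>0. (f has_vector_derivative f1 t) (at t within {0..})) \<and>
     (\<forall>t\<ge>0. (f1 has_vector_derivative f2 t) (at t within {0..})) \<and>
     (\<forall>t\<ge>0. (f2 has_vector_derivative f3 t) (at t within {0..})) \<and>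
     continuous_on {0..} f3 \<and>
     (f \<longlongrightarrow> 0) at_top \<and> (f1 \<longlongrightarrow> 0) at_top \<and> (f2 \<longlongrightarrow> 0) at_top \<and>
     (\<forall>t\<ge>0. norm (f3 t) \<le> D / (1 + t) ^ 6)"

lemma tame_continuous:
  assumes "tame D f f1 f2 f3"
  shows "continuous_on {0..} f" "continuous_on {0..} f1" "continuous_on {0..} f2" "continuous_on {0..} f3"
  using assms unfolding tame_def continuous_on_eq_continuous_within
  by (meson atLeast_iff has_vector_derivative_continuous)+

lemma tame_bounds:
  assumes "tame D f f1 f2 f3" and t: "t \<ge> 0"
  shows "norm (f3 t) \<le> D / (1 + t) ^ 6" "norm (f2 t) \<le> D / (1 + t) ^ 5"
    "norm (f1 t) \<le> D / (1 + t) ^ 4" "norm (f t) \<le> D / (1 + t) ^ 3"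
proof -
  note tm = assms(1)[unfolded tame_def]
  have 3: "norm (f3 t) \<le> D / (1 + t) ^ (4 + 2)" if "t \<ge> 0" for t using tm that by simp
  have 2: "norm (f2 t) \<le> D / (1 + t) ^ (4 + 1)" if "t \<ge> 0" for t
    by (rule inverse_power_decay_antiderivative[OF _ _ 3]) (use tm that in auto)
  then have 2: "norm (f2 t) \<le> D / (1 + t) ^ (3 + 2)" if "t \<ge> 0" for t using that by simp
  have 1: "norm (f1 t) \<le> D / (1 + t) ^ (3 + 1)" if "t \<ge> 0" for t
    by (rule inverse_power_decay_antiderivative[OF _ _ 2]) (use tm that in auto)
  then have 1: "norm (f1 t) \<le> D / (1 + t) ^ (2 + 2)" if "t \<ge> 0" for t using that by simp
  have 0: "norm (f t) \<le> D / (1 + t) ^ (2 + 1)" if "t \<ge> 0" for t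
    by (rule inverse_power_decay_antiderivative[OF _ _ 1]) (use tm that in auto)
  show "norm (f3 t) \<le> D / (1 + t) ^ 6" "norm (f2 t) \<le> D / (1 + t) ^ 5"
    "norm (f1 t) \<le> D / (1 + t) ^ 4" "norm (f t) \<le> D / (1 + t) ^ 3"
    using 3[OF t] 2[OF t] 1[OF t] 0[OF t] by simp_all
qed

lemma tame_nonneg: "tame D f f1 f2 f3 \<Longrightarrow> D \<ge> 0"
  using order_trans[OF norm_ge_zero tame_bounds(1)[of D f f1 f2 f3 0]] by simp

lemma tame_bes_integrable:
  assumes "tame D f f1 f2 f3" and A: "A \<ge> 0"
  shows "set_integrable lborel {0..} (\<lambda>t. f t * of_real (bes (A * t)))"
    and "norm (LBINT t:{0..}. f t * of_real (bes (A * t))) \<le> D"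
proof -
  have D: "D \<ge> 0" using assms(1) by (rule tame_nonneg)
  have "continuous_on {0..} (\<lambda>t. bes (A * t))"
    by (intro continuous_on_bes continuous_intros)
  then have c: "continuous_on {0..} (\<lambda>t. f t * of_real (bes (A * t)))"
    by (intro continuous_intros tame_continuous[OF assms(1)])
  have b: "norm (f t * of_real (bes (A * t))) \<le> D / (1 + t)\<^sup>2" if t: "t > 0" for t
  proof -
    have "norm (f t * of_real (bes (A * t))) \<le> D / (1 + t) ^ 3 * 1"
      unfolding norm_mult norm_of_real
      by (intro mult_mono tame_bounds(4)[OF assms(1)] abs_bes_le_1) (use A t D in auto)
    also have "\<dots> \<le> D / (1 + t)\<^sup>2"
      using D t by (auto intro!: divide_left_mono power_increasing)
    finally show ?thesis .
  qed
  show "set_integrable lborel {0..} (\<lambda>t. f t * of_real (bes (A * t)))"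
    "norm (LBINT t:{0..}. f t * of_real (bes (A * t))) \<le> D"
    using set_integrable_inverse_square_bound[of "\<lambda>t. f t * of_real (bes (A * t))" D] c b by auto
qed

text \<open>The Bessel equation \<open>(t b')' = - A b\<close> for \<open>b t = bes (A t)\<close> turns each integration by parts against \<open>b\<close>
  into a factor \<open>1 / A\<close>; the last one is only carried out halfway.\<close>

lemma tame_bes_integral_decay:
  assumes "tame D f f1 f2 f3" and A: "A > 0"
  shows "norm (LBINT t:{0..}. f t * of_real (bes (A * t))) \<le> 3 * D * A powr (-3/2)"
proof -
  have D: "D \<ge> 0" using assms(1) by (rule tame_nonneg)
  note tm = assms(1)[unfolded tame_def]
  \<comment> \<open>\<open>q t\<close> is t times the derivative of \<open>b\<close>, so that
    Bessel's equation reads q' = - A b.\<close>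
  define b q where "b t = complex_of_real (bes (A * t))" and "q t = complex_of_real (A * t * bes' (A * t))" for t
  \<comment> \<open>\<open>G\<close> gathers the boundary terms of all the integrations by parts
    into one antiderivative of - A^2 f b - r. It vanishes at 0, since t and \<open>q t\<close> do,
    and at infinity by the decay of \<open>f\<close>, \<open>f1\<close> and \<open>f2\<close>. Only
    \<open>r\<close> is left to be estimated, and its factor \<open>q\<close> contributes sqrt
    A.\<close>
  define G where "G t = of_real A * f t * q t - of_real A * of_real t * f1 t * b t - q t * (f1 t + of_real t * f2 t)" for t
  define r where "r t = q t * (2 * f2 t + of_real t * f3 t)" for t
  have db: "(b has_vector_derivative of_real (A * bes' (A * t))) (at t within S)" for t S
  proof -
    have "((\<lambda>t. bes (A * t)) has_real_derivative A * bes' (A * t)) (at t within S)"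
      by (subst mult.commute, rule DERIV_chain2[OF DERIV_bes]) (auto intro!: derivative_eq_intros)
    then show ?thesis unfolding b_def[abs_def]
      by (rule has_vector_derivative_of_real)
  qed
  have dq: "(q has_vector_derivative - of_real A * b t) (at t within S)" for t S
  proof -
    have "((\<lambda>t. bes' (A * t)) has_real_derivative bes'' (A * t) * A) (at t within S)"
      by (rule DERIV_chain2[OF DERIV_bes']) (auto intro!: derivative_eq_intros)
    then have "((\<lambda>t. A * t * bes' (A * t)) has_real_derivative A * bes' (A * t) + A * t * (bes'' (A * t) * A)) (at t within S)"
      by (auto intro!: derivative_eq_intros)
    also have "A * bes' (A * t) + A * t * (bes'' (A * t) * A) = A * (A * t * bes'' (A * t) + bes' (A * t) + bes (A * t)) - A * bes (A * t)"
      by (simp add: algebra_simps)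
    also have "\<dots> = - A * bes (A * t)"
      unfolding bes_ode by simp
    finally show ?thesis
      using has_vector_derivative_of_real by (fastforce simp: q_def[abs_def] b_def)
  qed
  have cb: "continuous_on S b" and cq: "continuous_on S q" for S
    unfolding continuous_on_eq_continuous_within
    using has_vector_derivative_continuous[OF db] has_vector_derivative_continuous[OF dq] by blast+
  have dG: "(G has_vector_derivative (- of_real (A\<^sup>2) * (f t * b t) - r t)) (at t within {0..})" if t: "t \<ge> 0" for t
  proof -
    have f: "(f has_vector_derivative f1 t) (at t within {0..})"
      "(f1 has_vector_derivative f2 t) (at t within {0..})"
      "(f2 has_vector_derivative f3 t) (at t within {0..})"
      using tm t by auto
    have id: "(complex_of_real has_vector_derivative 1) (at t within {0..})"
      using has_vector_derivative_of_real[OF DERIV_ident] by fastforce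
    have qb: "q t = of_real t * of_real (A * bes' (A * t))" by (simp add: q_def)
    note const = has_vector_derivative_const[of "complex_of_real A" "at t within {0..}"]
    note mult = has_vector_derivative_mult
    note e1 = mult[OF mult[OF const f(1)] dq[of t "{0..}"]]
    note e2 = mult[OF mult[OF mult[OF const id] f(2)] db[of t "{0..}"]]
    note e3 = mult[OF dq[of t "{0..}"] has_vector_derivative_add[OF f(2) mult[OF id f(3)]]]
    from has_vector_derivative_diff[OF has_vector_derivative_diff[OF e1 e2] e3]
    show ?thesis
      unfolding G_def[abs_def]
      by (rule has_vector_derivative_eq_rhs) (unfold r_def qb of_real_power, algebra)
  qed
  have qbound: "norm (q t) \<le> sqrt A * sqrt t" if "t \<ge> 0" for t
    using abs_bes'_le[of "A * t"] that A unfolding q_def norm_of_real by (simp add: real_sqrt_mult)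
  have shift: "(1 + t) * (c / (1 + t) ^ Suc n) = c / (1 + t) ^ n" if "t > 0" for t c :: real and n
    using that by simp
  have rb: "norm (r t) \<le> 3 * D * sqrt A / (1 + t)\<^sup>2" if t: "t > 0" for t
  proof -
    have "norm (2 * f2 t + of_real t * f3 t) \<le> norm (2 * f2 t) + norm (of_real t * f3 t)"
      by (rule norm_triangle_ineq)
    also have "\<dots> \<le> 2 * (D / (1 + t) ^ 5) + (1 + t) * (D / (1 + t) ^ 6)"
      unfolding norm_mult
      by (intro add_mono mult_mono tame_bounds[OF assms(1)]) (use t in auto)
    also have "(1 + t) * (D / (1 + t) ^ 6) = D / (1 + t) ^ 5"
      using t shift[of t D 5] by simp
    also have "2 * (D / (1 + t) ^ 5) + D / (1 + t) ^ 5 = 3 * D / (1 + t) ^ 5"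
      by simp
    finally have "norm (r t) \<le> (sqrt A * sqrt t) * (3 * D / (1 + t) ^ 5)"
      unfolding r_def norm_mult[of "q t"] by (intro mult_mono qbound) (use t A in auto)
    also have "\<dots> \<le> (sqrt A * (1 + t)) * (3 * D / (1 + t) ^ 5)"
    proof -
      have "sqrt t \<le> 1 + t" using t by (intro real_le_lsqrt) (auto simp: power2_eq_square algebra_simps)
      then show ?thesis using t D A by (intro mult_right_mono mult_left_mono) auto
    qed
    also have "\<dots> = sqrt A * ((1 + t) * (3 * D / (1 + t) ^ 5))"
      by simp
    also have "\<dots> = 3 * D * sqrt A / (1 + t) ^ 4"
      using t shift[of t "3 * D" 4] by simp
    also have "\<dots> \<le> 3 * D * sqrt A / (1 + t)\<^sup>2"
      using D t A by (auto intro!: divide_left_mono power_increasing)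
    finally show ?thesis .
  qed
  have cr: "continuous_on {0..} r"
    unfolding r_def[abs_def] by (intro continuous_intros cq tame_continuous[OF assms(1)])
  have ri: "set_integrable lborel {0..} r" and rn: "norm (LBINT t:{0..}. r t) \<le> 3 * D * sqrt A"
    using set_integrable_inverse_square_bound[of r "3 * D * sqrt A"] cr rb by auto
  have fi: "set_integrable lborel {0..} (\<lambda>t. f t * b t)"
    unfolding b_def using tame_bes_integrable(1)[OF assms(1)] A by simp
  have limG: "(G \<longlongrightarrow> 0) at_top"
  proof (rule Lim_null_comparison)
    show "\<forall>\<^sub>F t in at_top. norm (G t) \<le> D * (A * sqrt A * (sqrt t / (1 + t) ^ 3) + A * (t / (1 + t) ^ 4) + sqrt A * (sqrt t * (1 / (1 + t) ^ 4 + t / (1 + t) ^ 5)))"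
      using eventually_ge_at_top[of 0]
    proof eventually_elim
      case (elim t)
      note tb = tame_bounds[OF assms(1) elim]
      have "norm (G t) \<le> norm (of_real A * f t * q t) + norm (of_real A * of_real t * f1 t * b t) + norm (q t * (f1 t + of_real t * f2 t))"
        unfolding G_def by (intro order_trans[OF norm_triangle_ineq4] add_right_mono norm_triangle_ineq4)
      also have "\<dots> \<le> A * (D / (1 + t) ^ 3) * (sqrt A * sqrt t) + A * t * (D / (1 + t) ^ 4) * 1 +
          (sqrt A * sqrt t) * (D / (1 + t) ^ 4 + t * (D / (1 + t) ^ 5))"
      proof (intro add_mono)
        show "norm (of_real A * f t * q t) \<le> A * (D / (1 + t) ^ 3) * (sqrt A * sqrt t)"
          unfolding norm_mult by (intro mult_mono tb(4) qbound elim) (use elim A D in auto)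
        show "norm (of_real A * of_real t * f1 t * b t) \<le> A * t * (D / (1 + t) ^ 4) * 1"
          unfolding norm_mult b_def norm_of_real
          by (intro mult_mono tb(3) abs_bes_le_1) (use elim A D in auto)
        have "norm (f1 t + of_real t * f2 t) \<le> norm (f1 t) + norm (of_real t * f2 t)"
          by (rule norm_triangle_ineq)
        also have "\<dots> \<le> D / (1 + t) ^ 4 + t * (D / (1 + t) ^ 5)"
          unfolding norm_mult by (intro add_mono mult_mono tb) (use elim in auto)
        finally show "norm (q t * (f1 t + of_real t * f2 t)) \<le> (sqrt A * sqrt t) * (D / (1 + t) ^ 4 + t * (D / (1 + t) ^ 5))"
          unfolding norm_mult[of "q t"] by (intro mult_mono qbound elim) (use elim A in auto)
      qed
      also have "\<dots> = D * (A * sqrt A * (sqrt t / (1 + t) ^ 3) + A * (t / (1 + t) ^ 4) + sqrt A * (sqrt t * (1 / (1 + t) ^ 4 + t / (1 + t) ^ 5)))"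
        by (simp add: algebra_simps)
      finally show ?case .
    qed
    have "((\<lambda>t::real. sqrt t / (1 + t) ^ 3) \<longlongrightarrow> 0) at_top" "((\<lambda>t::real. t / (1 + t) ^ 4) \<longlongrightarrow> 0) at_top"
      "((\<lambda>t::real. sqrt t * (1 / (1 + t) ^ 4 + t / (1 + t) ^ 5)) \<longlongrightarrow> 0) at_top"
      by real_asymp+
    then show "((\<lambda>t. D * (A * sqrt A * (sqrt t / (1 + t) ^ 3) + A * (t / (1 + t) ^ 4) + sqrt A * (sqrt t * (1 / (1 + t) ^ 4 + t / (1 + t) ^ 5)))) \<longlongrightarrow> 0) at_top"
      by (intro tendsto_mult_right_zero tendsto_add_zero)
  qed
  have fi': "set_integrable lborel {0..} (\<lambda>t. - of_real (A\<^sup>2) * (f t * b t))"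
    using fi by (rule set_integrable_mult_right)
  have "- of_real (A\<^sup>2) * (LBINT t:{0..}. f t * b t) - (LBINT t:{0..}. r t) =
      (LBINT t:{0..}. - of_real (A\<^sup>2) * (f t * b t) - r t)"
    by (simp only: set_integral_diff(2)[OF fi' ri] set_integral_mult_right)
  also have "\<dots> = 0 - G 0"
    unfolding set_integral_Ici_eq_Ioi[OF set_integral_diff(1)[OF fi' ri]]
  proof (rule integral_half_line_FTC[OF dG _ _ limG])
    show "continuous_on {0..} (\<lambda>t. - complex_of_real (A\<^sup>2) * (f t * b t) - r t)"
      by (intro continuous_intros cr cb tame_continuous[OF assms(1)])
    show "set_integrable lborel {0<..} (\<lambda>t. - complex_of_real (A\<^sup>2) * (f t * b t) - r t)"
      by (rule set_integrable_subset[OF set_integral_diff(1)[OF fi' ri]]) auto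
  qed
  also have "G 0 = 0" by (simp add: G_def q_def)
  finally have "of_real (A\<^sup>2) * (LBINT t:{0..}. f t * b t) = - (LBINT t:{0..}. r t)"
    by algebra
  then have "norm (of_real (A\<^sup>2) * (LBINT t:{0..}. f t * b t)) \<le> 3 * D * sqrt A"
    using rn by simp
  then have "A\<^sup>2 * norm (LBINT t:{0..}. f t * b t) \<le> 3 * D * sqrt A"
    unfolding norm_mult norm_of_real by simp
  then have "norm (LBINT t:{0..}. f t * b t) \<le> 3 * D * (sqrt A / A\<^sup>2)"
    using A by (simp add: pos_le_divide_eq mult.commute)
  also have "sqrt A / A\<^sup>2 = A powr (1/2) / A powr 2"
    using A by (simp only: powr_half_sqrt powr_numeral less_imp_le)
  also have "\<dots> = A powr (-3/2)"
    by (subst powr_diff[symmetric]) simp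
  finally show ?thesis by (simp add: b_def)
qed

section \<open>A Laplace integral\<close>

text \<open>Cauchy's formula on the rectangle with base [-R, R] and height sqrt R. The integrand
  decays only like 1 / |w| on the real axis; with this height the vertical sides contribute order
  sqrt R / R, and on the top the factor exp (- A sqrt R) beats the length 2 R.\<close>

lemma laplace_sine_integral:
  fixes A b :: real
  assumes A: "A > 0" and b: "b > 0"
  shows "((\<lambda>R. integral {0..R} (\<lambda>v. v * sin (A * v) / (v\<^sup>2 + b\<^sup>2))) \<longlongrightarrow> pi / 2 * exp (- A * b)) at_top"
proof -
  \<comment> \<open>\<open>f\<close> is \<open>g\<close> multiplied by w - i b, which removes the
    pole inside the rectangle. The other pole, - i b, lies outside the half-plane
    \<open>S\<close>.\<close>
  define f where "f w = w * exp (\<i> * of_real A * w) / (w + \<i> * of_real b)" for w :: complex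
  define g where "g w = w * exp (\<i> * of_real A * w) / (w\<^sup>2 + of_real (b\<^sup>2))" for w :: complex
  define S where "S = {w. Im w > - b}"
  have sing: "w\<^sup>2 + of_real (b\<^sup>2) = (w + \<i> * of_real b) * (w - \<i> * of_real b)" for w
    by (simp add: algebra_simps power2_eq_square)
  have fg: "f w / (w - \<i> * of_real b) = g w" for w
    unfolding f_def g_def sing by simp
  have nz: "w + \<i> * of_real b \<noteq> 0" if "w \<in> S" for w
    using that by (auto simp: S_def complex_eq_iff)
  have holf: "f holomorphic_on S"
    unfolding f_def[abs_def] by (intro holomorphic_intros nz)
  have cvx: "convex S" unfolding S_def by (rule convex_halfspace_Im_gt)
  have opn: "open S" unfolding S_def by (rule open_halfspace_Im_gt)
  have fib: "f (\<i> * of_real b) = exp (- A * b) / 2"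
    using b by (simp add: f_def exp_of_real[symmetric] field_simps)
  have gbound: "norm (g w) \<le> 2 * exp (- A * Im w) / norm w" if w: "(norm w)\<^sup>2 \<ge> 2 * b\<^sup>2" for w
  proof -
    have w0: "norm w > 0" using w b by (cases "w = 0") auto
    have "(norm w)\<^sup>2 - b\<^sup>2 \<le> norm (w\<^sup>2 + of_real (b\<^sup>2))"
      using norm_diff_ineq[of "w\<^sup>2" "of_real (b\<^sup>2)"] by (simp add: norm_power)
    then have "(norm w)\<^sup>2 / 2 \<le> norm (w\<^sup>2 + of_real (b\<^sup>2))" using w by linarith
    then have "norm (g w) \<le> norm w * exp (- A * Im w) / ((norm w)\<^sup>2 / 2)"
      unfolding g_def norm_divide norm_mult
      by (intro frac_le mult_mono) (use w0 in auto)
    also have "\<dots> = 2 * exp (- A * Im w) / norm w"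
      using w0 by (simp add: power2_eq_square)
    finally show ?thesis .
  qed
  define J where "J R = contour_integral (linepath (- of_real R) (of_real R)) g" for R
  \<comment> \<open>Each vertical side contributes 2 / R times its length sqrt R; the top
    contributes 2 exp (- A sqrt R) / sqrt R times its length 2 R.\<close>
  define E where "E R = 4 / sqrt R + 4 * sqrt R * exp (- A * sqrt R)" for R
  \<comment> \<open>The threshold gives sqrt R > 1 and R > 2 b^2. Hence i b lies below the top side,
    and \<open>gbound\<close> applies on the three sides off the real axis.\<close>
  have est: "norm (J R - \<i> * of_real (pi * exp (- A * b))) \<le> E R" if R: "R > 1 + 2 * b\<^sup>2" for R
  proof -
    define H where "H = sqrt R"
    have R1: "R > 1" using R zero_le_power2[of b] by linarith
    have H0: "H > 1" using R1 by (simp add: H_def)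
    have HH: "H * H = R" using R1 by (simp add: H_def)
    have Hb: "H\<^sup>2 > 2 * b\<^sup>2" using R R1 by (simp add: H_def)
    have bH: "b < H"
    proof (rule power2_less_imp_less)
      show "b\<^sup>2 < H\<^sup>2" using Hb zero_le_power2[of b] by linarith
    qed (use H0 in auto)
    have RH: "R > H" using mult_strict_left_mono[of 1 H H] HH H0 by simp
    have R2: "R\<^sup>2 \<ge> 2 * b\<^sup>2"
      using Hb power_mono[of H R 2] RH H0 by linarith
    define a1 a2 a3 a4 where "a1 = Complex (- R) 0" and "a2 = Complex R 0"
      and "a3 = Complex R H" and "a4 = Complex (- R) H"
    have rect: "rectpath a1 a3 = linepath a1 a2 +++ linepath a2 a3 +++ linepath a3 a4 +++ linepath a4 a1"
      by (simp add: rectpath_def Let_def a1_def a2_def a3_def a4_def)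
    have inbox: "\<i> * of_real b \<in> box a1 a3"
      using b bH R1 by (auto simp: in_box_complex_iff a1_def a3_def)
    have img: "path_image (rectpath a1 a3) \<subseteq> S - {\<i> * of_real b}"
    proof -
      have "path_image (rectpath a1 a3) = cbox a1 a3 - box a1 a3"
        using R1 H0 by (intro path_image_rectpath_cbox_minus_box) (auto simp: a1_def a3_def)
      moreover have "cbox a1 a3 \<subseteq> S"
        using b by (auto simp: in_cbox_complex_iff a1_def a3_def S_def)
      ultimately show ?thesis using inbox by auto
    qed
    have hol: "g holomorphic_on S - {\<i> * of_real b}"
    proof -
      have "(\<lambda>w. f w / (w - \<i> * of_real b)) holomorphic_on S - {\<i> * of_real b}"
        by (intro holomorphic_intros holomorphic_on_subset[OF holf]) auto
      then show ?thesis by (simp add: fg)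
    qed
    have "((\<lambda>w. f w / (w - \<i> * of_real b)) has_contour_integral
        (2 * pi * \<i> * winding_number (rectpath a1 a3) (\<i> * of_real b) * f (\<i> * of_real b))) (rectpath a1 a3)"
    proof (rule Cauchy_integral_formula_convex_simple[OF cvx holf _ _ img])
      show "\<i> * of_real b \<in> interior S" using b opn by (simp add: interior_open S_def)
    qed auto
    then have tot: "contour_integral (rectpath a1 a3) g = \<i> * of_real (pi * exp (- A * b))"
      unfolding fg winding_number_rectpath[OF inbox] fib
      by (simp add: contour_integral_unique exp_of_real[symmetric])
    have seg: "closed_segment x y \<subseteq> S - {\<i> * of_real b}"
      if "linepath x y \<in> {linepath a1 a2, linepath a2 a3, linepath a3 a4, linepath a4 a1}" for x y
    proof -
      have "path_image (linepath x y) \<subseteq> path_image (rectpath a1 a3)"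
        using that by (auto simp: rect path_image_join simp del: path_image_linepath)
      then show ?thesis using img by simp
    qed
    have ci: "g contour_integrable_on linepath x y"
      if "linepath x y \<in> {linepath a1 a2, linepath a2 a3, linepath a3 a4, linepath a4 a1}" for x y
      by (intro contour_integrable_continuous_linepath holomorphic_on_imp_continuous_on
          holomorphic_on_subset[OF hol] seg that)
    have sum: "contour_integral (rectpath a1 a3) g = contour_integral (linepath a1 a2) g +
       (contour_integral (linepath a2 a3) g + (contour_integral (linepath a3 a4) g + contour_integral (linepath a4 a1) g))"
      unfolding rect using ci
      by (simp add: contour_integral_join contour_integrable_joinI valid_path_join)
    have side: "norm (contour_integral (linepath x y) g) \<le> 2 / R * H"
      if xy: "(x, y) = (a2, a3) \<or> (x, y) = (a4, a1)" for x y
    proof -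
      have "norm (contour_integral (linepath x y) g) \<le> 2 / R * norm (y - x)"
      proof (rule contour_integral_bound_linepath)
        show "g contour_integrable_on linepath x y" using xy by (intro ci) auto
        fix w assume w: "w \<in> closed_segment x y"
        have Re: "\<bar>Re w\<bar> = R"
          using w xy R1 closed_segment_same_Re[of x y] by (auto simp: a1_def a2_def a3_def a4_def)
        have Im: "Im w \<ge> 0"
          using w xy H0 closed_segment_same_Re[of x y]
          by (auto simp: a1_def a2_def a3_def a4_def closed_segment_eq_real_ivl)
        have nw: "R \<le> norm w" using abs_Re_le_cmod[of w] Re by simp
        then have "2 * b\<^sup>2 \<le> (norm w)\<^sup>2" using R2 R1 power_mono[of R "norm w" 2] by linarith
        from gbound[OF this] have "norm (g w) \<le> 2 * exp (- A * Im w) / norm w" .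
        also have "\<dots> \<le> 2 * 1 / R"
          using nw R1 Im A by (intro frac_le mult_left_mono) auto
        finally show "norm (g w) \<le> 2 / R" by simp
      qed (use R1 in auto)
      also have "norm (y - x) = H"
        using xy H0 by (auto simp: a1_def a2_def a3_def a4_def cmod_def)
      finally show ?thesis .
    qed
    have top: "norm (contour_integral (linepath a3 a4) g) \<le> 2 * exp (- A * H) / H * (2 * R)"
    proof -
      have "norm (contour_integral (linepath a3 a4) g) \<le> 2 * exp (- A * H) / H * norm (a4 - a3)"
      proof (rule contour_integral_bound_linepath)
        show "g contour_integrable_on linepath a3 a4" by (intro ci) auto
        fix w assume w: "w \<in> closed_segment a3 a4"
        have Im: "Im w = H"
          using w closed_segment_same_Im[of a3 a4] by (auto simp: a3_def a4_def)
        have nw: "H \<le> norm w" using abs_Im_le_cmod[of w] Im H0 by simp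
        then have "2 * b\<^sup>2 \<le> (norm w)\<^sup>2" using Hb H0 power_mono[of H "norm w" 2] by linarith
        from gbound[OF this] have "norm (g w) \<le> 2 * exp (- A * Im w) / norm w" .
        also have "\<dots> \<le> 2 * exp (- A * H) / H"
          using nw H0 Im by (intro frac_le) auto
        finally show "norm (g w) \<le> 2 * exp (- A * H) / H" .
      qed (use H0 in auto)
      also have "norm (a4 - a3) = 2 * R"
        using R1 by (simp add: a3_def a4_def cmod_def real_sqrt_mult)
      finally show ?thesis .
    qed
    have "a1 = - of_real R" "a2 = of_real R" by (simp_all add: a1_def a2_def complex_eq_iff)
    then have "J R = contour_integral (linepath a1 a2) g" by (simp add: J_def)
    then have "J R - \<i> * of_real (pi * exp (- A * b)) =
        - (contour_integral (linepath a2 a3) g + (contour_integral (linepath a3 a4) g + contour_integral (linepath a4 a1) g))"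
      using sum tot by (simp add: algebra_simps)
    then have "norm (J R - \<i> * of_real (pi * exp (- A * b))) \<le>
        norm (contour_integral (linepath a2 a3) g) + (norm (contour_integral (linepath a3 a4) g) + norm (contour_integral (linepath a4 a1) g))"
      by (simp only: norm_minus_cancel) (intro order_trans[OF norm_triangle_ineq] add_left_mono norm_triangle_ineq)
    also have "\<dots> \<le> 2 / R * H + (2 * exp (- A * H) / H * (2 * R) + 2 / R * H)"
      by (intro add_mono side top) auto
    also have "\<dots> = E R"
      using H0 unfolding E_def H_def[symmetric] HH[symmetric] by (simp add: field_simps)
    finally show ?thesis .
  qed
  have limE: "(E \<longlongrightarrow> 0) at_top"
    unfolding E_def using A by real_asymp
  have "((\<lambda>R. J R - \<i> * of_real (pi * exp (- A * b))) \<longlongrightarrow> 0) at_top"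
    by (rule Lim_null_comparison[OF _ limE])
       (rule eventually_mono[OF eventually_gt_at_top[of "1 + 2 * b\<^sup>2"] est])
  then have "(J \<longlongrightarrow> \<i> * of_real (pi * exp (- A * b))) at_top"
    by (simp add: LIM_zero_iff)
  then have limJ: "((\<lambda>R. Im (J R)) \<longlongrightarrow> pi * exp (- A * b)) at_top"
    using tendsto_Im by fastforce
  define h where "h v = v * sin (A * v) / (v\<^sup>2 + b\<^sup>2)" for v
  have den: "v\<^sup>2 + b\<^sup>2 \<noteq> 0" for v using b by (simp add: add_nonneg_eq_0_iff)
  have hc: "continuous_on X h" for X
    unfolding h_def[abs_def] by (intro continuous_intros) (use den in auto)
  have ImJ: "Im (J R) = 2 * integral {0..R} h" if R: "R > 0" for R
  proof -
    have gr: "g (of_real x) = of_real (x / (x\<^sup>2 + b\<^sup>2)) * exp (\<i> * of_real (A * x))" for x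
      by (simp add: g_def mult_ac)
    have gc: "continuous_on {-R..R} (\<lambda>x. g (of_real x))"
      unfolding gr by (intro continuous_intros) (use den in auto)
    have "J R = integral {-R..R} (\<lambda>x. g (of_real x))"
      using contour_integral_linepath_Reals_eq[of "- of_real R" "of_real R" g] R by (simp add: J_def)
    then have "Im (J R) = integral {-R..R} (\<lambda>x. Im (g (of_real x)))"
      using integral_linear[OF integrable_continuous_real[OF gc] bounded_linear_Im] by (simp add: o_def)
    also have "(\<lambda>x. Im (g (of_real x))) = h"
      unfolding gr by (simp add: h_def fun_eq_iff Im_exp)
    also have "integral {-R..R} h = integral {-R..0} h + integral {0..R} h"
      using R by (intro Henstock_Kurzweil_Integration.integral_combine[symmetric] integrable_continuous_real hc) auto
    also have "integral {-R..0} h = integral {0..R} (\<lambda>x. h (- x))"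
      using Henstock_Kurzweil_Integration.integral_reflect_real[of 0 "- R" h] by simp
    also have "(\<lambda>x. h (- x)) = h" by (simp add: h_def fun_eq_iff)
    finally show ?thesis by simp
  qed
  have "((\<lambda>R. Im (J R) / 2) \<longlongrightarrow> pi * exp (- A * b) / 2) at_top"
    by (intro tendsto_intros limJ) simp
  then have "((\<lambda>R. integral {0..R} h) \<longlongrightarrow> pi * exp (- A * b) / 2) at_top"
    by (rule Lim_transform_eventually)
       (rule eventually_mono[OF eventually_gt_at_top[of 0]], simp add: ImJ)
  then show ?thesis by (simp add: h_def[abs_def] mult_ac)
qed

section \<open>The sine kernel\<close>

lemma integral_split_half_lines:
  fixes h :: "real \<Rightarrow> complex"
  assumes pos: "set_integrable lborel {0..} h" and neg: "set_integrable lborel {0..} (\<lambda>u. h (- u))"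
  shows "integrable lborel h"
    and "(LBINT u. h u) = (LBINT u:{0..}. h u) + (LBINT u:{0..}. h (- u))"
proof -
  have negr: "(\<lambda>u. indicator {0..} (0 + (-1) * u) *\<^sub>R h (- (0 + (-1) * u))) = (\<lambda>u. indicator {..0} u *\<^sub>R h u)"
    by (auto simp: indicator_def)
  have i2: "integrable lborel (\<lambda>u. indicator {..0} u *\<^sub>R h u)"
    using lborel_integrable_real_affine[OF neg[unfolded set_integrable_def], of "-1" 0] unfolding negr by simp
  have v2: "(LBINT u:{0..}. h (- u)) = (LBINT u. indicator {..0} u *\<^sub>R h u)"
    using lborel_integral_real_affine[of "-1" "\<lambda>u. indicator {0..} u *\<^sub>R h (- u)" 0]
    unfolding negr set_lebesgue_integral_def by simp
  have i1: "integrable lborel (\<lambda>u. indicator {0..} u *\<^sub>R h u)"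
    using pos by (simp add: set_integrable_def)
  have i3: "integrable lborel (\<lambda>u. indicator {..<0} u *\<^sub>R h u)"
    using i2 unfolding set_integrable_def[symmetric] by (rule set_integrable_subset) auto
  have v3: "(LBINT u. indicator {..<0} u *\<^sub>R h u) = (LBINT u. indicator {..0} u *\<^sub>R h u)"
  proof (rule integral_cong_AE)
    show "AE u in lborel. indicator {..<0} u *\<^sub>R h u = indicator {..0} u *\<^sub>R h u"
      using AE_lborel_singleton[of 0] by eventually_elim (auto simp: indicator_def)
  qed (use i2 i3 in auto)
  have h: "h = (\<lambda>u. indicator {0..} u *\<^sub>R h u + indicator {..<0} u *\<^sub>R h u)"
    by (auto simp: indicator_def fun_eq_iff)
  show "integrable lborel h"
    by (subst h) (intro Bochner_Integration.integrable_add i1 i3)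
  have "(LBINT u. h u) = (LBINT u. indicator {0..} u *\<^sub>R h u) + (LBINT u. indicator {..0} u *\<^sub>R h u)"
    by (subst h) (simp only: Bochner_Integration.integral_add[OF i1 i3] v3)
  then show "(LBINT u. h u) = (LBINT u:{0..}. h u) + (LBINT u:{0..}. h (- u))"
    unfolding v2 by (simp add: set_lebesgue_integral_def)
qed

lemma integral_inverse_square_bound:
  fixes h :: "real \<Rightarrow> complex"
  assumes h: "continuous_on UNIV h" and bound: "\<And>u. norm (h u) \<le> C / (1 + \<bar>u\<bar>)\<^sup>2"
  shows "integrable lborel h" and "norm (LBINT u. h u) \<le> 2 * C"
proof -
  have c: "continuous_on {0..} h" "continuous_on {0..} (\<lambda>u. h (- u))"
    by (auto intro!: continuous_on_subset[OF h] continuous_on_compose2[OF h] continuous_intros)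
  have b: "norm (h u) \<le> C / (1 + u)\<^sup>2" "norm (h (- u)) \<le> C / (1 + u)\<^sup>2" if "u > 0" for u
    using bound[of u] bound[of "- u"] that by auto
  have p: "set_integrable lborel {0..} h" "norm (LBINT u:{0..}. h u) \<le> C"
    using set_integrable_inverse_square_bound[of h C] c b by auto
  have n: "set_integrable lborel {0..} (\<lambda>u. h (- u))" "norm (LBINT u:{0..}. h (- u)) \<le> C"
    using set_integrable_inverse_square_bound[of "\<lambda>u. h (- u)" C] c b by auto
  show "integrable lborel h" by (rule integral_split_half_lines(1)[OF p(1) n(1)])
  have "norm (LBINT u. h u) \<le> norm (LBINT u:{0..}. h u) + norm (LBINT u:{0..}. h (- u))"
    unfolding integral_split_half_lines(2)[OF p(1) n(1)] by (rule norm_triangle_ineq)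
  then show "norm (LBINT u. h u) \<le> 2 * C" using p n by simp
qed

lemma tame_even_continuous:
  "tame D f f1 f2 f3 \<Longrightarrow> continuous_on UNIV (\<lambda>u. f \<bar>u\<bar>)"
  by (rule continuous_on_compose2[OF tame_continuous(1)]) (auto intro!: continuous_intros)

text \<open>For the Lipschitz estimate, one power of the cubic decay of \<open>f\<close> is spent on
  the factor |u| coming from the difference of the two exponentials, which still leaves an inverse
  square. It controls the transform near 0, where the sine kernel is singular.\<close>

lemma tame_fourier:
  assumes tm: "tame D f f1 f2 f3"
  shows "integrable lborel (\<lambda>u. f \<bar>u\<bar> * exp (- (\<i> * of_real x * of_real u)))"
    and "norm (fourier (\<lambda>u. f \<bar>u\<bar>) x) \<le> 2 * D"
    and "norm (fourier (\<lambda>u. f \<bar>u\<bar>) x - fourier (\<lambda>u. f \<bar>u\<bar>) y) \<le> 2 * D * \<bar>x - y\<bar>"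
proof -
  have D: "D \<ge> 0" by (rule tame_nonneg[OF tm])
  have nexp: "norm (exp (- (\<i> * of_real x * of_real u))) = 1" for x u :: real
    by simp
  have c: "continuous_on UNIV (\<lambda>u. f \<bar>u\<bar> * exp (- (\<i> * of_real x * of_real u)))" for x
    by (intro continuous_intros tame_even_continuous[OF tm])
  have b: "norm (f \<bar>u\<bar> * exp (- (\<i> * of_real x * of_real u))) \<le> D / (1 + \<bar>u\<bar>)\<^sup>2" for u x
  proof -
    have "norm (f \<bar>u\<bar>) \<le> D / (1 + \<bar>u\<bar>) ^ 3" by (rule tame_bounds(4)[OF tm]) simp
    also have "\<dots> \<le> D / (1 + \<bar>u\<bar>)\<^sup>2"
      using D by (auto intro!: divide_left_mono power_increasing)
    finally show ?thesis by (simp add: norm_mult nexp)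
  qed
  show i: "integrable lborel (\<lambda>u. f \<bar>u\<bar> * exp (- (\<i> * of_real x * of_real u)))" for x
    by (rule integral_inverse_square_bound(1)[OF c b])
  show "norm (fourier (\<lambda>u. f \<bar>u\<bar>) x) \<le> 2 * D"
    unfolding fourier_def by (rule integral_inverse_square_bound(2)[OF c b])
  define e where "e u = exp (- (\<i> * of_real x * of_real u)) - exp (- (\<i> * of_real y * of_real u))" for u :: real
  have e: "norm (e u) \<le> \<bar>x - y\<bar> * \<bar>u\<bar>" for u
  proof -
    have "e u = exp (- (\<i> * of_real y * of_real u)) * (exp (\<i> * of_real ((y - x) * u)) - 1)"
      by (simp add: e_def algebra_simps flip: exp_add)
    then have "norm (e u) = norm (exp (\<i> * of_real ((y - x) * u)) - 1)"
      by (simp add: norm_mult nexp)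
    also have "\<dots> \<le> \<bar>(y - x) * u\<bar>"
      using iexp_approx1[of "(y - x) * u" 0] by simp
    finally show ?thesis by (simp add: abs_mult abs_minus_commute)
  qed
  have "fourier (\<lambda>u. f \<bar>u\<bar>) x - fourier (\<lambda>u. f \<bar>u\<bar>) y = (LBINT u. f \<bar>u\<bar> * e u)"
    unfolding fourier_def e_def right_diff_distrib by (rule Bochner_Integration.integral_diff[OF i i, symmetric])
  also have "norm \<dots> \<le> 2 * (D * \<bar>x - y\<bar>)"
  proof (rule integral_inverse_square_bound(2))
    show "continuous_on UNIV (\<lambda>u. f \<bar>u\<bar> * e u)"
      unfolding e_def by (intro continuous_intros tame_even_continuous[OF tm])
    fix u
    have "norm (f \<bar>u\<bar> * e u) \<le> D / (1 + \<bar>u\<bar>) ^ 3 * (\<bar>x - y\<bar> * (1 + \<bar>u\<bar>))"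
      unfolding norm_mult
      by (intro mult_mono tame_bounds(4)[OF tm] order_trans[OF e] mult_left_mono) (use D in auto)
    also have "\<dots> = D * \<bar>x - y\<bar> / (1 + \<bar>u\<bar>)\<^sup>2"
    proof -
      have "c / z ^ 3 * (d * z) = c * d / z\<^sup>2" if "z > 0" for c d z :: real
        using that by (simp add: power2_eq_square power3_eq_cube)
      then show ?thesis by (simp add: add_pos_nonneg)
    qed
    finally show "norm (f \<bar>u\<bar> * e u) \<le> D * \<bar>x - y\<bar> / (1 + \<bar>u\<bar>)\<^sup>2" .
  qed
  finally show "norm (fourier (\<lambda>u. f \<bar>u\<bar>) x - fourier (\<lambda>u. f \<bar>u\<bar>) y) \<le> 2 * D * \<bar>x - y\<bar>"
    by simp
qed

lemma tame_fourier_continuous: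
  assumes tm: "tame D f f1 f2 f3"
  shows "continuous_on UNIV (fourier (\<lambda>u. f \<bar>u\<bar>))"
proof (rule lipschitz_on_continuous_on)
  show "(2 * D)-lipschitz_on UNIV (fourier (\<lambda>u. f \<bar>u\<bar>))"
    by (rule lipschitz_onI) (use tame_fourier(3)[OF tm] tame_nonneg[OF tm] in \<open>auto simp: dist_norm\<close>)
qed

text \<open>Under v = A / u the integrand becomes sin v / v, and the end \<epsilon> tending to 0
  becomes infinity. The conditional convergence of the sine kernel is thus reduced to the limit of
  \<open>Si\<close> at infinity.\<close>

lemma has_bochner_integral_sinc_window:
  assumes A: "A > 0" and \<epsilon>: "0 < \<epsilon>" "\<epsilon> < 1"
  shows "has_bochner_integral lborel (\<lambda>u. indicator {\<epsilon><..1} u *\<^sub>R (sin (A / u) / u)) (Si (A / \<epsilon>) - Si A)"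
proof -
  have c: "continuous_on {\<epsilon>..1} (\<lambda>u. sin (A / u) / u)"
    using \<epsilon> by (intro continuous_intros) auto
  have i: "set_integrable lborel {\<epsilon>..1} (\<lambda>u. sin (A / u) / u)"
    by (rule borel_integrable_atLeastAtMost'[OF c])
  have i': "set_integrable lborel {\<epsilon><..1} (\<lambda>u. sin (A / u) / u)"
    by (rule set_integrable_subset[OF i]) auto
  have "((\<lambda>u. sin (A / u) / u) has_integral - Si (A / 1) - - Si (A / \<epsilon>)) {\<epsilon>..1}"
  proof (rule fundamental_theorem_of_calculus)
    fix u assume u: "u \<in> {\<epsilon>..1}"
    then have u0: "u > 0" using \<epsilon> by auto
    have "((\<lambda>u. A / u) has_real_derivative - A / u\<^sup>2) (at u within {\<epsilon>..1})"
      using u0 by (auto intro!: derivative_eq_intros simp: power2_eq_square field_simps)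
    from DERIV_minus[OF DERIV_chain2[OF DERIV_Si this]]
    show "((\<lambda>u. - Si (A / u)) has_vector_derivative sin (A / u) / u) (at u within {\<epsilon>..1})"
      unfolding has_real_derivative_iff_has_vector_derivative[symmetric]
      using u0 A by (simp add: power2_eq_square field_simps)
  qed (use \<epsilon> in auto)
  then have "(LBINT u:{\<epsilon>..1}. sin (A / u) / u) = Si (A / \<epsilon>) - Si A"
    using set_borel_integral_eq_integral(2)[OF i] by (simp add: integral_unique)
  moreover have "(LBINT u:{\<epsilon>..1}. sin (A / u) / u) = (LBINT u:{\<epsilon><..1}. sin (A / u) / u)"
    unfolding set_lebesgue_integral_def
  proof (rule integral_cong_AE)
    show "AE u in lborel. indicator {\<epsilon>..1} u *\<^sub>R (sin (A / u) / u) = indicator {\<epsilon><..1} u *\<^sub>R (sin (A / u) / u)"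
      using AE_lborel_singleton[of \<epsilon>] by eventually_elim (auto simp: indicator_def)
  qed (use i i' in \<open>auto simp: set_integrable_def\<close>)
  ultimately show ?thesis
    using i' by (simp add: has_bochner_integral_iff set_integrable_def set_lebesgue_integral_def)
qed

text \<open>Near \<open>0\<close> the integrand is \<open>sin (A / u) / u\<close> times a Lipschitz function: subtracting the value of
  the latter at \<open>0\<close> leaves an absolutely integrable remainder and a sine integral.\<close>

lemma tame_sine_kernel_limit:
  assumes tm: "tame D f f1 f2 f3" and A: "A > 0" and B: "\<And>T. \<bar>Si T\<bar> \<le> B"
  defines "k \<equiv> \<lambda>u. of_real (sin (A / u)) * fourier (\<lambda>u. f \<bar>u\<bar>) u / of_real u"
  shows "\<epsilon> > 0 \<Longrightarrow> set_integrable lborel {\<epsilon><..} k"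
    and "\<exists>l. ((\<lambda>\<epsilon>. LBINT u:{\<epsilon><..}. k u) \<longlongrightarrow> l) (at_right 0) \<and> norm l \<le> (4 * B + 8 * (1 + A)) * D"
proof -
  have D: "D \<ge> 0" by (rule tame_nonneg[OF tm])
  define \<phi> where "\<phi> = fourier (\<lambda>u. f \<bar>u\<bar>)"
  have \<phi>c: "continuous_on UNIV \<phi>" unfolding \<phi>_def by (rule tame_fourier_continuous[OF tm])
  then have [measurable]: "\<phi> \<in> borel_measurable borel" by (rule borel_measurable_continuous_onI)
  define w where "w u = indicator {..1} u *\<^sub>R (sin (A / u) / u)" for u :: real
  define r where "r u = k u - of_real (w u) * \<phi> 0" for u
  have km [measurable]: "k \<in> borel_measurable borel"
    unfolding k_def \<phi>_def[symmetric] by measurable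
  have wm [measurable]: "w \<in> borel_measurable borel"
    unfolding w_def by measurable
  have rm: "r \<in> borel_measurable borel"
    unfolding r_def by measurable
  have sinb: "\<bar>sin (A / u)\<bar> \<le> A / u" if "u > 0" for u
    using abs_sin_x_le_abs_x[of "A / u"] that A by simp
  \<comment> \<open>For u <= 1 the Lipschitz bound gives 2 D, and (1 + u)^2 <= 4; for u > 1 the
    estimate |sin (A / u)| <= A / u gives 2 A D / u^2, and (1 + u)^2 <= 4 u^2. The constant adds 8 D
    and 8 A D.\<close>
  have rb: "norm (r u) \<le> 8 * (1 + A) * D / (1 + u)\<^sup>2" if u: "u > 0" for u
  proof (cases "u \<le> 1")
    case True
    have "r u = of_real (sin (A / u)) * (\<phi> u - \<phi> 0) / of_real u"
      using True by (simp add: r_def k_def w_def \<phi>_def diff_divide_distrib right_diff_distrib)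
    then have "norm (r u) = \<bar>sin (A / u)\<bar> * norm (\<phi> u - \<phi> 0) / u"
      using u by (simp add: norm_mult norm_divide)
    also have "\<dots> \<le> 1 * (2 * D * \<bar>u - 0\<bar>) / u"
      unfolding \<phi>_def by (intro divide_right_mono mult_mono tame_fourier(3)[OF tm]) (use u in auto)
    also have "\<dots> = 2 * D" using u by simp
    also have "\<dots> \<le> 8 * (1 + A) * D / (1 + u)\<^sup>2"
    proof -
      have "(1 + u)\<^sup>2 \<le> 2\<^sup>2" using u True by (intro power_mono) auto
      then have "2 * D * (1 + u)\<^sup>2 \<le> 2 * D * 4" using D by (intro mult_left_mono) auto
      also have "\<dots> \<le> 8 * (1 + A) * D" using A D by (simp add: algebra_simps)
      finally show ?thesis using u by (simp add: pos_le_divide_eq)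
    qed
    finally show ?thesis .
  next
    case False
    then have "norm (r u) = \<bar>sin (A / u)\<bar> * norm (\<phi> u) / u"
      using u by (simp add: r_def k_def w_def \<phi>_def norm_mult norm_divide)
    also have "\<dots> \<le> (A / u) * (2 * D) / u"
      unfolding \<phi>_def by (intro divide_right_mono mult_mono tame_fourier(2)[OF tm] sinb) (use u A in auto)
    also have "\<dots> = 2 * A * D / u\<^sup>2" using u by (simp add: power2_eq_square)
    also have "\<dots> \<le> 8 * (1 + A) * D / (1 + u)\<^sup>2"
    proof -
      have "(1 + u)\<^sup>2 \<le> (2 * u)\<^sup>2" using u False by (intro power_mono) auto
      then have "2 * A * D * (1 + u)\<^sup>2 \<le> 2 * A * D * (4 * u\<^sup>2)"
        using A D by (intro mult_left_mono) (auto simp: power_mult_distrib)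
      also have "\<dots> \<le> 8 * (1 + A) * D * u\<^sup>2" using A D by (simp add: algebra_simps)
      finally show ?thesis using u by (simp add: divide_simps)
    qed
    finally show ?thesis .
  qed
  have ri: "set_integrable lborel {0..} r" and rn: "norm (LBINT u:{0..}. r u) \<le> 8 * (1 + A) * D"
    using set_integrable_inverse_square_bound[of r "8 * (1 + A) * D"] rm rb by auto
  have rie: "set_integrable lborel {\<epsilon><..} r" if "\<epsilon> > 0" for \<epsilon>
    by (rule set_integrable_subset[OF ri]) (use that in auto)
  have split: "set_integrable lborel {\<epsilon><..} k \<and>
      (LBINT u:{\<epsilon><..}. k u) = (LBINT u:{\<epsilon><..}. r u) + of_real (Si (A / \<epsilon>) - Si A) * \<phi> 0" if \<epsilon>: "0 < \<epsilon>" "\<epsilon> < 1" for \<epsilon>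
  proof -
    have "(\<lambda>u. indicator {\<epsilon><..} u *\<^sub>R (of_real (w u) * \<phi> 0)) =
        (\<lambda>u. of_real (indicator {\<epsilon><..1} u *\<^sub>R (sin (A / u) / u)) * \<phi> 0)"
      by (auto simp: w_def indicator_def fun_eq_iff)
    moreover have "has_bochner_integral lborel (\<lambda>u. of_real (indicator {\<epsilon><..1} u *\<^sub>R (sin (A / u) / u)) * \<phi> 0)
        (of_real (Si (A / \<epsilon>) - Si A) * \<phi> 0)"
      by (intro has_bochner_integral_mult_left has_bochner_integral_of_real has_bochner_integral_sinc_window A \<epsilon>)
    ultimately have w: "set_integrable lborel {\<epsilon><..} (\<lambda>u. of_real (w u) * \<phi> 0)"
      "(LBINT u:{\<epsilon><..}. of_real (w u) * \<phi> 0) = of_real (Si (A / \<epsilon>) - Si A) * \<phi> 0"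
      unfolding set_integrable_def set_lebesgue_integral_def by (simp_all add: has_bochner_integral_iff)
    have "k = (\<lambda>u. r u + of_real (w u) * \<phi> 0)" by (simp add: r_def)
    then show ?thesis
      using set_integral_add[OF rie[OF \<epsilon>(1)] w(1)] w(2) by simp
  qed
  show "set_integrable lborel {\<epsilon><..} k" if \<epsilon>: "\<epsilon> > 0"
  proof -
    have "set_integrable lborel {min \<epsilon> (1/2)<..} k" using split[of "min \<epsilon> (1/2)"] \<epsilon> by auto
    then show ?thesis by (rule set_integrable_subset) auto
  qed
  \<comment> \<open>With T = 1 / \<epsilon> the limit becomes one at infinity, and the norm of
    \<open>r\<close> on the half-line dominates every truncation.\<close>
  have "((\<lambda>T. LBINT u. indicator {inverse T<..} u *\<^sub>R r u) \<longlongrightarrow> (LBINT u. indicator {0<..} u *\<^sub>R r u)) at_top"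
  proof (rule integral_dominated_convergence_at_top[where w = "\<lambda>u. norm (indicator {0..} u *\<^sub>R r u)"])
    show "AE u in lborel. ((\<lambda>T. indicator {inverse T<..} u *\<^sub>R r u) \<longlongrightarrow> indicator {0<..} u *\<^sub>R r u) at_top"
    proof (intro AE_I2 tendsto_eventually)
      fix u :: real
      show "\<forall>\<^sub>F T in at_top. indicator {inverse T<..} u *\<^sub>R r u = indicator {0<..} u *\<^sub>R r u"
      proof (cases "u > 0")
        case True
        show ?thesis
          using eventually_gt_at_top[of "inverse u"]
        proof eventually_elim
          case (elim T)
          then have "inverse T < u" using True by (metis inverse_inverse_eq inverse_less_imp_less inverse_positive_iff_positive less_imp_inverse_less)
          then show ?case using True by simp
        qed
      next
        case False
        show ?thesis
          using eventually_gt_at_top[of 0]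
        proof eventually_elim
          case (elim T)
          then have "inverse T > 0" by simp
          then have "\<not> inverse T < u" using False by linarith
          then show ?case using False by simp
        qed
      qed
    qed
    show "\<forall>\<^sub>F T in at_top. AE u in lborel. norm (indicator {inverse T<..} u *\<^sub>R r u) \<le> norm (indicator {0..} u *\<^sub>R r u)"
      using eventually_gt_at_top[of 0]
    proof eventually_elim
      case (elim T)
      then have "inverse T > 0" by simp
      have "norm (indicator {inverse T<..} u *\<^sub>R r u) \<le> norm (indicator {0..} u *\<^sub>R r u)" for u
      proof (cases "u \<ge> 0")
        case False
        then have "\<not> inverse T < u" using \<open>inverse T > 0\<close> by linarith
        then show ?thesis by simp
      qed (auto simp: indicator_def)
      then show ?case by simp
    qed
    show "integrable lborel (\<lambda>u. norm (indicator {0..} u *\<^sub>R r u))"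
      using ri by (intro integrable_norm) (simp add: set_integrable_def)
  qed (use rm in auto)
  then have rlim: "((\<lambda>\<epsilon>. LBINT u:{\<epsilon><..}. r u) \<longlongrightarrow> (LBINT u. indicator {0<..} u *\<^sub>R r u)) (at_right 0)"
    unfolding set_lebesgue_integral_def by (subst filterlim_at_right_to_top)
  have "filterlim (\<lambda>\<epsilon>. A / \<epsilon>) at_top (at_right 0)"
    using A by real_asymp
  from filterlim_compose[OF Si_at_top this]
  have "((\<lambda>\<epsilon>. Si (A / \<epsilon>)) \<longlongrightarrow> pi / 2) (at_right 0)" .
  then have lim: "((\<lambda>\<epsilon>. (LBINT u:{\<epsilon><..}. r u) + of_real (Si (A / \<epsilon>) - Si A) * \<phi> 0)
      \<longlongrightarrow> (LBINT u. indicator {0<..} u *\<^sub>R r u) + of_real (pi / 2 - Si A) * \<phi> 0) (at_right 0)"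
    by (intro tendsto_intros rlim)
  have ev: "eventually (\<lambda>\<epsilon>. 0 < \<epsilon> \<and> \<epsilon> < 1) (at_right (0::real))"
    by (auto simp: eventually_at_right_field intro!: exI[of _ 1])
  define l where "l = (LBINT u. indicator {0<..} u *\<^sub>R r u) + of_real (pi / 2 - Si A) * \<phi> 0"
  have "((\<lambda>\<epsilon>. LBINT u:{\<epsilon><..}. k u) \<longlongrightarrow> l) (at_right 0)"
    unfolding l_def by (rule Lim_transform_eventually[OF lim]) (use ev split in \<open>auto elim: eventually_mono\<close>)
  moreover have "norm l \<le> (4 * B + 8 * (1 + A)) * D"
  proof -
    have "(LBINT u. indicator {0<..} u *\<^sub>R r u) = (LBINT u:{0..}. r u)"
      unfolding set_lebesgue_integral_def
    proof (rule integral_cong_AE)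
      show "AE u in lborel. indicator {0<..} u *\<^sub>R r u = indicator {0..} u *\<^sub>R r u"
        using AE_lborel_singleton[of 0] by eventually_elim (auto simp: indicator_def)
    qed (use rm in auto)
    then have 1: "norm (LBINT u. indicator {0<..} u *\<^sub>R r u) \<le> 8 * (1 + A) * D" using rn by simp
    \<comment> \<open>pi / 2 is a limit of values of \<open>Si\<close>, so \<open>B\<close> bounds
      it as well. Together with the bound 2 D on the transform at 0 this yields the term 4 B
      D.\<close>
    have "\<bar>pi / 2\<bar> \<le> B"
      by (rule tendsto_upperbound[OF tendsto_rabs[OF Si_at_top]]) (auto simp: B)
    then have "\<bar>pi / 2 - Si A\<bar> \<le> 2 * B"
      using B[of A] by linarith
    then have "norm (of_real (pi / 2 - Si A) * \<phi> 0) \<le> 2 * B * (2 * D)"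
      unfolding norm_mult norm_of_real \<phi>_def
      by (intro mult_mono tame_fourier(2)[OF tm]) auto
    then show ?thesis
      unfolding l_def using 1 norm_triangle_ineq[of "LBINT u. indicator {0<..} u *\<^sub>R r u" "of_real (pi / 2 - Si A) * \<phi> 0"]
      by (simp add: algebra_simps)
  qed
  ultimately show "\<exists>l. ((\<lambda>\<epsilon>. LBINT u:{\<epsilon><..}. k u) \<longlongrightarrow> l) (at_right 0) \<and> norm l \<le> (4 * B + 8 * (1 + A)) * D"
    by blast
qed

section \<open>Density of exponentials\<close>

lemma complex_polynomial_approximation:
  fixes g :: "real \<Rightarrow> complex"
  assumes g: "continuous_on {0..1} g" and e: "e > 0"
  obtains N and c :: "nat \<Rightarrow> complex"
  where "\<And>x. x \<in> {0..1} \<Longrightarrow> norm (g x - (\<Sum>i<N. c i * of_real (x ^ i))) < e"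
proof -
  obtain p where p: "real_polynomial_function p" "\<And>x. x \<in> {0..1} \<Longrightarrow> \<bar>Re (g x) - p x\<bar> < e / 2"
    using Stone_Weierstrass_real_polynomial_function[of "{0..1}" "\<lambda>x. Re (g x)" "e / 2"] g e
    by (auto intro!: continuous_intros)
  obtain q where q: "real_polynomial_function q" "\<And>x. x \<in> {0..1} \<Longrightarrow> \<bar>Im (g x) - q x\<bar> < e / 2"
    using Stone_Weierstrass_real_polynomial_function[of "{0..1}" "\<lambda>x. Im (g x)" "e / 2"] g e
    by (auto intro!: continuous_intros)
  obtain a n where a: "p = (\<lambda>x. \<Sum>i\<le>n. a i * x ^ i)"
    using p(1) unfolding real_polynomial_function_iff_sum by blast
  obtain b m where b: "q = (\<lambda>x. \<Sum>i\<le>m. b i * x ^ i)"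
    using q(1) unfolding real_polynomial_function_iff_sum by blast
  define N where "N = Suc (max n m)"
  define a' where "a' i = (if i \<le> n then a i else 0)" for i
  define b' where "b' i = (if i \<le> m then b i else 0)" for i
  have a': "p x = (\<Sum>i<N. a' i * x ^ i)" for x
    unfolding a by (rule sum.mono_neutral_cong_left) (auto simp: a'_def N_def)
  have b': "q x = (\<Sum>i<N. b' i * x ^ i)" for x
    unfolding b by (rule sum.mono_neutral_cong_left) (auto simp: b'_def N_def)
  define c where "c i = Complex (a' i) (b' i)" for i
  have "norm (g x - (\<Sum>i<N. c i * of_real (x ^ i))) < e" if x: "x \<in> {0..1}" for x
  proof -
    have "norm (g x - (\<Sum>i<N. c i * of_real (x ^ i))) \<le>
        \<bar>Re (g x - (\<Sum>i<N. c i * of_real (x ^ i)))\<bar> + \<bar>Im (g x - (\<Sum>i<N. c i * of_real (x ^ i)))\<bar>"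
      by (rule cmod_le)
    also have "\<dots> = \<bar>Re (g x) - p x\<bar> + \<bar>Im (g x) - q x\<bar>"
      unfolding a' b' by (simp add: c_def del: of_real_power)
    also have "\<dots> < e" using p(2)[OF x] q(2)[OF x] by linarith
    finally show ?thesis .
  qed
  then show ?thesis by (rule that)
qed

section \<open>Tame functions as a space containing the exponentials\<close>

lemma tame_add:
  assumes "tame D f f1 f2 f3" "tame E g g1 g2 g3"
  shows "tame (D + E) (\<lambda>t. f t + g t) (\<lambda>t. f1 t + g1 t) (\<lambda>t. f2 t + g2 t) (\<lambda>t. f3 t + g3 t)"
proof -
  have "norm (f3 t + g3 t) \<le> (D + E) / (1 + t) ^ 6" if "t \<ge> 0" for t
    using norm_triangle_ineq[of "f3 t" "g3 t"] tame_bounds(1)[OF assms(1) that] tame_bounds(1)[OF assms(2) that]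
    by (simp add: add_divide_distrib)
  then show ?thesis
    using assms unfolding tame_def
    by (auto intro!: has_vector_derivative_add continuous_on_add tendsto_add_zero)
qed

lemma tame_cmult:
  fixes c :: complex
  assumes "tame D f f1 f2 f3"
  shows "tame (norm c * D) (\<lambda>t. c * f t) (\<lambda>t. c * f1 t) (\<lambda>t. c * f2 t) (\<lambda>t. c * f3 t)"
proof -
  have "norm (c * f3 t) \<le> norm c * D / (1 + t) ^ 6" if "t \<ge> 0" for t
    using mult_left_mono[OF tame_bounds(1)[OF assms that], of "norm c"] by (simp add: norm_mult)
  then show ?thesis
    using assms unfolding tame_def
    by (auto intro!: has_vector_derivative_mult_right continuous_on_mult_left tendsto_mult_right_zero)
qed

lemma tame_zero: "tame 0 (\<lambda>_. 0) (\<lambda>_. 0) (\<lambda>_. 0) (\<lambda>_. 0)"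
  by (simp add: tame_def)

lemma exp_decay_bound:
  fixes s :: real
  assumes s: "s > 0"
  obtains M where "M > 0" "\<And>t. t \<ge> 0 \<Longrightarrow> exp (- (s * t)) \<le> M / (1 + t) ^ 6"
proof
  \<comment> \<open>Chosen so that m (1 + t) <= 1 + s t / 6 <= exp (s t / 6); the sixth power is the
    claim.\<close>
  define m where "m = min 1 (s / 6)"
  have m: "m > 0" "m \<le> 1" "6 * m \<le> s" using s by (auto simp: m_def)
  show "1 / m ^ 6 > 0" using m by simp
  fix t :: real assume t: "t \<ge> 0"
  have "m * (1 + t) \<le> 1 + s * t / 6"
    using m t mult_right_mono[OF m(3) t] by (simp add: algebra_simps)
  also have "\<dots> \<le> exp (s * t / 6)" by (rule exp_ge_add_one_self)
  finally have "(m * (1 + t)) ^ 6 \<le> exp (s * t / 6) ^ 6" using m t by (intro power_mono) auto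
  also have "exp (s * t / 6) ^ 6 = exp (s * t)" by (simp flip: exp_of_nat_mult)
  finally have "m ^ 6 * (1 + t) ^ 6 \<le> exp (s * t)" by (simp add: power_mult_distrib)
  then have "1 / exp (s * t) \<le> 1 / (m ^ 6 * (1 + t) ^ 6)" using m t by (intro divide_left_mono) auto
  then show "exp (- (s * t)) \<le> 1 / m ^ 6 / (1 + t) ^ 6" by (simp add: exp_minus inverse_eq_divide)
qed

lemma tame_exp:
  fixes s :: real
  assumes s: "s > 0"
  defines "E \<equiv> \<lambda>j t. complex_of_real ((- s) ^ j * exp (- (s * t)))"
  obtains D where "tame D (E 0) (E 1) (E 2) (E 3)"
proof -
  obtain M where M: "\<And>t. t \<ge> 0 \<Longrightarrow> exp (- (s * t)) \<le> M / (1 + t) ^ 6"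
    using exp_decay_bound[OF s] by blast
  have d: "(E j has_vector_derivative E (Suc j) t) (at t within {0..})" for j t
    unfolding E_def by (intro has_vector_derivative_of_real) (auto intro!: derivative_eq_intros)
  have l: "(E j \<longlongrightarrow> 0) at_top" for j
  proof -
    have "((\<lambda>t. (- s) ^ j * exp (- (s * t))) \<longlongrightarrow> (- s) ^ j * 0) at_top"
      by (rule tendsto_mult[OF tendsto_const]) (use s in real_asymp)
    then show ?thesis unfolding E_def
      using tendsto_of_real[of "\<lambda>t. (- s) ^ j * exp (- (s * t))" 0] by simp
  qed
  have "tame (s ^ 3 * M) (E 0) (E 1) (E 2) (E 3)"
    unfolding tame_def
  proof (intro conjI allI impI)
    show "continuous_on {0..} (E 3)" unfolding E_def by (intro continuous_intros)
    fix t :: real assume t: "0 \<le> t"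
    show "norm (E 3 t) \<le> s ^ 3 * M / (1 + t) ^ 6"
      using mult_left_mono[OF M[OF t], of "s ^ 3"] s by (simp add: E_def norm_mult norm_power)
  qed (use d[of 0] d[of 1] d[of 2] l in \<open>simp_all add: numeral_2_eq_2 numeral_3_eq_3\<close>)
  then show ?thesis by (rule that)
qed

text \<open>Linearity of the functionals needs convergence only, so the constant and the derivatives
  are hidden here; they remain visible where a functional is bounded.\<close>

definition tame_ex :: "(real \<Rightarrow> complex) \<Rightarrow> bool" where
  "tame_ex f \<longleftrightarrow> (\<exists>D f1 f2 f3. tame D f f1 f2 f3)"

lemma tame_exI: "tame D f f1 f2 f3 \<Longrightarrow> tame_ex f"
  unfolding tame_ex_def by blast

text \<open>Exponentials are dense: with \<open>x = exp (- \<eta> t)\<close>, the third derivative is approximated by a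
  polynomial in \<open>x\<close> without constant term, which is then integrated three times from infinity.\<close>

lemma tame_functional_eq_zero:
  fixes \<Phi> :: "(real \<Rightarrow> complex) \<Rightarrow> complex"
  assumes add: "\<And>f g. tame_ex f \<Longrightarrow> tame_ex g \<Longrightarrow> \<Phi> (\<lambda>t. f t + g t) = \<Phi> f + \<Phi> g"
    and cmult: "\<And>c f. tame_ex f \<Longrightarrow> \<Phi> (\<lambda>t. c * f t) = c * \<Phi> f"
    and bound: "\<And>D f f1 f2 f3. tame D f f1 f2 f3 \<Longrightarrow> norm (\<Phi> f) \<le> K * D"
    and exp: "\<And>s. s > 0 \<Longrightarrow> \<Phi> (\<lambda>t. of_real (exp (- (s * t)))) = 0"
    and tm: "tame D f f1 f2 f3" and decay: "\<forall>t\<ge>0. norm (f3 t) \<le> C / (1 + t) ^ 7"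
  shows "\<Phi> f = 0"
proof -
  have C: "norm (f3 t) \<le> C / (1 + t) ^ 7" if "t \<ge> 0" for t using decay that by blast
  have "0 \<le> norm (f3 0)" by simp
  also have "\<dots> \<le> C" using C[of 0] by simp
  finally have C0: "C \<ge> 0" .
  have approx: "norm (\<Phi> f) \<le> K * \<delta>" if \<delta>: "\<delta> > 0" for \<delta>
  proof -
    \<comment> \<open>Makes the damping error at most \<delta> / 2: 1 - exp (- 2 \<eta> t) <= 2
      \<eta> (1 + t), and the factor 1 + t is absorbed by the extra power in \<open>decay\<close>.
      Using C + 1 avoids a division by 0.\<close>
    define \<eta> where "\<eta> = \<delta> / (4 * (C + 1))"
    have \<eta>: "\<eta> > 0" "2 * \<eta> * C \<le> \<delta> / 2"
      using \<delta> C0 by (auto simp: \<eta>_def field_simps)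
    obtain M where M: "M > 0" "\<And>t. t \<ge> 0 \<Longrightarrow> exp (- (\<eta> * t)) \<le> M / (1 + t) ^ 6"
      using exp_decay_bound[OF \<eta>(1)] by blast
    \<comment> \<open>\<open>f3\<close> in the variable x = exp (- \<eta> t), with one factor x that
      forces continuity at x = 0, the image of t = infinity. The approximating polynomial is later
      multiplied by a second factor x, which removes its constant term and, through the constant
      \<open>M\<close>, turns the uniform error \<delta> / (2 M) into the weighted error \<delta> /
      2.\<close>
    define g where "g x = (if x \<le> 0 then 0 else f3 (- ln x / \<eta>) * of_real x)" for x
    have lnr: "- ln x / \<eta> \<ge> 0" if "0 < x" "x \<le> 1" for x
      by (rule divide_nonneg_nonneg) (use that \<eta> in auto)
    have gb: "norm (g x) \<le> C * \<bar>x\<bar>" if "x \<in> {0..1}" for x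
    proof (cases "x = 0")
      case False
      then have x: "0 < x" "x \<le> 1" using that by auto
      have "norm (f3 (- ln x / \<eta>)) \<le> C / (1 + - ln x / \<eta>) ^ 7" by (rule C[OF lnr[OF x]])
      also have "\<dots> \<le> C / 1" using lnr[OF x] C0 by (intro divide_left_mono one_le_power) auto
      finally show ?thesis using x by (simp add: g_def norm_mult mult_right_mono)
    qed (simp add: g_def)
    have gc: "continuous_on {0..1} g"
      unfolding continuous_on_eq_continuous_within
    proof
      fix x :: real assume x: "x \<in> {0..1}"
      show "continuous (at x within {0..1}) g"
      proof (cases "x = 0")
        case True
        have "(g \<longlongrightarrow> 0) (at 0 within {0..1})"
        proof (rule Lim_null_comparison)
          show "\<forall>\<^sub>F x in at 0 within {0..1}. norm (g x) \<le> C * \<bar>x\<bar>"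
            using gb by (auto simp: eventually_at_filter)
          show "((\<lambda>x. C * \<bar>x\<bar>) \<longlongrightarrow> 0) (at 0 within {0..1})"
            by (rule tendsto_eq_intros | simp)+
        qed
        then show ?thesis using True by (simp add: continuous_within g_def)
      next
        case False
        have "continuous_on {0<..1} (\<lambda>x. f3 (- ln x / \<eta>) * of_real x)"
        proof (intro continuous_intros)
          show "continuous_on {0<..1} (\<lambda>x. f3 (- ln x / \<eta>))"
            by (rule continuous_on_compose2[OF tame_continuous(4)[OF tm]])
               (use lnr \<eta> in \<open>auto intro!: continuous_intros\<close>)
        qed
        then have "continuous_on {0<..1} g"
          by (rule continuous_on_eq) (simp add: g_def)
        then have "continuous (at x within {0<..1}) g"
          using x False by (auto simp: continuous_on_eq_continuous_within)
        moreover have "at x within {0..1} = at x within {0<..1}"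
          by (rule at_within_nhd[of x "{0<..}"]) (use x False in auto)
        ultimately show ?thesis by simp
      qed
    qed
    obtain N and c :: "nat \<Rightarrow> complex"
      where c: "\<And>x. x \<in> {0..1} \<Longrightarrow> norm (g x - (\<Sum>i<N. c i * of_real (x ^ i))) < \<delta> / (2 * M)"
      by (rule complex_polynomial_approximation[OF gc, of "\<delta> / (2 * M)"]) (use \<delta> M in auto)
    \<comment> \<open>x^i times the second factor x is exp (- s_i t), hence \<open>Suc\<close>.
      Dividing the coefficients by (- s_i)^3 in \<open>a\<close> integrates three times from
      infinity, and \<open>P n j\<close> is the j-th derivative of the resulting sum.\<close>
    define s where "s i = \<eta> * real (Suc i)" for i
    have s: "s i > 0" for i using \<eta> by (simp add: s_def)
    define a where "a i = c i / of_real ((- s i) ^ 3)" for i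
    define P where "P n j t = (\<Sum>i<n. a i * of_real ((- s i) ^ j * exp (- (s i * t))))" for n j t
    have P: "(\<exists>D. tame D (P n 0) (P n 1) (P n 2) (P n 3)) \<and> \<Phi> (P n 0) = 0" for n
    proof (induction n)
      case 0
      \<comment> \<open>The zero function is tame with constant 0, so the bound on the functional
        already gives this.\<close>
      have "\<Phi> (\<lambda>_. 0) = 0"
        using bound[OF tame_zero] by simp
      then show ?case using tame_zero by (auto simp: P_def[abs_def])
    next
      case (Suc n)
      then obtain D1 where D1: "tame D1 (P n 0) (P n 1) (P n 2) (P n 3)" by blast
      obtain D2 where D2: "tame D2 (\<lambda>t. of_real ((- s n) ^ 0 * exp (- (s n * t)))) (\<lambda>t. of_real ((- s n) ^ 1 * exp (- (s n * t))))
          (\<lambda>t. of_real ((- s n) ^ 2 * exp (- (s n * t)))) (\<lambda>t. of_real ((- s n) ^ 3 * exp (- (s n * t))))"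
        using tame_exp[OF s] by blast
      have PS: "P (Suc n) j = (\<lambda>t. P n j t + a n * of_real ((- s n) ^ j * exp (- (s n * t))))" for j
        by (simp add: P_def[abs_def])
      have "\<Phi> (P (Suc n) 0) = \<Phi> (P n 0) + \<Phi> (\<lambda>t. a n * of_real ((- s n) ^ 0 * exp (- (s n * t))))"
        unfolding PS by (rule add[OF tame_exI[OF D1] tame_exI[OF tame_cmult[OF D2]]])
      also have "\<Phi> (\<lambda>t. a n * of_real ((- s n) ^ 0 * exp (- (s n * t)))) = a n * \<Phi> (\<lambda>t. of_real ((- s n) ^ 0 * exp (- (s n * t))))"
        by (rule cmult[OF tame_exI[OF D2]])
      finally have "\<Phi> (P (Suc n) 0) = 0" using Suc exp[OF s] by simp
      then show ?case
        unfolding PS using tame_add[OF D1 tame_cmult[OF D2]] by blast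
    qed
    then obtain D1 where D1: "tame D1 (P N 0) (P N 1) (P N 2) (P N 3)" by blast
    have diff: "tame (D + norm (-1 :: complex) * D1) (\<lambda>t. f t + -1 * P N 0 t) (\<lambda>t. f1 t + -1 * P N 1 t)
        (\<lambda>t. f2 t + -1 * P N 2 t) (\<lambda>t. f3 t + -1 * P N 3 t)"
      by (rule tame_add[OF tm tame_cmult[OF D1]])
    have "norm (f3 t + -1 * P N 3 t) \<le> \<delta> / (1 + t) ^ 6" if t: "t \<ge> 0" for t
    proof -
      define x where "x = exp (- (\<eta> * t))"
      have x: "x \<in> {0..1}" "x > 0" "- ln x / \<eta> = t" using \<eta> t by (auto simp: x_def)
      have xx: "x * x = exp (- (2 * \<eta> * t))" by (simp add: x_def flip: exp_add)
      have P3: "P N 3 t = (\<Sum>i<N. c i * of_real (x ^ i)) * of_real x"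
      proof -
        have "a i * of_real ((- s i) ^ 3 * exp (- (s i * t))) = c i * of_real (x ^ i) * of_real x" for i
        proof -
          have "exp (- (s i * t)) = x ^ Suc i"
            unfolding x_def exp_of_nat_mult[symmetric] s_def by (simp add: algebra_simps)
          moreover have "complex_of_real ((- s i) ^ 3) \<noteq> 0" using s[of i] by simp
          ultimately show ?thesis by (simp add: a_def del: of_real_power)
        qed
        then show ?thesis by (simp only: P_def sum_distrib_right)
      qed
      have gx: "g x * of_real x = f3 t * of_real (x * x)"
        using x by (simp add: g_def)
      \<comment> \<open>The first term is the error of replacing f3 by x^2 f3, the second is the
        Weierstrass error multiplied by x. Each receives half of \<delta>.\<close>
      have "f3 t + -1 * P N 3 t = f3 t * of_real (1 - x * x) + (g x - (\<Sum>i<N. c i * of_real (x ^ i))) * of_real x"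
        unfolding P3 left_diff_distrib gx by (simp add: algebra_simps)
      then have "norm (f3 t + -1 * P N 3 t) \<le> norm (f3 t * of_real (1 - x * x)) + norm ((g x - (\<Sum>i<N. c i * of_real (x ^ i))) * of_real x)"
        by (simp only: norm_triangle_ineq)
      also have "norm (f3 t * of_real (1 - x * x)) \<le> C / (1 + t) ^ 7 * (2 * \<eta> * (1 + t))"
      proof -
        have "1 - x * x \<le> 2 * \<eta> * t"
          unfolding xx using exp_ge_add_one_self[of "- (2 * \<eta> * t)"] by simp
        also have "\<dots> \<le> 2 * \<eta> * (1 + t)" using \<eta> by simp
        finally have "1 - x * x \<le> 2 * \<eta> * (1 + t)" .
        moreover have "0 \<le> 1 - x * x" using x by (simp add: mult_le_one)
        ultimately show ?thesis
          unfolding norm_mult norm_of_real using C[OF t] C0 t by (intro mult_mono) auto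
      qed
      also have "C / (1 + t) ^ 7 * (2 * \<eta> * (1 + t)) = 2 * \<eta> * C / (1 + t) ^ 6"
      proof -
        have "C / (z * z ^ 6) * (2 * \<eta> * z) = 2 * \<eta> * C / z ^ 6" if "z > 0" for z :: real
          using that by simp
        then show ?thesis using t power_Suc[of "1 + t" 6] by simp
      qed
      also have "\<dots> \<le> \<delta> / 2 / (1 + t) ^ 6"
        using \<eta> t by (intro divide_right_mono) auto
      also have "norm ((g x - (\<Sum>i<N. c i * of_real (x ^ i))) * of_real x) \<le> \<delta> / (2 * M) * (M / (1 + t) ^ 6)"
        unfolding norm_mult norm_of_real
        using c[OF x(1)] M(2)[OF t] x \<delta> M(1) by (intro mult_mono) (auto simp: x_def)
      also have "\<dots> = \<delta> / 2 / (1 + t) ^ 6" using M by simp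
      finally show ?thesis by simp
    qed
    \<comment> \<open>In \<open>tame\<close> the constant enters only through the bound on the third
      derivative, so \<delta> may replace the crude constant obtained in
      \<open>diff\<close>.\<close>
    then have "tame \<delta> (\<lambda>t. f t + -1 * P N 0 t) (\<lambda>t. f1 t + -1 * P N 1 t)
        (\<lambda>t. f2 t + -1 * P N 2 t) (\<lambda>t. f3 t + -1 * P N 3 t)"
      using diff by (simp add: tame_def)
    from bound[OF this] have "norm (\<Phi> (\<lambda>t. f t + -1 * P N 0 t)) \<le> K * \<delta>" .
    moreover have "\<Phi> (\<lambda>t. f t + -1 * P N 0 t) = \<Phi> f + \<Phi> (\<lambda>t. -1 * P N 0 t)"
      by (rule add[OF tame_exI[OF tm] tame_exI[OF tame_cmult[OF D1]]])
    moreover have "\<Phi> (\<lambda>t. -1 * P N 0 t) = -1 * \<Phi> (P N 0)"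
      by (rule cmult[OF tame_exI[OF D1]])
    ultimately show ?thesis using P[of N] by simp
  qed
  have "norm (\<Phi> f) \<le> 0"
  proof (rule tendsto_lowerbound)
    show "((\<lambda>\<delta>. K * \<delta>) \<longlongrightarrow> 0) (at_right 0)" by (rule tendsto_eq_intros | simp)+
    show "\<forall>\<^sub>F \<delta> in at_right 0. norm (\<Phi> f) \<le> K * \<delta>"
      using eventually_at_right_less[of 0] by eventually_elim (rule approx)
  qed simp
  then show ?thesis by simp
qed

section \<open>The summation formula\<close>

lemma laplace_transform_one:
  fixes c :: complex
  assumes c: "Re c > 0"
  shows "set_integrable lborel {0..} (\<lambda>u. exp (- c * of_real u))"
    and "(LBINT u:{0..}. exp (- c * of_real u)) = 1 / c"
proof -
  obtain M where M: "M > 0" "\<And>t. t \<ge> 0 \<Longrightarrow> exp (- (Re c * t)) \<le> M / (1 + t) ^ 6"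
    using exp_decay_bound[OF c] by blast
  have c0: "c \<noteq> 0" using c by auto
  have cont: "continuous_on {0..} (\<lambda>u. exp (- c * of_real u))"
    by (intro continuous_intros)
  have b: "norm (exp (- c * of_real t)) \<le> M / (1 + t)\<^sup>2" if t: "t > 0" for t
  proof -
    have "norm (exp (- c * of_real t)) \<le> M / (1 + t) ^ 6" using M(2)[of t] t by simp
    also have "\<dots> \<le> M / (1 + t)\<^sup>2"
      using M t by (intro divide_left_mono power_increasing) auto
    finally show ?thesis .
  qed
  show int: "set_integrable lborel {0..} (\<lambda>u. exp (- c * of_real u))"
    using set_integrable_inverse_square_bound(1)[of "\<lambda>u. exp (- c * of_real u)" M] cont b by blast
  have "(LBINT u:{0<..}. exp (- c * of_real u)) = 0 - - exp (- c * of_real 0) / c"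
  proof (rule integral_half_line_FTC[OF _ cont])
    fix t :: real
    have "((\<lambda>z. - exp (- c * z) / c) has_field_derivative exp (- c * of_real t)) (at (of_real t))"
      using c0 by (auto intro!: derivative_eq_intros)
    then show "((\<lambda>t. - exp (- c * of_real t) / c) has_vector_derivative exp (- c * of_real t)) (at t within {0..})"
      by (rule has_vector_derivative_real_field)
    show "set_integrable lborel {0<..} (\<lambda>u. exp (- c * of_real u))"
      by (rule set_integrable_subset[OF int]) auto
    show "((\<lambda>t. - exp (- c * of_real t) / c) \<longlongrightarrow> 0) at_top"
    proof (rule Lim_null_comparison)
      show "\<forall>\<^sub>F t in at_top. norm (- exp (- c * of_real t) / c) \<le> exp (- Re c * t) / norm c"
        by (simp add: norm_divide)
      show "((\<lambda>t. exp (- Re c * t) / norm c) \<longlongrightarrow> 0) at_top"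
      proof -
        have "((\<lambda>t. exp (- r * t)) \<longlongrightarrow> 0) at_top" if "r > 0" for r :: real
          using that by real_asymp
        from tendsto_divide_zero[OF this[OF c]] show ?thesis .
      qed
    qed
  qed
  then show "(LBINT u:{0..}. exp (- c * of_real u)) = 1 / c"
    unfolding set_integral_Ici_eq_Ioi[OF int] by simp
qed

text \<open>The two half-lines give Laplace transforms at c = s + i x and at its conjugate, and 1 /
  c + 1 / \<open>cnj c\<close> is the real kernel stated.\<close>

lemma fourier_exp_abs:
  fixes s x :: real
  assumes s: "s > 0"
  shows "fourier (\<lambda>u. of_real (exp (- (s * \<bar>u\<bar>)))) x = of_real (2 * s / (s\<^sup>2 + x\<^sup>2))"
proof -
  define h where "h u = complex_of_real (exp (- (s * \<bar>u\<bar>))) * exp (- (\<i> * of_real x * of_real u))" for u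
  define c where "c = Complex s x"
  have c: "Re c > 0" "Re (cnj c) > 0" using s by (auto simp: c_def)
  have p: "indicator {0..} u *\<^sub>R h u = indicator {0..} u *\<^sub>R exp (- c * of_real u)" for u
    by (auto simp: indicator_def h_def c_def Complex_eq exp_of_real[symmetric] algebra_simps simp flip: exp_add)
  have n: "indicator {0..} u *\<^sub>R h (- u) = indicator {0..} u *\<^sub>R exp (- cnj c * of_real u)" for u
    by (auto simp: indicator_def h_def c_def Complex_eq exp_of_real[symmetric] algebra_simps simp flip: exp_add)
  have "set_integrable lborel {0..} h"
    using laplace_transform_one(1)[OF c(1)] unfolding set_integrable_def p .
  moreover have "set_integrable lborel {0..} (\<lambda>u. h (- u))"
    using laplace_transform_one(1)[OF c(2)] unfolding set_integrable_def n .
  ultimately have "(LBINT u. h u) = (LBINT u:{0..}. h u) + (LBINT u:{0..}. h (- u))"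
    by (rule integral_split_half_lines)
  also have "\<dots> = 1 / c + 1 / cnj c"
    using laplace_transform_one(2)[OF c(1)] laplace_transform_one(2)[OF c(2)]
    unfolding set_lebesgue_integral_def p n by simp
  also have "\<dots> = (c + cnj c) / (c * cnj c)"
  proof -
    have "c \<noteq> 0" using c by auto
    then show ?thesis by (simp add: field_simps)
  qed
  also have "c * cnj c = of_real (s\<^sup>2 + x\<^sup>2)"
    unfolding complex_mult_cnj by (simp add: c_def)
  also have "c + cnj c = of_real (2 * s)"
    by (simp add: complex_add_cnj c_def)
  finally show ?thesis
    by (simp add: fourier_def h_def)
qed

text \<open>The substitution v = 1 / u turns the integrand into 2 / s times v sin (A v) / (v^2 +
  s^(-2)), and the improper end u = 0 into v = infinity. The limit is then 2 / s times the Laplace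
  integral with b = 1 / s.\<close>

lemma sine_kernel_limit_exp:
  fixes s A :: real
  assumes A: "A > 0" and s: "s > 0"
  shows "((\<lambda>\<epsilon>. LBINT u:{\<epsilon><..}. of_real (sin (A / u)) * fourier (\<lambda>u. of_real (exp (- (s * \<bar>u\<bar>)))) u / of_real u)
     \<longlongrightarrow> of_real (pi / s * exp (- A / s))) (at_right 0)"
proof -
  define b where "b = 1 / s"
  have b: "b > 0" using s by (simp add: b_def)
  define h where "h v = v * sin (A * v) / (v\<^sup>2 + b\<^sup>2)" for v
  have den: "v\<^sup>2 + b\<^sup>2 \<noteq> 0" for v using b by (simp add: add_nonneg_eq_0_iff)
  have hc: "continuous_on X h" for X
    unfolding h_def[abs_def] by (intro continuous_intros) (use den in auto)
  define \<Psi> where "\<Psi> w = integral {0..w} h" for w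
  define k where "k u = complex_of_real (sin (A / u)) * fourier (\<lambda>u. of_real (exp (- (s * \<bar>u\<bar>)))) u / of_real u" for u
  have k: "k u = of_real (sin (A / u) * (2 * s / (s\<^sup>2 + u\<^sup>2)) / u)" for u
    by (simp add: k_def fourier_exp_abs[OF s])
  obtain B where B: "\<And>T. \<bar>Si T\<bar> \<le> B" using bounded_Si by blast
  obtain D where D: "tame D (\<lambda>t. of_real ((- s) ^ 0 * exp (- (s * t)))) (\<lambda>t. of_real ((- s) ^ 1 * exp (- (s * t))))
          (\<lambda>t. of_real ((- s) ^ 2 * exp (- (s * t)))) (\<lambda>t. of_real ((- s) ^ 3 * exp (- (s * t))))"
    using tame_exp[OF s] by blast
  have val: "(LBINT u:{\<epsilon><..}. k u) = of_real (2 / s * \<Psi> (1 / \<epsilon>))" if \<epsilon>: "\<epsilon> > 0" for \<epsilon>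
  proof -
    have "(LBINT u:{\<epsilon><..}. k u) = 0 - of_real (- (2 / s) * \<Psi> (1 / \<epsilon>))"
    proof (rule integral_half_line_FTC)
      show "set_integrable lborel {\<epsilon><..} k"
        using tame_sine_kernel_limit(1)[OF D A B \<epsilon>] unfolding k_def[abs_def] by simp
      show "continuous_on {\<epsilon>..} k"
      proof -
        have "s\<^sup>2 + u\<^sup>2 \<noteq> 0" for u using s by (simp add: add_nonneg_eq_0_iff)
        then show ?thesis
          unfolding k[abs_def] using \<epsilon> by (intro continuous_intros) auto
      qed
      have "((\<lambda>u. \<Psi> (1 / u)) \<longlongrightarrow> \<Psi> 0) at_top"
      proof (rule continuous_on_tendsto_compose[where f = \<Psi> and s = "{0..1}" and l = 0 and g = "\<lambda>u. 1 / u"])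
        show "continuous_on {0..1} \<Psi>"
          unfolding \<Psi>_def by (intro indefinite_integral_continuous_1 integrable_continuous_real hc)
        show "((\<lambda>u::real. 1 / u) \<longlongrightarrow> 0) at_top" by real_asymp
        show "\<forall>\<^sub>F u::real in at_top. 1 / u \<in> {0..1}"
          using eventually_ge_at_top[of 1] by eventually_elim auto
      qed simp
      then have "((\<lambda>u. - (2 / s) * \<Psi> (1 / u)) \<longlongrightarrow> - (2 / s) * \<Psi> 0) at_top"
        by (intro tendsto_intros)
      then have "((\<lambda>u. complex_of_real (- (2 / s) * \<Psi> (1 / u))) \<longlongrightarrow> of_real (- (2 / s) * \<Psi> 0)) at_top"
        by (rule tendsto_of_real)
      then show "((\<lambda>u. complex_of_real (- (2 / s) * \<Psi> (1 / u))) \<longlongrightarrow> 0) at_top"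
        by (simp add: \<Psi>_def)
      fix u assume u: "u \<ge> \<epsilon>"
      then have u0: "u > 0" using \<epsilon> by simp
      \<comment> \<open>Any interval with 1 / u in its interior would do; 2 / u is a convenient
        right end, and the derivative within it becomes a full derivative.\<close>
      have "(\<Psi> has_real_derivative h (1 / u)) (at (1 / u) within {0..2 / u})"
        unfolding \<Psi>_def by (rule integral_has_real_derivative[OF hc]) (use u0 in \<open>auto simp: field_simps\<close>)
      then have "(\<Psi> has_real_derivative h (1 / u)) (at (1 / u))"
        using u0 by (simp add: at_within_interior[of "1 / u" "{0..2 / u}"] divide_strict_right_mono)
      moreover have "((\<lambda>u. 1 / u) has_real_derivative - 1 / u\<^sup>2) (at u within {\<epsilon>..})"
        using u0 by (auto intro!: derivative_eq_intros simp: power2_eq_square)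
      ultimately have "((\<lambda>u. \<Psi> (1 / u)) has_real_derivative h (1 / u) * (- 1 / u\<^sup>2)) (at u within {\<epsilon>..})"
        by (rule DERIV_chain2)
      then have "((\<lambda>u. - (2 / s) * \<Psi> (1 / u)) has_real_derivative - (2 / s) * (h (1 / u) * (- 1 / u\<^sup>2))) (at u within {\<epsilon>..})"
        by (rule DERIV_cmult)
      also have "- (2 / s) * (h (1 / u) * (- 1 / u\<^sup>2)) = sin (A / u) * (2 * s / (s\<^sup>2 + u\<^sup>2)) / u"
      proof -
        have "(1 / u)\<^sup>2 + b\<^sup>2 = (s\<^sup>2 + u\<^sup>2) / (s\<^sup>2 * u\<^sup>2)"
          using s u0 by (simp add: b_def field_simps)
        then show ?thesis
          using s u0 by (simp add: h_def power2_eq_square)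
      qed
      finally show "((\<lambda>u. complex_of_real (- (2 / s) * \<Psi> (1 / u))) has_vector_derivative k u) (at u within {\<epsilon>..})"
        unfolding k by (rule has_vector_derivative_of_real)
    qed
    then show ?thesis by simp
  qed
  have "(\<Psi> \<longlongrightarrow> pi / 2 * exp (- A * b)) at_top"
    unfolding \<Psi>_def[abs_def] h_def by (rule laplace_sine_integral[OF A b])
  moreover have "filterlim (\<lambda>\<epsilon>::real. 1 / \<epsilon>) at_top (at_right 0)" by real_asymp
  ultimately have "((\<lambda>\<epsilon>. \<Psi> (1 / \<epsilon>)) \<longlongrightarrow> pi / 2 * exp (- A * b)) (at_right 0)"
    by (rule filterlim_compose)
  then have "((\<lambda>\<epsilon>. complex_of_real (2 / s * \<Psi> (1 / \<epsilon>))) \<longlongrightarrow> of_real (2 / s * (pi / 2 * exp (- A * b)))) (at_right 0)"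
    by (intro tendsto_of_real tendsto_mult tendsto_const)
  then have "((\<lambda>\<epsilon>. LBINT u:{\<epsilon><..}. k u) \<longlongrightarrow> of_real (2 / s * (pi / 2 * exp (- A * b)))) (at_right 0)"
    by (rule Lim_transform_eventually)
       (rule eventually_mono[OF eventually_at_right_less[of 0]], simp only: val)
  moreover have "2 / s * (pi / 2 * exp (- A * b)) = pi / s * exp (- A / s)"
    by (simp add: b_def)
  ultimately show ?thesis by (simp only: k_def)
qed

lemma laplace_bes_complex:
  fixes s A :: real
  assumes "s > 0" "A \<ge> 0"
  shows "(LBINT t:{0..}. complex_of_real (exp (- (s * t))) * of_real (bes (A * t))) = of_real (exp (- A / s) / s)"
proof -
  have "(LBINT t:{0..}. complex_of_real (exp (- (s * t))) * of_real (bes (A * t))) =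
      (LBINT t:{0..}. complex_of_real (exp (- s * t) * bes (A * t)))"
    by simp
  also have "\<dots> = of_real (LBINT t:{0..}. exp (- s * t) * bes (A * t))"
    by (rule set_integral_complex_of_real)
  finally show ?thesis by (simp only: laplace_bes(2)[OF assms])
qed

lemma fourier_add:
  assumes "tame_ex f" "tame_ex g"
  shows "fourier (\<lambda>u. f \<bar>u\<bar> + g \<bar>u\<bar>) x = fourier (\<lambda>u. f \<bar>u\<bar>) x + fourier (\<lambda>u. g \<bar>u\<bar>) x"
proof -
  obtain D f1 f2 f3 where f: "tame D f f1 f2 f3" using assms(1) unfolding tame_ex_def by blast
  obtain E g1 g2 g3 where g: "tame E g g1 g2 g3" using assms(2) unfolding tame_ex_def by blast
  show ?thesis
    unfolding fourier_def distrib_right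
    by (rule Bochner_Integration.integral_add[OF tame_fourier(1)[OF f] tame_fourier(1)[OF g]])
qed

lemma fourier_cmult:
  "fourier (\<lambda>u. c * f u) x = c * fourier f x"
  unfolding fourier_def mult.assoc by simp

text \<open>On exp (- s t) both sides equal pi / s * exp (- A / s). Since A is fixed, the bound on
  the difference of the two functionals may depend on A; uniformity in n enters only later, through
  the Bessel side.\<close>

lemma tame_sine_kernel_value:
  assumes tm: "tame D f f1 f2 f3" and C: "\<forall>t\<ge>0. norm (f3 t) \<le> C / (1 + t) ^ 7" and A: "A > 0"
  shows "((\<lambda>\<epsilon>. LBINT u:{\<epsilon><..}. of_real (sin (A / u)) * fourier (\<lambda>u. f \<bar>u\<bar>) u / of_real u)
     \<longlongrightarrow> of_real pi * (LBINT t:{0..}. f t * of_real (bes (A * t)))) (at_right 0)"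
proof -
  define k where "k f u = of_real (sin (A / u)) * fourier (\<lambda>u. f \<bar>u\<bar>) u / of_real u" for f u
  define L where "L f = Lim (at_right 0) (\<lambda>\<epsilon>. LBINT u:{\<epsilon><..}. k f u)" for f
  define b where "b f = (LBINT t:{0..}. f t * of_real (bes (A * t)))" for f :: "real \<Rightarrow> complex"
  obtain B where B: "\<And>T. \<bar>Si T\<bar> \<le> B" using bounded_Si by blast
  have int: "set_integrable lborel {\<epsilon><..} (k f)" if "\<epsilon> > 0" "tame_ex f" for \<epsilon> f
    using that tame_sine_kernel_limit(1)[OF _ A B] unfolding k_def[abs_def] tame_ex_def by blast
  have bint: "set_integrable lborel {0..} (\<lambda>t. f t * of_real (bes (A * t)))" if "tame_ex f" for f
    using that tame_bes_integrable(1) A unfolding tame_ex_def by fastforce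
  have Llim: "((\<lambda>\<epsilon>. LBINT u:{\<epsilon><..}. k f u) \<longlongrightarrow> L f) (at_right 0)"
    and Lbound: "norm (L f) \<le> (4 * B + 8 * (1 + A)) * D" if tm': "tame D f f1 f2 f3" for D f f1 f2 f3
  proof -
    obtain l where l: "((\<lambda>\<epsilon>. LBINT u:{\<epsilon><..}. k f u) \<longlongrightarrow> l) (at_right 0)" "norm l \<le> (4 * B + 8 * (1 + A)) * D"
      using tame_sine_kernel_limit(2)[OF tm' A B] unfolding k_def by blast
    moreover have "L f = l" unfolding L_def by (rule tendsto_Lim[OF _ l(1)]) simp
    ultimately show "((\<lambda>\<epsilon>. LBINT u:{\<epsilon><..}. k f u) \<longlongrightarrow> L f) (at_right 0)" "norm (L f) \<le> (4 * B + 8 * (1 + A)) * D"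
      by auto
  qed
  have Llim': "((\<lambda>\<epsilon>. LBINT u:{\<epsilon><..}. k f u) \<longlongrightarrow> L f) (at_right 0)" if "tame_ex f" for f
    using that Llim unfolding tame_ex_def by blast
  have "L f - of_real pi * b f = 0"
  proof (rule tame_functional_eq_zero[of "\<lambda>f. L f - of_real pi * b f", OF _ _ _ _ tm C])
    fix f g :: "real \<Rightarrow> complex" assume f: "tame_ex f" and g: "tame_ex g"
    have "((\<lambda>\<epsilon>. LBINT u:{\<epsilon><..}. k (\<lambda>t. f t + g t) u) \<longlongrightarrow> L f + L g) (at_right 0)"
    proof (rule Lim_transform_eventually[OF tendsto_add[OF Llim'[OF f] Llim'[OF g]]])
      have kadd: "k (\<lambda>t. f t + g t) = (\<lambda>u. k f u + k g u)"
        by (simp add: k_def fourier_add[OF f g] add_divide_distrib distrib_left fun_eq_iff)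
      show "\<forall>\<^sub>F \<epsilon> in at_right 0. (LBINT u:{\<epsilon><..}. k f u) + (LBINT u:{\<epsilon><..}. k g u) = (LBINT u:{\<epsilon><..}. k (\<lambda>t. f t + g t) u)"
        unfolding kadd
        by (rule eventually_mono[OF eventually_at_right_less[of 0]])
           (simp add: set_integral_add(2)[OF int[OF _ f] int[OF _ g]])
    qed
    then have "L (\<lambda>t. f t + g t) = L f + L g"
      unfolding L_def[of "\<lambda>t. f t + g t"] by (intro tendsto_Lim) auto
    moreover have "b (\<lambda>t. f t + g t) = b f + b g"
      unfolding b_def distrib_right by (rule set_integral_add(2)[OF bint[OF f] bint[OF g]])
    ultimately show "L (\<lambda>t. f t + g t) - of_real pi * b (\<lambda>t. f t + g t) = (L f - of_real pi * b f) + (L g - of_real pi * b g)"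
      by (simp add: algebra_simps)
  next
    fix c and f :: "real \<Rightarrow> complex" assume f: "tame_ex f"
    have kc: "k (\<lambda>t. c * f t) = (\<lambda>u. c * k f u)"
      by (simp add: k_def fourier_cmult fun_eq_iff)
    have "((\<lambda>\<epsilon>. LBINT u:{\<epsilon><..}. k (\<lambda>t. c * f t) u) \<longlongrightarrow> c * L f) (at_right 0)"
      unfolding kc set_integral_mult_right by (intro tendsto_mult_left Llim'[OF f])
    then have "L (\<lambda>t. c * f t) = c * L f"
      unfolding L_def[of "\<lambda>t. c * f t"] by (intro tendsto_Lim) auto
    moreover have "b (\<lambda>t. c * f t) = c * b f"
      unfolding b_def mult.assoc by (rule set_integral_mult_right)
    ultimately show "L (\<lambda>t. c * f t) - of_real pi * b (\<lambda>t. c * f t) = c * (L f - of_real pi * b f)"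
      by (simp add: algebra_simps)
  next
    fix D f f1 f2 f3 assume tm: "tame D f f1 f2 f3"
    have "norm (L f - of_real pi * b f) \<le> norm (L f) + norm (of_real pi * b f)"
      by (rule norm_triangle_ineq4)
    also have "\<dots> \<le> (4 * B + 8 * (1 + A)) * D + pi * D"
      using tame_bes_integrable(2)[OF tm, of A] A Lbound[OF tm]
      by (auto simp: norm_mult b_def intro!: add_mono)
    finally show "norm (L f - of_real pi * b f) \<le> (4 * B + 8 * (1 + A) + pi) * D"
      by (simp add: algebra_simps)
  next
    fix s :: real assume s: "s > 0"
    have "L (\<lambda>t. of_real (exp (- (s * t)))) = of_real (pi / s * exp (- A / s))"
      unfolding L_def k_def by (rule tendsto_Lim[OF _ sine_kernel_limit_exp[OF A s]]) simp
    moreover have "b (\<lambda>t. of_real (exp (- (s * t)))) = of_real (exp (- A / s) / s)"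
      unfolding b_def using A by (intro laplace_bes_complex s) simp
    ultimately show "L (\<lambda>t. of_real (exp (- (s * t)))) - of_real pi * b (\<lambda>t. of_real (exp (- (s * t)))) = 0"
      by simp
  qed
  then show ?thesis using Llim[OF tm] by (simp add: k_def b_def)
qed

section \<open>Bounds uniform in the test function, and the summation formula\<close>

lemma r2_0: "r2 0 = 1"
proof -
  have "{(a :: int, b :: int). a\<^sup>2 + b\<^sup>2 = int 0} = {(0, 0)}"
    by (auto simp: sum_power2_eq_zero_iff)
  then show ?thesis unfolding r2_def by simp
qed

text \<open>\<open>c\<close> is obtained before the function is chosen, so that the whole series is
  a bounded functional for the tame norm. The cubic decay is weakened to the exponent 3/2 so that
  both sides share one summable weight.\<close>

lemma tame_lattice_sum_bound:
  fixes y :: real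
  assumes y: "y > 0"
  obtains c where "c > 0"
    "\<And>D f f1 f2 f3 n. tame D f f1 f2 f3 \<Longrightarrow>
      norm (of_nat (r2 n) * f (real n * y)) \<le> D * (c * (real (r2 n) * (1 + real n) powr (-3/2)))"
proof
  \<comment> \<open>Compares the spacing y with 1: m (1 + n) <= 1 + n y.\<close>
  define m where "m = min 1 y"
  have m: "0 < m" "m \<le> 1" "m \<le> y" using y by (auto simp: m_def)
  show "1 / m ^ 3 > 0" using m by simp
  fix D f f1 f2 f3 n assume tm: "tame D f f1 f2 f3"
  have D: "D \<ge> 0" by (rule tame_nonneg[OF tm])
  have "m * (1 + real n) \<le> 1 + real n * y"
    using m mult_left_mono[of m y "real n"] by (simp add: algebra_simps)
  then have "(m * (1 + real n)) ^ 3 \<le> (1 + real n * y) ^ 3" using m by (intro power_mono) auto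
  then have *: "D / (1 + real n * y) ^ 3 \<le> D / (m * (1 + real n)) ^ 3"
    using D m y by (intro divide_left_mono) (auto intro!: mult_pos_pos add_pos_nonneg)
  have "norm (f (real n * y)) \<le> D / (1 + real n * y) ^ 3"
    using y by (intro tame_bounds(4)[OF tm]) simp
  also note *
  also have "D / (m * (1 + real n)) ^ 3 = D * (1 / m ^ 3 * (1 + real n) powr (-3))"
    using m by (simp add: power_mult_distrib powr_minus powr_realpow divide_inverse)
  also have "\<dots> \<le> D * (1 / m ^ 3 * (1 + real n) powr (-3/2))"
    using D m by (intro mult_left_mono powr_mono) auto
  finally have "norm (f (real n * y)) \<le> D * (1 / m ^ 3 * (1 + real n) powr (-3/2))" .
  from mult_left_mono[OF this, of "real (r2 n)"]
  show "norm (of_nat (r2 n) * f (real n * y)) \<le> D * (1 / m ^ 3 * (real (r2 n) * (1 + real n) powr (-3/2)))"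
    by (simp add: norm_mult mult_ac)
qed

lemma tame_dual_sum_bound:
  fixes y :: real
  assumes y: "y > 0"
  obtains c where "c > 0"
    "\<And>D f f1 f2 f3 n. tame D f f1 f2 f3 \<Longrightarrow>
      norm (of_nat (r2 (Suc n)) * (LBINT t:{0..}. f t * of_real (bes (pi\<^sup>2 * real (Suc n) / y * t))))
        \<le> D * (c * (real (r2 (Suc n)) * (1 + real (Suc n)) powr (-3/2)))"
proof
  \<comment> \<open>For indices n >= 1 one has 1 + n <= 2 n, hence p (1 + n) <= pi^2 n / y. The
    index 0 is left out because the decay estimate needs A > 0.\<close>
  define p where "p = pi\<^sup>2 / (2 * y)"
  have p: "p > 0" using y by (simp add: p_def)
  show "3 * p powr (-3/2) > 0" using p by simp
  fix D f f1 f2 f3 n assume tm: "tame D f f1 f2 f3"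
  have D: "D \<ge> 0" by (rule tame_nonneg[OF tm])
  have "p * (1 + real (Suc n)) \<le> p * (2 * real (Suc n))" using p by (intro mult_left_mono) auto
  also have "\<dots> = pi\<^sup>2 * real (Suc n) / y" using y by (simp add: p_def del: of_nat_Suc)
  finally have "p * (1 + real (Suc n)) \<le> pi\<^sup>2 * real (Suc n) / y" .
  then have "(pi\<^sup>2 * real (Suc n) / y) powr (-3/2) \<le> (p * (1 + real (Suc n))) powr (-3/2)"
    using p by (intro powr_mono2') auto
  also have "\<dots> = p powr (-3/2) * (1 + real (Suc n)) powr (-3/2)"
    by (rule powr_mult)
  finally have *: "(pi\<^sup>2 * real (Suc n) / y) powr (-3/2) \<le> p powr (-3/2) * (1 + real (Suc n)) powr (-3/2)" .
  have "norm (LBINT t:{0..}. f t * of_real (bes (pi\<^sup>2 * real (Suc n) / y * t))) \<le> 3 * D * (pi\<^sup>2 * real (Suc n) / y) powr (-3/2)"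
    using y by (intro tame_bes_integral_decay[OF tm]) simp
  also have "\<dots> \<le> 3 * D * (p powr (-3/2) * (1 + real (Suc n)) powr (-3/2))"
    using D * by (intro mult_left_mono) auto
  finally have "norm (LBINT t:{0..}. f t * of_real (bes (pi\<^sup>2 * real (Suc n) / y * t))) \<le>
      3 * D * (p powr (-3/2) * (1 + real (Suc n)) powr (-3/2))" .
  from mult_left_mono[OF this, of "real (r2 (Suc n))"]
  show "norm (of_nat (r2 (Suc n)) * (LBINT t:{0..}. f t * of_real (bes (pi\<^sup>2 * real (Suc n) / y * t))))
        \<le> D * (3 * p powr (-3/2) * (real (r2 (Suc n)) * (1 + real (Suc n)) powr (-3/2)))"
    by (simp add: norm_mult mult_ac)
qed

lemma tame_set_integrable:
  assumes tm: "tame D f f1 f2 f3"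
  shows "set_integrable lborel {0..} f" and "norm (LBINT t:{0..}. f t) \<le> D"
proof -
  \<comment> \<open>With A = 0 the kernel is constant, so the plain integral is covered by the
    Bessel estimates.\<close>
  have "bes 0 = 1" unfolding bes_def powser_zero by (simp add: bes_coeff_def)
  then show "set_integrable lborel {0..} f" "norm (LBINT t:{0..}. f t) \<le> D"
    using tame_bes_integrable[OF tm, of 0] by simp_all
qed

text \<open>This is Poisson summation over the lattice Z^2 for the radial function f (y |x|^2),
  whose planar Fourier transform at squared frequency n is pi / y times the Bessel integral.
  Frequency 0 gives the plain integral. On exponentials the two sides reduce to
  \<open>r2_exp_sums\<close>.\<close>

theorem tame_poisson_summation:
  assumes tm: "tame D f f1 f2 f3" and C: "\<forall>t\<ge>0. norm (f3 t) \<le> C / (1 + t) ^ 7" and y: "y > 0"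
  shows "summable (\<lambda>n. of_nat (r2 n) * f (real n * y))"
    and "summable (\<lambda>n. of_nat (r2 (Suc n)) * (LBINT t:{0..}. f t * of_real (bes (pi\<^sup>2 * real (Suc n) / y * t))))"
    and "(\<Sum>n. of_nat (r2 n) * f (real n * y)) = of_real (pi / y) * ((LBINT t:{0..}. f t) +
      (\<Sum>n. of_nat (r2 (Suc n)) * (LBINT t:{0..}. f t * of_real (bes (pi\<^sup>2 * real (Suc n) / y * t)))))"
proof -
  define A where "A n = pi\<^sup>2 * real n / y" for n
  have A: "A n \<ge> 0" for n using y by (simp add: A_def)
  define b where "b n f = (LBINT t:{0..}. f t * of_real (bes (A n * t)))" for n and f :: "real \<Rightarrow> complex"
  define w where "w n = real (r2 n) * (1 + real n) powr (-3/2)" for n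
  have w: "summable w" "summable (\<lambda>n. w (Suc n))"
    using summable_r2_powr summable_Suc_iff[of w] by (simp_all only: w_def[abs_def])
  obtain c where c: "c > 0" "\<And>D f f1 f2 f3 n. tame D f f1 f2 f3 \<Longrightarrow>
      norm (of_nat (r2 n) * f (real n * y)) \<le> D * (c * w n)"
    using tame_lattice_sum_bound[OF y] unfolding w_def by blast
  obtain d where d: "d > 0" "\<And>D f f1 f2 f3 n. tame D f f1 f2 f3 \<Longrightarrow>
      norm (of_nat (r2 (Suc n)) * b (Suc n) f) \<le> D * (d * w (Suc n))"
    using tame_dual_sum_bound[OF y] unfolding w_def b_def A_def by blast
  have bint: "set_integrable lborel {0..} (\<lambda>t. f t * of_real (bes (A n * t)))" if "tame_ex f" for f n
    using that tame_bes_integrable(1) A unfolding tame_ex_def by blast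
  have sum1: "summable (\<lambda>n. of_nat (r2 n) * f (real n * y))"
    and bound1: "norm (\<Sum>n. of_nat (r2 n) * f (real n * y)) \<le> D * (c * suminf w)" if "tame D f f1 f2 f3" for D f f1 f2 f3
  proof -
    have sw: "summable (\<lambda>n. D * (c * w n))" by (intro summable_mult w)
    show "summable (\<lambda>n. of_nat (r2 n) * f (real n * y))"
      by (rule summable_comparison_test'[OF sw c(2)[OF that]])
    have "norm (\<Sum>n. of_nat (r2 n) * f (real n * y)) \<le> (\<Sum>n. D * (c * w n))"
      by (rule norm_suminf_le[OF c(2)[OF that] sw])
    then show "norm (\<Sum>n. of_nat (r2 n) * f (real n * y)) \<le> D * (c * suminf w)"
      using w by (simp add: suminf_mult summable_mult)
  qed
  have sum2: "summable (\<lambda>n. of_nat (r2 (Suc n)) * b (Suc n) f)"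
    and bound2: "norm (\<Sum>n. of_nat (r2 (Suc n)) * b (Suc n) f) \<le> D * (d * (\<Sum>n. w (Suc n)))" if "tame D f f1 f2 f3" for D f f1 f2 f3
  proof -
    have sw: "summable (\<lambda>n. D * (d * w (Suc n)))" by (intro summable_mult w)
    show "summable (\<lambda>n. of_nat (r2 (Suc n)) * b (Suc n) f)"
      by (rule summable_comparison_test'[OF sw d(2)[OF that]])
    have "norm (\<Sum>n. of_nat (r2 (Suc n)) * b (Suc n) f) \<le> (\<Sum>n. D * (d * w (Suc n)))"
      by (rule norm_suminf_le[OF d(2)[OF that] sw])
    then show "norm (\<Sum>n. of_nat (r2 (Suc n)) * b (Suc n) f) \<le> D * (d * (\<Sum>n. w (Suc n)))"
      using w by (simp add: suminf_mult summable_mult)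
  qed
  have sum1': "summable (\<lambda>n. of_nat (r2 n) * f (real n * y))" and sum2': "summable (\<lambda>n. of_nat (r2 (Suc n)) * b (Suc n) f)"
    and int': "set_integrable lborel {0..} f" if "tame_ex f" for f
    using that sum1 sum2 tame_set_integrable(1) unfolding tame_ex_def by blast+
  define \<Phi> where "\<Phi> f = (\<Sum>n. of_nat (r2 n) * f (real n * y)) -
     of_real (pi / y) * ((LBINT t:{0..}. f t) + (\<Sum>n. of_nat (r2 (Suc n)) * b (Suc n) f))" for f
  have "\<Phi> f = 0"
  proof (rule tame_functional_eq_zero[of \<Phi>, OF _ _ _ _ tm C])
    fix f g :: "real \<Rightarrow> complex" assume f: "tame_ex f" and g: "tame_ex g"
    have "b n (\<lambda>t. f t + g t) = b n f + b n g" for n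
      unfolding b_def distrib_right by (rule set_integral_add(2)[OF bint[OF f] bint[OF g]])
    then have 1: "(\<Sum>n. of_nat (r2 (Suc n)) * b (Suc n) (\<lambda>t. f t + g t)) =
        (\<Sum>n. of_nat (r2 (Suc n)) * b (Suc n) f) + (\<Sum>n. of_nat (r2 (Suc n)) * b (Suc n) g)"
      using suminf_add[OF sum2'[OF f] sum2'[OF g]] by (simp only: distrib_left)
    have 2: "(\<Sum>n. of_nat (r2 n) * (f (real n * y) + g (real n * y))) =
        (\<Sum>n. of_nat (r2 n) * f (real n * y)) + (\<Sum>n. of_nat (r2 n) * g (real n * y))"
      using suminf_add[OF sum1'[OF f] sum1'[OF g]] by (simp only: distrib_left)
    show "\<Phi> (\<lambda>t. f t + g t) = \<Phi> f + \<Phi> g"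
      unfolding \<Phi>_def 1 2 set_integral_add(2)[OF int'[OF f] int'[OF g]] by (simp add: ring_distribs)
  next
    fix e and f :: "real \<Rightarrow> complex" assume f: "tame_ex f"
    have 1: "of_nat (r2 n) * b n (\<lambda>t. e * f t) = e * (of_nat (r2 n) * b n f)" for n
      unfolding b_def mult.assoc[of e] set_integral_mult_right by (simp add: mult_ac)
    have 2: "of_nat (r2 n) * (e * f (real n * y)) = e * (of_nat (r2 n) * f (real n * y))" for n
      by simp
    show "\<Phi> (\<lambda>t. e * f t) = e * \<Phi> f"
      unfolding \<Phi>_def 1 2 suminf_mult[OF sum1'[OF f]] suminf_mult[OF sum2'[OF f]] set_integral_mult_right
      by (simp add: algebra_simps)
  next
    fix D f f1 f2 f3 assume tm: "tame D f f1 f2 f3"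
    have "norm (\<Phi> f) \<le> norm (\<Sum>n. of_nat (r2 n) * f (real n * y)) +
        norm (of_real (pi / y) * ((LBINT t:{0..}. f t) + (\<Sum>n. of_nat (r2 (Suc n)) * b (Suc n) f)))"
      unfolding \<Phi>_def by (rule norm_triangle_ineq4)
    also have "\<dots> \<le> D * (c * suminf w) + pi / y * (D + D * (d * (\<Sum>n. w (Suc n))))"
    proof (intro add_mono bound1[OF tm])
      have "norm ((LBINT t:{0..}. f t) + (\<Sum>n. of_nat (r2 (Suc n)) * b (Suc n) f)) \<le> D + D * (d * (\<Sum>n. w (Suc n)))"
        by (intro order_trans[OF norm_triangle_ineq] add_mono tame_set_integrable(2)[OF tm] bound2[OF tm])
      then show "norm (of_real (pi / y) * ((LBINT t:{0..}. f t) + (\<Sum>n. of_nat (r2 (Suc n)) * b (Suc n) f)))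
          \<le> pi / y * (D + D * (d * (\<Sum>n. w (Suc n))))"
        unfolding norm_mult norm_of_real using y by (intro mult_mono) auto
    qed
    finally show "norm (\<Phi> f) \<le> (c * suminf w + pi / y * (1 + d * (\<Sum>n. w (Suc n)))) * D"
      by (simp add: algebra_simps)
  next
    fix s :: real assume s: "s > 0"
    obtain \<Theta> where \<Theta>: "(\<lambda>n. real (r2 n) * exp (- s * (real n * y))) sums (pi / (s * y) * \<Theta>)"
      "(\<lambda>n. real (r2 n) * exp (- (pi\<^sup>2 * real n / y) / s)) sums \<Theta>"
      by (rule r2_exp_sums[OF s y])
    have 1: "(\<Sum>n. of_nat (r2 n) * complex_of_real (exp (- (s * (real n * y))))) = of_real (pi / (s * y) * \<Theta>)"
      using sums_of_real[OF \<Theta>(1), where ?'a = complex] by (simp add: sums_iff)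
    have be: "b n (\<lambda>t. of_real (exp (- (s * t)))) = of_real (exp (- A n / s) / s)" for n
      unfolding b_def by (rule laplace_bes_complex[OF s A])
    \<comment> \<open>The term n = 0 of the dual theta series is r_0 = 1; it corresponds to the
      integral of f, which stands outside the series.\<close>
    have "(\<lambda>n. real (r2 (Suc n)) * exp (- A (Suc n) / s)) sums (\<Theta> - 1)"
      using \<Theta>(2) sums_Suc_iff[of "\<lambda>n. real (r2 n) * exp (- A n / s)" "\<Theta> - 1"] by (simp add: A_def r2_0)
    from sums_divide[OF this, of s]
    have "(\<lambda>n. real (r2 (Suc n)) * (exp (- A (Suc n) / s) / s)) sums ((\<Theta> - 1) / s)" by simp
    from sums_of_real[OF this, where ?'a = complex]
    have 2: "(\<Sum>n. of_nat (r2 (Suc n)) * b (Suc n) (\<lambda>t. of_real (exp (- (s * t))))) = of_real ((\<Theta> - 1) / s)"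
      unfolding be by (simp add: sums_iff)
    have "bes 0 = 1" unfolding bes_def powser_zero by (simp add: bes_coeff_def)
    then have 3: "(LBINT t:{0..}. complex_of_real (exp (- (s * t)))) = of_real (1 / s)"
      using laplace_bes_complex[OF s, of 0] by simp
    have "pi / (s * y) * \<Theta> = pi / y * (1 / s + (\<Theta> - 1) / s)"
      using s y by (simp add: field_simps)
    then have "complex_of_real (pi / (s * y) * \<Theta>) = of_real (pi / y * (1 / s + (\<Theta> - 1) / s))"
      by (rule arg_cong)
    then show "\<Phi> (\<lambda>t. of_real (exp (- (s * t)))) = 0"
      unfolding \<Phi>_def 1 2 3 by (simp only: of_real_mult of_real_add diff_self)
  qed
  then show "(\<Sum>n. of_nat (r2 n) * f (real n * y)) = of_real (pi / y) * ((LBINT t:{0..}. f t) +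
      (\<Sum>n. of_nat (r2 (Suc n)) * (LBINT t:{0..}. f t * of_real (bes (pi\<^sup>2 * real (Suc n) / y * t)))))"
    unfolding \<Phi>_def b_def A_def by simp
  show "summable (\<lambda>n. of_nat (r2 n) * f (real n * y))" by (rule sum1[OF tm])
  show "summable (\<lambda>n. of_nat (r2 (Suc n)) * (LBINT t:{0..}. f t * of_real (bes (pi\<^sup>2 * real (Suc n) / y * t))))"
    using sum2[OF tm] unfolding b_def A_def .
qed

section \<open>From the Schwartz class to tame functions\<close>

lemma polynomial_decay_of_limit:
  fixes g :: "real \<Rightarrow> complex"
  assumes g: "continuous_on {0..} g" and lim: "((\<lambda>t. of_real (t ^ m) * g t) \<longlongrightarrow> 0) at_top"
  obtains C where "\<And>t. t \<ge> 0 \<Longrightarrow> norm (g t) \<le> C / (1 + t) ^ m"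
proof -
  have "eventually (\<lambda>t. norm (of_real (t ^ m) * g t) < 1) at_top"
    using tendstoD[OF lim, of 1] by simp
  then obtain T0 where T0: "\<And>t. t \<ge> T0 \<Longrightarrow> norm (of_real (t ^ m) * g t) < 1"
    unfolding eventually_at_top_linorder by blast
  \<comment> \<open>T >= 1 gives 1 + t <= 2 t beyond T, whence the constant 2^m there; on [0, T]
    compactness provides \<open>B\<close>.\<close>
  define T where "T = max 1 T0"
  have "compact ((\<lambda>t. of_real ((1 + t) ^ m) * g t) ` {0..T})"
    by (intro compact_continuous_image continuous_intros continuous_on_subset[OF g]) auto
  from compact_imp_bounded[OF this]
  obtain B where "\<forall>z\<in>(\<lambda>t. of_real ((1 + t) ^ m) * g t) ` {0..T}. norm z \<le> B"
    unfolding bounded_iff by blast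
  then have B: "norm (of_real ((1 + t) ^ m) * g t) \<le> B" if "t \<in> {0..T}" for t
    using that by blast
  have "norm (g t) \<le> max B (2 ^ m) / (1 + t) ^ m" if t: "t \<ge> 0" for t
  proof -
    have "norm (of_real ((1 + t) ^ m) * g t) \<le> max B (2 ^ m)"
    proof (cases "t \<le> T")
      case True
      then show ?thesis using B[of t] t by auto
    next
      case False
      then have t1: "t \<ge> 1" "t \<ge> T0" by (auto simp: T_def)
      have "norm (of_real ((1 + t) ^ m) * g t) \<le> norm (of_real ((2 * t) ^ m) * g t)"
      proof -
        have "\<bar>(1 + t) ^ m\<bar> \<le> \<bar>(2 * t) ^ m\<bar>"
          unfolding power_abs using t1 by (intro power_mono) auto
        then show ?thesis
          unfolding norm_mult norm_of_real by (intro mult_right_mono) auto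
      qed
      also have "\<dots> = 2 ^ m * norm (of_real (t ^ m) * g t)"
        using t1 by (simp add: norm_mult norm_power power_mult_distrib)
      also have "\<dots> \<le> 2 ^ m * 1" using T0[OF t1(2)] by (intro mult_left_mono) auto
      finally show ?thesis by simp
    qed
    moreover have "norm (of_real ((1 + t) ^ m) * g t) = (1 + t) ^ m * norm (g t)"
      unfolding norm_mult norm_of_real using t by simp
    ultimately show ?thesis using t by (simp add: pos_le_divide_eq mult.commute)
  qed
  then show ?thesis by (rule that)
qed

lemma schwartz_nonpos_tame:
  assumes F: "F \<in> schwartz_nonpos"
  obtains D C f1 f2 f3 where "tame D (\<lambda>t. F (- t)) f1 f2 f3" "\<forall>t\<ge>0. norm (f3 t) \<le> C / (1 + t) ^ 7"
proof -
  \<comment> \<open>The sign makes \<open>f (Suc j)\<close> the derivative of \<open>f j\<close>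
    after reflection, one-sided at 0 like the derivatives on the negative half-line.\<close>
  define f where "f j t = (- 1) ^ j * deriv_nonpos j F (- t)" for j t
  have smooth: "deriv_nonpos j F differentiable (at t within {..0})" if "t \<le> 0" for j t
    using F that by (auto simp: schwartz_nonpos_def smooth_nonpos_def)
  have decay: "((\<lambda>t. of_real (\<bar>t\<bar> ^ m) * deriv_nonpos j F t) \<longlongrightarrow> 0) at_bot" for j m
    using F by (auto simp: schwartz_nonpos_def)
  have d: "(f j has_vector_derivative f (Suc j) t) (at t within {0..})" if t: "t \<ge> 0" for j t
  proof -
    have "(deriv_nonpos j F has_vector_derivative deriv_nonpos (Suc j) F (- t)) (at (- t) within {..0})"
      using smooth[of "- t" j] t by (simp add: vector_derivative_works)
    then have "(deriv_nonpos j F has_vector_derivative deriv_nonpos (Suc j) F (- t)) (at (- t) within uminus ` {0..})"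
      by (simp del: deriv_nonpos.simps)
    moreover have "(uminus has_vector_derivative (-1)) (at t within {0..})"
      by (auto intro!: derivative_eq_intros)
    ultimately have "((deriv_nonpos j F \<circ> uminus) has_vector_derivative (-1) *\<^sub>R deriv_nonpos (Suc j) F (- t)) (at t within {0..})"
      by (intro vector_diff_chain_within)
    from has_vector_derivative_mult_right[OF this, of "(- 1) ^ j"]
    show ?thesis by (simp add: f_def[abs_def] o_def del: deriv_nonpos.simps)
  qed
  have c: "continuous_on {0..} (f j)" for j
    unfolding continuous_on_eq_continuous_within using d has_vector_derivative_continuous by (meson atLeast_iff)
  have lim: "((\<lambda>t. of_real (t ^ m) * f j t) \<longlongrightarrow> 0) at_top" for j m
  proof -
    have "((\<lambda>t. (- 1) ^ j * (of_real (\<bar>- t\<bar> ^ m) * deriv_nonpos j F (- t))) \<longlongrightarrow> 0) at_top"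
      by (intro tendsto_mult_right_zero filterlim_compose[OF decay filterlim_uminus_at_bot_at_top])
    then show ?thesis
      by (rule Lim_transform_eventually)
         (rule eventually_mono[OF eventually_ge_at_top[of 0]], simp add: f_def mult_ac)
  qed
  \<comment> \<open>Exponent 7 serves the density argument, exponent 6 below the norm.\<close>
  obtain C where C: "\<And>t. t \<ge> 0 \<Longrightarrow> norm (f 3 t) \<le> C / (1 + t) ^ 7"
    using polynomial_decay_of_limit[OF c[of 3] lim[where j = 3 and m = 7]] by blast
  obtain D where D: "\<And>t. t \<ge> 0 \<Longrightarrow> norm (f 3 t) \<le> D / (1 + t) ^ 6"
    using polynomial_decay_of_limit[OF c[of 3] lim[where j = 3 and m = 6]] by blast
  have "tame D (f 0) (f 1) (f 2) (f 3)"
    unfolding tame_def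
    using d[of _ 0] d[of _ 1] d[of _ 2] lim[of 0] c D
    by (simp add: numeral_2_eq_2 numeral_3_eq_3)
  moreover have "f 0 = (\<lambda>t. F (- t))" by (simp add: f_def fun_eq_iff)
  ultimately show ?thesis using that C by metis
qed

theorem mainTheorem7:
  fixes F :: "real \<Rightarrow> complex" and y :: real
  assumes "F \<in> schwartz_nonpos" and "y > 0"
  shows "summable (\<lambda>n. of_nat (r2 n) * even_ext F (real n * y)) \<and>
    set_integrable lborel {0..} (even_ext F) \<and>
    (\<forall>x. integrable lborel (\<lambda>u. even_ext F u * exp (- (\<i> * of_real x * of_real u)))) \<and>
    (\<forall>n\<ge>1. improper_convergent (sine_kernel_integrand (even_ext F) y n)) \<and>
    summable (\<lambda>n. of_nat (r2 (Suc n)) *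
      improper_integral (sine_kernel_integrand (even_ext F) y (Suc n))) \<and>
    (\<Sum>n. of_nat (r2 n) * even_ext F (real n * y)) =
      of_real (pi / y) * (LBINT u:{0..}. even_ext F u) +
      of_real (1 / y) * (\<Sum>n. of_nat (r2 (Suc n)) *
        improper_integral (sine_kernel_integrand (even_ext F) y (Suc n)))"
proof -
  have y: "y > 0" by fact
  define f where "f t = F (- t)" for t
  obtain D C f1 f2 f3 where tm: "tame D f f1 f2 f3" and C: "\<forall>t\<ge>0. norm (f3 t) \<le> C / (1 + t) ^ 7"
    using schwartz_nonpos_tame[OF assms(1)] unfolding f_def by metis
  have ext: "even_ext F = (\<lambda>u. f \<bar>u\<bar>)"
    by (simp add: even_ext_def f_def fun_eq_iff)
  have ind: "indicator {0..} u *\<^sub>R f \<bar>u\<bar> = indicator {0..} u *\<^sub>R f u" for u :: real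
    by (auto simp: indicator_def)
  define A where "A n = pi\<^sup>2 * real n / y" for n
  have A: "A n > 0" if "n \<ge> 1" for n using that y by (simp add: A_def)
  have ker: "sine_kernel_integrand (even_ext F) y n = (\<lambda>u. of_real (sin (A n / u)) * fourier (\<lambda>u. f \<bar>u\<bar>) u / of_real u)" for n
    by (simp add: sine_kernel_integrand_def ext A_def fun_eq_iff)
  obtain B where B: "\<And>T. \<bar>Si T\<bar> \<le> B" using bounded_Si by blast
  note val = tame_sine_kernel_value[OF tm C A]
  have conv: "improper_convergent (sine_kernel_integrand (even_ext F) y n)" if "n \<ge> 1" for n
    unfolding improper_convergent_def ker
    using tame_sine_kernel_limit(1)[OF tm A[OF that] B] val[OF that] by blast
  have impr: "improper_integral (sine_kernel_integrand (even_ext F) y n) =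
      of_real pi * (LBINT t:{0..}. f t * of_real (bes (A n * t)))" if "n \<ge> 1" for n
    unfolding improper_integral_def ker by (rule tendsto_Lim[OF _ val[OF that]]) simp
  \<comment> \<open>Each sine integral carries a factor pi, so the prefactor 1 / y of the sine
    series and the prefactor pi / y of the integral of F become the common factor of the Poisson
    formula.\<close>
  have summand: "of_nat (r2 (Suc n)) * improper_integral (sine_kernel_integrand (even_ext F) y (Suc n)) =
      of_real pi * (of_nat (r2 (Suc n)) * (LBINT t:{0..}. f t * of_real (bes (pi\<^sup>2 * real (Suc n) / y * t))))" for n
    using impr[of "Suc n"] by (simp add: A_def mult_ac)
  note poisson = tame_poisson_summation[OF tm C y]
  have lat: "even_ext F (real n * y) = f (real n * y)" for n
    using y by (simp add: ext)
  have int: "(LBINT u:{0..}. even_ext F u) = (LBINT u:{0..}. f u)"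
    unfolding set_lebesgue_integral_def ext ind ..
  show ?thesis
  proof (intro conjI allI impI)
    show "summable (\<lambda>n. of_nat (r2 n) * even_ext F (real n * y))"
      unfolding lat by (rule poisson(1))
    show "set_integrable lborel {0..} (even_ext F)"
      using tame_set_integrable(1)[OF tm] unfolding set_integrable_def ext ind .
    show "integrable lborel (\<lambda>u. even_ext F u * exp (- (\<i> * of_real x * of_real u)))" for x
      unfolding ext by (rule tame_fourier(1)[OF tm])
    show "improper_convergent (sine_kernel_integrand (even_ext F) y n)" if "n \<ge> 1" for n
      by (rule conv[OF that])
    show "summable (\<lambda>n. of_nat (r2 (Suc n)) * improper_integral (sine_kernel_integrand (even_ext F) y (Suc n)))"
      unfolding summand by (rule summable_mult[OF poisson(2)])
    show "(\<Sum>n. of_nat (r2 n) * even_ext F (real n * y)) =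
      of_real (pi / y) * (LBINT u:{0..}. even_ext F u) +
      of_real (1 / y) * (\<Sum>n. of_nat (r2 (Suc n)) *
        improper_integral (sine_kernel_integrand (even_ext F) y (Suc n)))"
      unfolding lat int summand suminf_mult[OF poisson(2)] poisson(3) by (simp add: distrib_left)
  qed
qed

end
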